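(* Let $d\ge 1$ and $k\ge 1$ be integers, let $\mathcal{H}_A\cong\mathbb{C}^d$, and let $k\text{-}\mathbb{SNBC}$ denote the set of $k$-Schmidt-number-breaking channels on $\mathcal{L}(\mathcal{H}_A)$. For every quantum channel $\mathcal{N}:\mathcal{L}(\mathcal{H}_A)\to\mathcal{L}(\mathcal{H}_A)$ with $\mathcal{N}\notin k\text{-}\mathbb{SNBC}$, there exists a semiquantum signaling game for which the average payoff satisfies $\mathscr{J}_{\mathrm{avg}}(\mathcal{N})<0$, while $\mathscr{J}_{\mathrm{avg}}(\mathcal{E})\ge 0$ for all $\mathcal{E}\in k\text{-}\mathbb{SNBC}$. That is, there is a game such that: (i) there exists a measurement $M$ of Bob with $\mathscr{J}_{\mathrm{avg}}(\mathcal{N};M)<0$; and (ii) for every $\mathcal{E}\in k\text{-}\mathbb{SNBC}$ and every measurement $M$ of Bob, $\mathscr{J}_{\mathrm{avg}}(\mathcal{E};M)\ge 0$.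
   Context: All Hilbert spaces are finite-dimensional complex; $\mathcal{L}(\mathcal{H})$ is the space of linear operators on $\mathcal{H}$ and $\mathcal{D}(\mathcal{H})$ the set of density operators (positive semidefinite, trace one). A quantum channel on $\mathcal{L}(\mathcal{H})$ is a linear, completely positive, trace-preserving map $\mathcal{L}(\mathcal{H})\to\mathcal{L}(\mathcal{H})$. Schmidt number. The Schmidt rank $\mathrm{SR}(|\psi\rangle)$ of a unit vector $|\psi\rangle\in\mathbb{C}^{m}\otimes\mathbb{C}^{n}$ is the number of nonzero coefficients in its Schmidt decomposition. The Schmidt number of $\rho\in\mathcal{D}(\mathbb{C}^{m}\otimes\mathbb{C}^{n})$ is $$\mathrm{SN}(\rho)=\min_{\{p_j,|\psi_j\rangle\}}\max_j \mathrm{SR}(|\psi_j\rangle),$$ the minimum being over all decompositions $\rho=\sum_j p_j|\psi_j\rangle\langle\psi_j|$ with $\{p_j\}$ a probability vector and $|\psi_j\rangle$ unit vectors in $\mathbb{C}^{m}\otimes\mathbb{C}^{n}$. $k$-SNB channels. A channel $\mathcal{E}$ on $\mathcal{L}(\mathbb{C}^{d})$ is $k$-Schmidt-number-breaking ($k$-SNB) if $\mathrm{SN}[(\mathbf{id}\otimes\mathcal{E})(\rho)]\le k$ for all $\rho\in\mathcal{D}(\mathbb{C}^{m}\otimes\mathbb{C}^{d})$ and all $m\ge 1$, where $\mathbf{id}$ is the identity channel on $\mathcal{L}(\mathbb{C}^{m})$. Semiquantum signaling game. A game consists of: a finite family of states $\{\psi_A^x\}_x\subset\mathcal{D}(\mathcal{H}_A)$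 and a finite family of states $\{\phi_B^y\}_y\subset\mathcal{D}(\mathcal{H}_B)$ for some finite-dimensional Hilbert space $\mathcal{H}_B$ (each family consisting of states that are not all mutually orthogonal); probability distributions $p(\psi_A^x)$ over $x$ and $p(\phi_B^y)$ over $y$; a finite set of outcomes $b$; and a real-valued payoff function $\mathscr{J}(b,x,y)$. The referee sends $\psi_A^x$ to Alice, who applies a channel $\mathcal{N}$ on $\mathcal{L}(\mathcal{H}_A)$; Bob receives the output $\mathcal{N}(\psi_A^x)$ together with $\phi_B^y$ from the referee, and performs a joint measurement (POVM) $M=\{\Pi^b_{AB}\}_b$ on $\mathcal{H}_A\otimes\mathcal{H}_B$ (i.e. $\Pi^b_{AB}\ge 0$, $\sum_b\Pi^b_{AB}=\mathbb{I}_{AB}$), reporting the outcome $b$. The resulting correlation is $$p(b|\psi_A^x,\phi_B^y)=\mathrm{Tr}\left[\left(\mathcal{N}(\psi_A^x)\otimes\phi_B^y\right)\Pi^b_{AB}\right],$$ and the average payoff is $$\mathscr{J}_{\mathrm{avg}}(\mathcal{N};M)=\sum_{b,x,y}\mathscr{J}(b,x,y)\,p(b|\psi_A^x,\phi_B^y)\,p(\psi_A^x)\,p(\phi_B^y).$$ *)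

theory Defs
  imports "Jordan_Normal_Form.Matrix" "Jordan_Normal_Form.Conjugate"
begin

text \<open>Operators on \<open>\<complex>\<^sup>n\<close> are complex \<open>n \<times> n\<close> matrices. The space \<open>\<complex>\<^sup>m \<otimes> \<complex>\<^sup>n\<close> is \<open>\<complex>\<close> to the
  power \<open>m * n\<close>, the basis vector \<open>e\<^sub>i \<otimes> e\<^sub>j\<close> having index \<open>i * n + j\<close>.\<close>

definition mat_trace :: "complex mat \<Rightarrow> complex" where
  "mat_trace A = (\<Sum>i<dim_row A. A $$ (i, i))"

definition mat_sum :: "nat \<Rightarrow> ('i \<Rightarrow> complex mat) \<Rightarrow> 'i set \<Rightarrow> complex mat" where
  "mat_sum n A I = mat n n (\<lambda>(i, j). \<Sum>a\<in>I. A a $$ (i, j))"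

definition vec_tensor :: "complex vec \<Rightarrow> complex vec \<Rightarrow> complex vec" (infixl \<open>\<otimes>\<^sub>v\<close> 70) where
  "u \<otimes>\<^sub>v v = vec (dim_vec u * dim_vec v) (\<lambda>i. u $ (i div dim_vec v) * v $ (i mod dim_vec v))"

definition mat_tensor :: "complex mat \<Rightarrow> complex mat \<Rightarrow> complex mat" (infixl \<open>\<otimes>\<^sub>m\<close> 70) where
  "A \<otimes>\<^sub>m B = mat (dim_row A * dim_row B) (dim_col A * dim_col B)
     (\<lambda>(i, j). A $$ (i div dim_row B, j div dim_col B) * B $$ (i mod dim_row B, j mod dim_col B))"

text \<open>The order on \<open>\<complex>\<close> is such that \<open>0 \<le> z\<close> means that \<open>z\<close> is real and nonnegative; over \<open>\<complex>\<close> the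
  condition below therefore includes self-adjointness.\<close>

definition psd :: "nat \<Rightarrow> complex mat \<Rightarrow> bool" where
  "psd n A \<longleftrightarrow> A \<in> carrier_mat n n \<and> (\<forall>v \<in> carrier_vec n. 0 \<le> (A *\<^sub>v v) \<bullet>c v)"

definition density_ops :: "nat \<Rightarrow> complex mat set" where
  "density_ops n = {\<rho>. psd n \<rho> \<and> mat_trace \<rho> = 1}"

definition unit_vectors :: "nat \<Rightarrow> complex vec set" where
  "unit_vectors n = {\<psi> \<in> carrier_vec n. \<psi> \<bullet>c \<psi> = 1}"

definition ket_bra :: "complex vec \<Rightarrow> complex mat" where
  "ket_bra \<psi> = mat (dim_vec \<psi>) (dim_vec \<psi>) (\<lambda>(i, j). \<psi> $ i * cnj (\<psi> $ j))"

definition prob_vector :: "nat \<Rightarrow> (nat \<Rightarrow> real) \<Rightarrow> bool" where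
  "prob_vector N p \<longleftrightarrow> (\<forall>i<N. 0 \<le> p i) \<and> (\<Sum>i<N. p i) = 1"


section \<open>Schmidt number\<close>

definition orthonormal_family :: "nat \<Rightarrow> nat \<Rightarrow> (nat \<Rightarrow> complex vec) \<Rightarrow> bool" where
  "orthonormal_family n q u \<longleftrightarrow>
     (\<forall>i<q. u i \<in> carrier_vec n) \<and> (\<forall>i<q. \<forall>j<q. u i \<bullet>c u j = (if i = j then 1 else 0))"

definition schmidt_decomposition ::
  "nat \<Rightarrow> nat \<Rightarrow> complex vec \<Rightarrow> nat \<Rightarrow> (nat \<Rightarrow> real) \<Rightarrow> (nat \<Rightarrow> complex vec) \<Rightarrow> (nat \<Rightarrow> complex vec) \<Rightarrow> bool"
where
  "schmidt_decomposition m n \<psi> q s u v \<longleftrightarrow>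
     orthonormal_family m q u \<and> orthonormal_family n q v \<and> (\<forall>i<q. 0 \<le> s i) \<and>
     \<psi> = vec (m * n) (\<lambda>a. \<Sum>i<q. complex_of_real (s i) * (u i \<otimes>\<^sub>v v i) $ a)"

text \<open>Every vector of \<open>\<complex>\<^sup>m \<otimes> \<complex>\<^sup>n\<close> has a Schmidt decomposition, and the number of nonzero coefficients
  is the same in all of them.\<close>

definition schmidt_rank :: "nat \<Rightarrow> nat \<Rightarrow> complex vec \<Rightarrow> nat" where
  "schmidt_rank m n \<psi> =
     (THE r. \<exists>q s u v. schmidt_decomposition m n \<psi> q s u v \<and> r = card {i. i < q \<and> s i \<noteq> 0})"

definition pure_decomposition ::
  "nat \<Rightarrow> complex mat \<Rightarrow> nat \<Rightarrow> (nat \<Rightarrow> real) \<Rightarrow> (nat \<Rightarrow> complex vec) \<Rightarrow> bool"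
where
  "pure_decomposition n \<rho> N p \<psi> \<longleftrightarrow>
     prob_vector N p \<and> (\<forall>j<N. \<psi> j \<in> unit_vectors n) \<and>
     \<rho> = mat_sum n (\<lambda>j. complex_of_real (p j) \<cdot>\<^sub>m ket_bra (\<psi> j)) {..<N}"

definition schmidt_number :: "nat \<Rightarrow> nat \<Rightarrow> complex mat \<Rightarrow> nat" where
  "schmidt_number m n \<rho> =
     (LEAST r. \<exists>N p \<psi>. pure_decomposition (m * n) \<rho> N p \<psi> \<and>
        r = Max ((\<lambda>j. schmidt_rank m n (\<psi> j)) ` {..<N}))"


section \<open>Channels\<close>

text \<open>A map between matrix spaces is a HOL function whose values outside \<open>carrier_mat d d\<close> are
  irrelevant.\<close>

definition linear_on_mats :: "nat \<Rightarrow> (complex mat \<Rightarrow> complex mat) \<Rightarrow> bool" where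
  "linear_on_mats d E \<longleftrightarrow>
     (\<forall>A \<in> carrier_mat d d. E A \<in> carrier_mat d d) \<and>
     (\<forall>A \<in> carrier_mat d d. \<forall>B \<in> carrier_mat d d. E (A + B) = E A + E B) \<and>
     (\<forall>c. \<forall>A \<in> carrier_mat d d. E (c \<cdot>\<^sub>m A) = c \<cdot>\<^sub>m E A)"

text \<open>An operator on \<open>\<complex>\<^sup>m \<otimes> \<complex>\<^sup>d\<close> is an \<open>m \<times> m\<close> array of \<open>d \<times> d\<close> blocks, and \<open>id \<otimes> E\<close> applies \<open>E\<close> to
  each block; lemma \<open>id_tensor_mat_tensor\<close> gives its values on product operators.\<close>

definition block :: "nat \<Rightarrow> complex mat \<Rightarrow> nat \<Rightarrow> nat \<Rightarrow> complex mat" where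
  "block d X i j = mat d d (\<lambda>(a, b). X $$ (i * d + a, j * d + b))"

definition id_tensor :: "nat \<Rightarrow> nat \<Rightarrow> (complex mat \<Rightarrow> complex mat) \<Rightarrow> complex mat \<Rightarrow> complex mat" where
  "id_tensor m d E X =
     mat (m * d) (m * d) (\<lambda>(a, b). E (block d X (a div d) (b div d)) $$ (a mod d, b mod d))"

lemma id_tensor_mat_tensor:
  assumes E: "linear_on_mats d E" and A: "A \<in> carrier_mat m m" and B: "B \<in> carrier_mat d d"
  shows "id_tensor m d E (A \<otimes>\<^sub>m B) = A \<otimes>\<^sub>m E B"
proof -
  have EB: "E B \<in> carrier_mat d d"
    using E B by (auto simp: linear_on_mats_def)
  have lt: "i * d + a < m * d" if "i < m" "a < d" for i a
  proof -
    have "i * d + a < Suc i * d" using that by simp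
    also have "\<dots> \<le> m * d" using that by (intro mult_le_mono1) simp
    finally show ?thesis .
  qed
  have blk: "block d (A \<otimes>\<^sub>m B) i j = A $$ (i, j) \<cdot>\<^sub>m B" if "i < m" "j < m" for i j
    by (rule eq_matI) (use that A B lt in \<open>auto simp: block_def mat_tensor_def\<close>)
  show ?thesis
  proof (rule eq_matI)
    fix a b assume "a < dim_row (A \<otimes>\<^sub>m E B)" "b < dim_col (A \<otimes>\<^sub>m E B)"
    then have ab: "a < m * d" "b < m * d"
      using A EB by (auto simp: mat_tensor_def)
    then have "0 < d" "a div d < m" "b div d < m"
      by (auto simp: less_mult_imp_div_less intro: Nat.gr0I)
    moreover have "E (c \<cdot>\<^sub>m B) = c \<cdot>\<^sub>m E B" for c
      using E B by (simp add: linear_on_mats_def)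
    moreover have "dim_row (E B) = d" "dim_col (E B) = d"
      using EB by auto
    ultimately have "id_tensor m d E (A \<otimes>\<^sub>m B) $$ (a, b) =
        A $$ (a div d, b div d) * E B $$ (a mod d, b mod d)"
      using ab by (simp add: id_tensor_def blk)
    then show "id_tensor m d E (A \<otimes>\<^sub>m B) $$ (a, b) = (A \<otimes>\<^sub>m E B) $$ (a, b)"
      using ab A EB by (simp add: mat_tensor_def)
  qed (use A EB in \<open>auto simp: id_tensor_def mat_tensor_def\<close>)
qed

definition completely_positive :: "nat \<Rightarrow> (complex mat \<Rightarrow> complex mat) \<Rightarrow> bool" where
  "completely_positive d E \<longleftrightarrow> (\<forall>m\<ge>1. \<forall>X. psd (m * d) X \<longrightarrow> psd (m * d) (id_tensor m d E X))"

definition quantum_channel :: "nat \<Rightarrow> (complex mat \<Rightarrow> complex mat) \<Rightarrow> bool" where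
  "quantum_channel d E \<longleftrightarrow>
     linear_on_mats d E \<and> completely_positive d E \<and>
     (\<forall>A \<in> carrier_mat d d. mat_trace (E A) = mat_trace A)"

definition SNBC :: "nat \<Rightarrow> nat \<Rightarrow> (complex mat \<Rightarrow> complex mat) set" where
  "SNBC k d =
     {E. quantum_channel d E \<and>
         (\<forall>m\<ge>1. \<forall>\<rho> \<in> density_ops (m * d). schmidt_number m d (id_tensor m d E \<rho>) \<le> k)}"


section \<open>Semiquantum signaling games\<close>

definition povm :: "nat \<Rightarrow> nat \<Rightarrow> (nat \<Rightarrow> complex mat) \<Rightarrow> bool" where
  "povm n N M \<longleftrightarrow> (\<forall>b<N. psd n (M b)) \<and> mat_sum n M {..<N} = 1\<^sub>m n"

text \<open>The labels \<open>x\<close>, \<open>y\<close> and the outcomes \<open>b\<close> range over initial segments of the natural numbers.\<close>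

record sq_game =
  dimB :: nat
  nX :: nat
  nY :: nat
  nOut :: nat
  stA :: "nat \<Rightarrow> complex mat"
  stB :: "nat \<Rightarrow> complex mat"
  prA :: "nat \<Rightarrow> real"
  prB :: "nat \<Rightarrow> real"
  payoff :: "nat \<Rightarrow> nat \<Rightarrow> nat \<Rightarrow> real"

definition not_all_orthogonal :: "nat \<Rightarrow> (nat \<Rightarrow> complex mat) \<Rightarrow> bool" where
  "not_all_orthogonal N \<sigma> \<longleftrightarrow> (\<exists>i<N. \<exists>j<N. \<sigma> i \<noteq> \<sigma> j \<and> mat_trace (\<sigma> i * \<sigma> j) \<noteq> 0)"

definition semiquantum_game :: "nat \<Rightarrow> sq_game \<Rightarrow> bool" where
  "semiquantum_game d G \<longleftrightarrow>
     (\<forall>x<nX G. stA G x \<in> density_ops d) \<and> not_all_orthogonal (nX G) (stA G) \<and>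
     (\<forall>y<nY G. stB G y \<in> density_ops (dimB G)) \<and> not_all_orthogonal (nY G) (stB G) \<and>
     prob_vector (nX G) (prA G) \<and> prob_vector (nY G) (prB G)"

text \<open>For channels, states and measurements the trace is a real number; \<open>Re\<close> only adjusts its type.\<close>

definition correlation ::
  "sq_game \<Rightarrow> (complex mat \<Rightarrow> complex mat) \<Rightarrow> (nat \<Rightarrow> complex mat) \<Rightarrow> nat \<Rightarrow> nat \<Rightarrow> nat \<Rightarrow> real"
where
  "correlation G E M b x y = Re (mat_trace ((E (stA G x) \<otimes>\<^sub>m stB G y) * M b))"

definition avg_payoff :: "sq_game \<Rightarrow> (complex mat \<Rightarrow> complex mat) \<Rightarrow> (nat \<Rightarrow> complex mat) \<Rightarrow> real" where
  "avg_payoff G E M =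
     (\<Sum>b<nOut G. \<Sum>x<nX G. \<Sum>y<nY G. payoff G b x y * correlation G E M b x y * prA G x * prB G y)"

end

theory Submission
  imports Defs "Jordan_Normal_Form.Spectral_Radius"
begin

text \<open>By the Choi correspondence a channel is \<open>k\<close>-Schmidt-number-breaking iff its Choi matrix, the image of
  the maximally entangled state, is a convex combination of pure states of Schmidt rank at most \<open>k\<close>.
  These pure states form a compact set, so by Caratheodory's theorem their convex hull is closed, and
  the Choi matrix of \<open>N\<close> is strictly separated from it by a witness \<open>W\<close>. Expanding \<open>W\<close> in product states
  \<open>\<psi>\<^sub>x \<otimes> \<phi>\<^sub>y\<close> gives the payoffs of the game. If Bob projects onto the maximally entangled
  state, the payoff is a positive multiple of \<open>Tr (W J)\<close>, where \<open>J\<close> is the Choi matrix. For an arbitrary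
  measurement, the effect \<open>\<Sum>\<^sub>m \<bar>\<mu>\<^sub>m\<rangle>\<langle>\<mu>\<^sub>m\<bar>\<close> acts on the Choi vectors of the channel as a local operator,
  which does not raise the Schmidt rank, so that \<open>W\<close> stays nonnegative.\<close>

subsection \<open>Linear dependence and separation from a convex hull\<close>

text \<open>\<open>schmidt_rank\<close> is a definite description and \<open>schmidt_number\<close>
  a minimum over decompositions, so both are traded for factorizations: a vector has Schmidt rank at
  most k iff its coefficient matrix is a sum of k products, and a state has Schmidt number at most k
  iff it is a Gram sum of such vectors, of arbitrary norm. In this form weights, zero vectors and
  local operators are harmless. The singular value decomposition serves twice: it yields Schmidt
  decompositions, and it bounds the factors of a low-rank unit vector, which could otherwise diverge
  along a convergent sequence of such vectors. Dimension 1 has to be treated apart: there is only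
  one state, so no family meets \<open>not_all_orthogonal\<close> and no game exists; but there
  every channel is Schmidt-number-breaking. Separation comes with a threshold c. As all states have
  trace one, c is absorbed into the diagonal of W, which makes the sign condition homogeneous. This
  matters because the vectors produced by Bob's effects are not normalized.\<close>

lemma linear_dependence:
  fixes f :: "'s \<Rightarrow> 'i \<Rightarrow> 'a::field"
  assumes "finite I" "finite S" "card I < card S"
  shows "\<exists>c. (\<exists>s\<in>S. c s \<noteq> 0) \<and> (\<forall>i\<in>I. (\<Sum>s\<in>S. c s * f s i) = 0)"
  using assms
proof (induction I arbitrary: S f rule: finite_induct)
  case empty
  then have "S \<noteq> {}" by auto
  then show ?case by (intro exI[of _ "\<lambda>_. 1"]) auto
next
  case (insert i I)
  show ?case
  proof (cases "\<forall>s\<in>S. f s i = 0")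
    case True
    have "card I < card S" using insert by simp
    from insert.IH[OF \<open>finite S\<close> this, of f] True show ?thesis by auto
  next
    case False
    then obtain s0 where s0: "s0 \<in> S" "f s0 i \<noteq> 0" by auto
    define S' where "S' = S - {s0}"
    have S': "finite S'" "card I < card S'" and SS: "S = insert s0 S'" "s0 \<notin> S'"
      using insert s0 by (auto simp: S'_def)
    obtain c where c: "\<exists>s\<in>S'. c s \<noteq> 0"
      "\<And>j. j \<in> I \<Longrightarrow> (\<Sum>s\<in>S'. c s * (f s j - f s i / f s0 i * f s0 j)) = 0"
      using insert.IH[OF S', of "\<lambda>s j. f s j - f s i / f s0 i * f s0 j"] by auto
    \<comment> \<open>Equation i is solved for the coefficient of the pivot s0. In the other
      equations the same value compensates the multiples of s0 subtracted before the induction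
      hypothesis was applied.\<close>
    define a where "a = - (\<Sum>s\<in>S'. c s * f s i) / f s0 i"
    let ?c = "c(s0 := a)"
    have sm: "(\<Sum>s\<in>S. ?c s * f s j) = a * f s0 j + (\<Sum>s\<in>S'. c s * f s j)" for j
    proof -
      have "(\<Sum>s\<in>S'. ?c s * f s j) = (\<Sum>s\<in>S'. c s * f s j)"
        using SS by (intro sum.cong) auto
      then show ?thesis using SS S' by simp
    qed
    have "(\<Sum>s\<in>S. ?c s * f s j) = 0" if "j \<in> insert i I" for j
    proof (cases "j = i")
      case True
      then show ?thesis using s0 by (subst sm) (simp add: a_def)
    next
      case False
      then have "0 = (\<Sum>s\<in>S'. c s * (f s j - f s i / f s0 i * f s0 j))"
        using c that by simp
      also have "\<dots> = (\<Sum>s\<in>S'. c s * f s j) - (\<Sum>s\<in>S'. (c s * f s i) * (f s0 j / f s0 i))"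
        by (simp add: algebra_simps sum_subtractf)
      also have "(\<Sum>s\<in>S'. (c s * f s i) * (f s0 j / f s0 i)) = - a * f s0 j"
        by (simp only: a_def sum_distrib_right[symmetric]) simp
      finally show ?thesis by (subst sm) (simp add: algebra_simps)
    qed
    moreover have "\<exists>s\<in>S. ?c s \<noteq> 0" using c(1) SS by auto
    ultimately show ?thesis by blast
  qed
qed

text \<open>The number L of points is a parameter because closedness of the hull rests on a bound
  for it. Functions are compared on I only, so P and the members of K may be arbitrary
  elsewhere.\<close>

definition convex_comb ::
  "nat \<Rightarrow> 'i set \<Rightarrow> ('i \<Rightarrow> real) set \<Rightarrow> ('i \<Rightarrow> real) \<Rightarrow> bool" where
  "convex_comb L I K P \<longleftrightarrow> (\<exists>c \<kappa>. (\<forall>l<L. 0 \<le> c l) \<and> (\<Sum>l<L. c l) = 1 \<and> (\<forall>l<L. \<kappa> l \<in> K) \<and>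
     (\<forall>i\<in>I. P i = (\<Sum>l<L. c l * \<kappa> l i)))"

text \<open>One step of Caratheodory's theorem: more than \<open>card I + 1\<close> points are
  affinely dependent, and moving the weights along the dependence until one of them vanishes frees a
  point.\<close>

lemma convex_comb_reduce:
  assumes I: "finite I" and L: "card I + 1 < Suc L" and P: "convex_comb (Suc L) I K P"
  shows "convex_comb L I K P"
proof -
  obtain c \<kappa> where c: "\<And>l. l < Suc L \<Longrightarrow> 0 \<le> c l" "(\<Sum>l<Suc L. c l) = 1"
    and \<kappa>: "\<And>l. l < Suc L \<Longrightarrow> \<kappa> l \<in> K" and Pe: "\<And>i. i \<in> I \<Longrightarrow> P i = (\<Sum>l<Suc L. c l * \<kappa> l i)"
    using P unfolding convex_comb_def by blast
  \<comment> \<open>The extra coordinate \<open>None\<close> with constant value 1 makes the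
    dependence affine: its coefficients b sum to zero, so subtracting a multiple of b keeps the
    total weight.\<close>
  define f where "f l i = (case i of None \<Rightarrow> 1 | Some j \<Rightarrow> \<kappa> l j)" for l :: nat and i
  have "card (insert None (Some ` I)) = card I + 1"
    using I by (simp add: card_image)
  then have "card (insert None (Some ` I)) < card {..<Suc L}" using L by simp
  from linear_dependence[OF _ _ this, of f] I obtain b where
    b0: "\<exists>l<Suc L. b l \<noteq> 0" and
    b: "\<And>i. i \<in> insert None (Some ` I) \<Longrightarrow> (\<Sum>l<Suc L. b l * f l i) = 0"
    by auto
  have bs: "(\<Sum>l<Suc L. b l) = 0" using b[of None] by (simp add: f_def)
  have bI: "(\<Sum>l<Suc L. b l * \<kappa> l i) = 0" if "i \<in> I" for i
    using b[of "Some i"] that by (simp add: f_def)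
  define T where "T = {l. l < Suc L \<and> b l > 0}"
  have "T \<noteq> {}"
  proof
    assume "T = {}"
    then have "0 \<le> - b l" if "l < Suc L" for l
      using that by (force simp: T_def)
    then have "\<forall>l\<in>{..<Suc L}. 0 \<le> - b l" by blast
    moreover have "(\<Sum>l<Suc L. - b l) = 0" using bs by (simp only: sum_negf minus_zero)
    ultimately have "\<forall>l\<in>{..<Suc L}. - b l = 0"
      using sum_nonneg_eq_0_iff[of "{..<Suc L}" "\<lambda>l. - b l"] by blast
    then show False using b0 by auto
  qed
  moreover have finT: "finite T" by (simp add: T_def)
  \<comment> \<open>The largest t for which all \<open>c l - t * b l\<close> stay nonnegative; the
    weight at the minimizer l0 becomes 0.\<close>
  define t where "t = Min ((\<lambda>l. c l / b l) ` T)"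
  have "t \<in> (\<lambda>l. c l / b l) ` T" unfolding t_def using finT \<open>T \<noteq> {}\<close> by (intro Min_in) auto
  then obtain l0 where l0: "l0 \<in> T" "t = c l0 / b l0" by auto
  have tle: "t \<le> c l / b l" if "l \<in> T" for l
    unfolding t_def using finT that by (intro Min_le) auto
  have t0: "0 \<le> t" using l0 c(1)[of l0] by (auto simp: T_def)
  define c' where "c' l = c l - t * b l" for l
  have c': "0 \<le> c' l" if "l < Suc L" for l
  proof (cases "l \<in> T")
    case True
    then show ?thesis using tle[OF True] by (auto simp: c'_def T_def field_simps)
  next
    case False
    then have "t * b l \<le> 0" using t0 that by (auto simp: T_def mult_nonneg_nonpos)
    then show ?thesis using c(1)[OF that] by (simp add: c'_def)
  qed
  have c'0: "c' l0 = 0" using l0 by (auto simp: c'_def T_def)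
  have l0L: "l0 \<le> L" using l0 by (auto simp: T_def)
  \<comment> \<open>Index l0 has become free, and L is moved into its place.\<close>
  define \<pi> where "\<pi> l = (if l = l0 then L else l)" for l
  have re: "(\<Sum>l<L. g (\<pi> l)) = (\<Sum>l<Suc L. g l)" if "g l0 = 0" for g :: "nat \<Rightarrow> real"
  proof -
    have "(\<Sum>l<Suc L. g l) = (\<Sum>l\<in>{..<Suc L} - {l0}. g l)"
      using l0L that by (subst sum.remove[of _ l0]) auto
    also have "\<dots> = (\<Sum>l<L. g (\<pi> l))"
      by (rule sum.reindex_bij_witness[of _ \<pi> "\<lambda>l. if l = L then l0 else l"])
        (use l0L in \<open>auto simp: \<pi>_def split: if_splits\<close>)
    finally show ?thesis by simp
  qed
  have "(\<Sum>l<L. c' (\<pi> l)) = 1"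
    using re[of c', OF c'0] c(2) bs
    by (simp only: c'_def sum_subtractf sum_distrib_left[symmetric] mult_zero_right diff_zero)
  moreover have "P i = (\<Sum>l<L. c' (\<pi> l) * \<kappa> (\<pi> l) i)" if "i \<in> I" for i
  proof -
    have "(\<Sum>l<L. c' (\<pi> l) * \<kappa> (\<pi> l) i) = (\<Sum>l<Suc L. c' l * \<kappa> l i)"
      using re[of "\<lambda>l. c' l * \<kappa> l i"] c'0 by simp
    also have "\<dots> = (\<Sum>l<Suc L. c l * \<kappa> l i) - t * (\<Sum>l<Suc L. b l * \<kappa> l i)"
      by (simp only: c'_def sum_subtractf sum_distrib_left left_diff_distrib mult.assoc)
    finally show ?thesis using Pe[OF that] bI[OF that] by simp
  qed
  moreover have "\<pi> l < Suc L" if "l < L" for l using that by (simp add: \<pi>_def)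
  ultimately show ?thesis
    unfolding convex_comb_def using c' \<kappa>
    by (intro exI[of _ "\<lambda>l. c' (\<pi> l)"] exI[of _ "\<lambda>l. \<kappa> (\<pi> l)"]) auto
qed

section \<open>Compactness of convex hulls in finitely many coordinates, and the nearest
  point\<close>

lemma bounded_real_subseq:
  fixes f :: "nat \<Rightarrow> real"
  assumes "\<And>n. \<bar>f n\<bar> \<le> B"
  shows "\<exists>r l. strict_mono r \<and> (\<lambda>n. f (r n)) \<longlonglongrightarrow> l"
proof -
  obtain r :: "nat \<Rightarrow> nat" where r: "strict_mono r" "monoseq (\<lambda>n. f (r n))"
    using seq_monosub[of f] by auto
  have "Bseq (\<lambda>n. f (r n))" using assms by (intro BseqI'[of _ B]) auto
  then show ?thesis
    using Bseq_monoseq_convergent[of "\<lambda>n. f (r n)"] r unfolding convergent_def by blast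
qed

lemma bounded_complex_subseq:
  fixes f :: "nat \<Rightarrow> complex"
  assumes "\<And>n. norm (f n) \<le> B"
  shows "\<exists>r l. strict_mono r \<and> (\<lambda>n. f (r n)) \<longlonglongrightarrow> l"
proof -
  have "\<bar>Re (f n)\<bar> \<le> B" for n using abs_Re_le_cmod assms order_trans by blast
  then obtain r a where r: "strict_mono r" "(\<lambda>n. Re (f (r n))) \<longlonglongrightarrow> a"
    using bounded_real_subseq[of "\<lambda>n. Re (f n)"] by blast
  have "\<bar>Im (f (r n))\<bar> \<le> B" for n using abs_Im_le_cmod assms order_trans by blast
  then obtain r' b where r': "strict_mono r'" "(\<lambda>n. Im (f (r (r' n)))) \<longlonglongrightarrow> b"
    using bounded_real_subseq[of "\<lambda>n. Im (f (r n))"] by blast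
  have "(\<lambda>n. Re (f (r (r' n)))) \<longlonglongrightarrow> a"
    using LIMSEQ_subseq_LIMSEQ[OF r(2) r'(1)] by (simp add: o_def)
  then have "(\<lambda>n. f ((r \<circ> r') n)) \<longlonglongrightarrow> Complex a b"
    using r'(2) by (subst tendsto_complex_iff) simp
  then show ?thesis using strict_mono_o[OF r(1) r'(1)] by blast
qed

lemma bounded_family_subseq:
  fixes f :: "nat \<Rightarrow> 'i \<Rightarrow> complex"
  assumes "finite I" "\<And>n i. i \<in> I \<Longrightarrow> norm (f n i) \<le> B"
  shows "\<exists>r g. strict_mono r \<and> (\<forall>i\<in>I. (\<lambda>n. f (r n) i) \<longlonglongrightarrow> g i)"
  using assms
proof (induction I rule: finite_induct)
  case empty
  then show ?case using strict_mono_id by auto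
next
  case (insert i I)
  then obtain r g where r: "strict_mono r" "\<And>j. j \<in> I \<Longrightarrow> (\<lambda>n. f (r n) j) \<longlonglongrightarrow> g j" by fastforce
  obtain r' l where r': "strict_mono r'" "(\<lambda>n. f (r (r' n)) i) \<longlonglongrightarrow> l"
    using bounded_complex_subseq[of "\<lambda>n. f (r n) i" B] insert by auto
  have "(\<lambda>n. f ((r \<circ> r') n) j) \<longlonglongrightarrow> (g(i := l)) j" if "j \<in> insert i I" for j
    using that r'(2) LIMSEQ_subseq_LIMSEQ[OF r(2) r'(1)] by (auto simp: o_def)
  then show ?case using strict_mono_o[OF r(1) r'(1)] by blast
qed

definition coord_seq_compact :: "'i set \<Rightarrow> ('i \<Rightarrow> real) set \<Rightarrow> bool" where
  "coord_seq_compact I K \<longleftrightarrow>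
     (\<forall>f :: nat \<Rightarrow> _. (\<forall>n. f n \<in> K) \<longrightarrow>
        (\<exists>(r :: nat \<Rightarrow> nat) g. strict_mono r \<and> g \<in> K \<and> (\<forall>i\<in>I. (\<lambda>n. f (r n) i) \<longlonglongrightarrow> g i)))"

lemma coord_seq_compact_family:
  fixes f :: "nat \<Rightarrow> nat \<Rightarrow> 'i \<Rightarrow> real"
  assumes K: "coord_seq_compact I K" and f: "\<And>l n. l < L \<Longrightarrow> f l n \<in> K"
  shows "\<exists>r g. strict_mono r \<and> (\<forall>l<L. g l \<in> K \<and> (\<forall>i\<in>I. (\<lambda>n. f l (r n) i) \<longlonglongrightarrow> g l i))"
  using f
proof (induction L)
  case 0
  show ?case by (intro exI[of _ id] exI[of _ undefined]) (simp add: strict_mono_def)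
next
  case (Suc L)
  then obtain r g where r: "strict_mono r"
    "\<And>l. l < L \<Longrightarrow> g l \<in> K" "\<And>l i. l < L \<Longrightarrow> i \<in> I \<Longrightarrow> (\<lambda>n. f l (r n) i) \<longlonglongrightarrow> g l i"
    by (metis less_Suc_eq)
  have "\<forall>n. f L (r n) \<in> K" using Suc.prems by auto
  with K[unfolded coord_seq_compact_def, rule_format, of "\<lambda>n. f L (r n)"]
  obtain r' h where r': "strict_mono r'" "h \<in> K" "\<And>i. i \<in> I \<Longrightarrow> (\<lambda>n. f L (r (r' n)) i) \<longlonglongrightarrow> h i"
    by blast
  have "(\<lambda>n. f l ((r \<circ> r') n) i) \<longlonglongrightarrow> (g(L := h)) l i" if "l < Suc L" "i \<in> I" for l i
    using that r'(3) LIMSEQ_subseq_LIMSEQ[OF r(3) r'(1), of l i]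
    by (cases "l = L") (auto simp: o_def)
  moreover have "(g(L := h)) l \<in> K" if "l < Suc L" for l
    using that r r' by (auto simp: less_Suc_eq)
  ultimately show ?case using strict_mono_o[OF r(1) r'(1)] by blast
qed

text \<open>For fixed L the hull is a continuous image of L copies of K and the simplex of weights;
  along a common subsequence all points and all weights converge.\<close>

lemma convex_comb_seq_compact:
  fixes P :: "nat \<Rightarrow> 'i \<Rightarrow> real"
  assumes I: "finite I" and K: "coord_seq_compact I K" and P: "\<And>n. convex_comb L I K (P n)"
  shows "\<exists>r Q. strict_mono r \<and> convex_comb L I K Q \<and> (\<forall>i\<in>I. (\<lambda>n. P (r n) i) \<longlonglongrightarrow> Q i)"
proof -
  obtain c \<kappa> where c: "\<And>n l. l < L \<Longrightarrow> 0 \<le> c n l" "\<And>n. (\<Sum>l<L. c n l) = 1"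
    and \<kappa>: "\<And>n l. l < L \<Longrightarrow> \<kappa> n l \<in> K" and Pe: "\<And>n i. i \<in> I \<Longrightarrow> P n i = (\<Sum>l<L. c n l * \<kappa> n l i)"
    using P unfolding convex_comb_def by metis
  have c1: "norm (complex_of_real (c n l)) \<le> 1" if "l \<in> {..<L}" for n l
  proof -
    have "c n l \<le> (\<Sum>l<L. c n l)" using that c by (intro member_le_sum) auto
    then show ?thesis using c that by simp
  qed
  obtain r g where r: "strict_mono r" "\<And>l. l < L \<Longrightarrow> g l \<in> K"
    "\<And>l i. l < L \<Longrightarrow> i \<in> I \<Longrightarrow> (\<lambda>n. \<kappa> (r n) l i) \<longlonglongrightarrow> g l i"
    using coord_seq_compact_family[OF K, of L "\<lambda>l n. \<kappa> n l"] \<kappa> by blast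
  \<comment> \<open>The weights lie between 0 and 1. They are cast to complex numbers so that
    \<open>bounded_family_subseq\<close> applies, and \<open>Re\<close> brings the limits
    back.\<close>
  obtain r' h where r': "strict_mono r'"
    "\<And>l. l < L \<Longrightarrow> (\<lambda>n. complex_of_real (c (r (r' n)) l)) \<longlonglongrightarrow> h l"
    using bounded_family_subseq[OF finite_lessThan, of L "\<lambda>n l. complex_of_real (c (r n) l)" 1,
      OF c1] by (auto simp only: lessThan_iff Ball_def)
  have cl: "(\<lambda>n. c (r (r' n)) l) \<longlonglongrightarrow> Re (h l)" if "l < L" for l
    using tendsto_Re[OF r'(2)[OF that]] by simp
  have \<kappa>l: "(\<lambda>n. \<kappa> (r (r' n)) l i) \<longlonglongrightarrow> g l i" if "l < L" "i \<in> I" for l i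
    using LIMSEQ_subseq_LIMSEQ[OF r(3)[OF that] r'(1)] by (simp add: o_def)
  define Q where "Q i = (\<Sum>l<L. Re (h l) * g l i)" for i
  have "(\<lambda>n. P ((r \<circ> r') n) i) \<longlonglongrightarrow> Q i" if "i \<in> I" for i
    unfolding Q_def using that
    by (simp only: Pe o_def) (intro tendsto_sum tendsto_mult cl \<kappa>l; simp)
  moreover have "0 \<le> Re (h l)" if "l < L" for l
    by (rule LIMSEQ_le_const[OF cl[OF that]]) (use c that in auto)
  moreover have "(\<Sum>l<L. Re (h l)) = 1"
  proof -
    have "(\<lambda>n. \<Sum>l<L. c (r (r' n)) l) \<longlonglongrightarrow> (\<Sum>l<L. Re (h l))"
      by (intro tendsto_sum cl) simp
    then show ?thesis using c(2) LIMSEQ_unique[OF tendsto_const] by fastforce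
  qed
  ultimately have "strict_mono (r \<circ> r') \<and> convex_comb L I K Q \<and>
      (\<forall>i\<in>I. (\<lambda>n. P ((r \<circ> r') n) i) \<longlonglongrightarrow> Q i)"
    unfolding convex_comb_def using strict_mono_o[OF r(1) r'(1)] r(2)
    by (auto simp: Q_def intro!: exI[of _ "\<lambda>l. Re (h l)"] exI[of _ g])
  then show ?thesis by blast
qed

text \<open>Moving towards a point of K costs one more point; in the separation argument
  \<open>convex_comb_reduce\<close> removes it again.\<close>

lemma convex_comb_segment:
  assumes P: "convex_comb L I K P" and k: "\<kappa> \<in> K" and e: "0 \<le> e" "e \<le> 1"
  shows "convex_comb (Suc L) I K (\<lambda>i. P i + e * (\<kappa> i - P i))"
proof -
  obtain c \<mu> where c: "\<And>l. l < L \<Longrightarrow> 0 \<le> c l" "(\<Sum>l<L. c l) = 1"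
    and \<mu>: "\<And>l. l < L \<Longrightarrow> \<mu> l \<in> K" and Pe: "\<And>i. i \<in> I \<Longrightarrow> P i = (\<Sum>l<L. c l * \<mu> l i)"
    using P unfolding convex_comb_def by blast
  let ?c = "\<lambda>l. if l = L then e else (1 - e) * c l"
  let ?m = "\<lambda>l. if l = L then \<kappa> else \<mu> l"
  have "P i + e * (\<kappa> i - P i) = (\<Sum>l<Suc L. ?c l * ?m l i)" if "i \<in> I" for i
    using Pe[OF that] by (simp add: algebra_simps sum_subtractf sum_distrib_left)
  moreover have "(\<Sum>l<Suc L. ?c l) = 1" using c by (simp flip: sum_distrib_left)
  ultimately show ?thesis unfolding convex_comb_def
    using c \<mu> k e by (intro exI[of _ ?c] exI[of _ ?m]) auto
qed

text \<open>The hull point Q nearest to J gives the functional w = Q - J, with its value at Q as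
  threshold. If some \<kappa> in K had a smaller value, a short move from Q towards \<kappa> would
  come closer to J.\<close>

lemma separate_from_convex_hull:
  fixes J :: "'i \<Rightarrow> real"
  assumes I: "finite I" and K: "coord_seq_compact I K" "K \<noteq> {}"
    and J: "\<And>L. \<not> convex_comb L I K J"
  shows "\<exists>w c. (\<Sum>i\<in>I. w i * J i) < c \<and> (\<forall>\<kappa>\<in>K. c \<le> (\<Sum>i\<in>I. w i * \<kappa> i))"
proof -
  define L where "L = card I + 1"
  define D where "D P = (\<Sum>i\<in>I. (P i - J i)\<^sup>2)" for P
  have D0: "0 \<le> D P" for P by (auto simp: D_def intro: sum_nonneg)
  obtain \<kappa>0 where \<kappa>0: "\<kappa>0 \<in> K" using K by blast
  have ne: "convex_comb L I K \<kappa>0"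
    unfolding convex_comb_def using \<kappa>0
    by (intro exI[of _ "\<lambda>l. if l = 0 then 1 else 0"] exI[of _ "\<lambda>_. \<kappa>0"])
      (auto simp: L_def sum.delta if_distrib[of "\<lambda>x. x * _"] cong: if_cong)
  define S where "S = D ` {P. convex_comb L I K P}"
  have bd: "bdd_below S" unfolding S_def using D0 by (intro bdd_belowI[of _ 0]) auto
  have Sne: "S \<noteq> {}" using ne by (auto simp: S_def)
  have "\<exists>P. convex_comb L I K P \<and> D P < Inf S + inverse (Suc n)" for n
    using cInf_lessD[OF Sne, of "Inf S + inverse (Suc n)"] by (auto simp: S_def)
  then obtain P where P: "\<And>n. convex_comb L I K (P n)" "\<And>n. D (P n) < Inf S + inverse (Suc n)"
    by metis
  obtain r Q where r: "strict_mono r" and Q: "convex_comb L I K Q"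
    and lim: "\<And>i. i \<in> I \<Longrightarrow> (\<lambda>n. P (r n) i) \<longlonglongrightarrow> Q i"
    using convex_comb_seq_compact[of I K L P] I K(1) P(1) by blast
  have "(\<lambda>n. D (P (r n))) \<longlonglongrightarrow> D Q"
    unfolding D_def by (intro tendsto_intros lim)
  moreover have "(\<lambda>n. Inf S + inverse (real (Suc (r n)))) \<longlonglongrightarrow> Inf S"
    using LIMSEQ_subseq_LIMSEQ[OF LIMSEQ_inverse_real_of_nat_add r] by (simp add: o_def)
  ultimately have DQ: "D Q \<le> Inf S"
    by (rule LIMSEQ_le) (use P(2) less_imp_le in blast)
  have min: "D Q \<le> D R" if "convex_comb L I K R" for R
    using DQ cInf_lower[OF _ bd, of "D R"] that by (auto simp: S_def)
  define w where "w i = Q i - J i" for i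
  have DQpos: "0 < D Q"
  proof (rule ccontr)
    assume "\<not> 0 < D Q"
    then have "D Q = 0" using D0[of Q] by simp
    then have "\<forall>i\<in>I. Q i = J i" unfolding D_def using I by (subst (asm) sum_nonneg_eq_0_iff) auto
    then have "convex_comb L I K J" using Q unfolding convex_comb_def by simp
    then show False using J by blast
  qed
  have "(\<Sum>i\<in>I. w i * Q i) \<le> (\<Sum>i\<in>I. w i * \<kappa> i)" if k: "\<kappa> \<in> K" for \<kappa>
  proof (rule ccontr)
    define s where "s = (\<Sum>i\<in>I. w i * (Q i - \<kappa> i))"
    define q where "q = (\<Sum>i\<in>I. (\<kappa> i - Q i)\<^sup>2)"
    assume "\<not> ?thesis"
    then have s: "0 < s" by (simp add: s_def algebra_simps sum_subtractf)
    have q: "0 \<le> q" by (auto simp: q_def intro: sum_nonneg)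
    \<comment> \<open>Along the segment the squared distance changes by
      \<open>e * (e * q - 2 * s)\<close>. This step size ensures e * q \<le> s, hence a decrease;
      the denominator is positive even if q = 0.\<close>
    define e where "e = min 1 (s / (q + 1))"
    have e: "0 < e" "e \<le> 1" "e \<le> s / (q + 1)"
      using s q by (auto simp: e_def)
    have "convex_comb L I K (\<lambda>i. Q i + e * (\<kappa> i - Q i))"
      by (rule convex_comb_reduce[OF I]) (use convex_comb_segment[OF Q k] e in \<open>auto simp: L_def\<close>)
    then have "D Q \<le> D (\<lambda>i. Q i + e * (\<kappa> i - Q i))" by (rule min)
    also have "\<dots> = (\<Sum>i\<in>I. (Q i - J i)\<^sup>2 - 2 * e * (w i * (Q i - \<kappa> i)) + e\<^sup>2 * (\<kappa> i - Q i)\<^sup>2)"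
      unfolding D_def w_def by (intro sum.cong) (auto simp: power2_eq_square algebra_simps)
    also have "\<dots> = D Q - 2 * e * s + e\<^sup>2 * q"
      by (simp add: D_def s_def q_def sum.distrib sum_subtractf sum_distrib_left)
    finally have "e * (2 * s) \<le> e * (e * q)" by (simp add: power2_eq_square)
    then have "2 * s \<le> e * q" using e by simp
    moreover have "e * q \<le> s"
    proof -
      have "e * (q + 1) \<le> s" using e(3) q by (simp add: pos_le_divide_eq)
      then show ?thesis using e(1) by (simp add: algebra_simps)
    qed
    ultimately show False using s by simp
  qed
  moreover have "(\<Sum>i\<in>I. w i * J i) < (\<Sum>i\<in>I. w i * Q i)"
  proof -
    have "(\<Sum>i\<in>I. w i * Q i) - (\<Sum>i\<in>I. w i * J i) = D Q"
      unfolding D_def w_def by (simp add: power2_eq_square algebra_simps flip: sum_subtractf)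
    then show ?thesis using DQpos by simp
  qed
  ultimately show ?thesis by blast
qed

subsection \<open>Positive semidefinite matrices\<close>

lemma quad_form_two_points:
  fixes A :: "nat \<Rightarrow> nat \<Rightarrow> complex"
  assumes pos: "\<And>v. 0 \<le> (\<Sum>i<n. \<Sum>j<n. cnj (v i) * A i j * v j)"
    and ij: "i < n" "j < n" "i \<noteq> j"
  shows "0 \<le> cnj a * A i i * a + cnj a * A i j * b + cnj b * A j i * a + cnj b * A j j * b"
proof -
  define v where "v = (\<lambda>k. if k = i then a else if k = j then b else 0)"
  have red: "(\<Sum>k<n. f k * v k) = f i * a + f j * b" for f
  proof -
    have "(\<Sum>k<n. f k * v k) = (\<Sum>k\<in>{i, j}. f k * v k)"
      by (rule sum.mono_neutral_right) (use ij in \<open>auto simp: v_def\<close>)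
    then show ?thesis using ij by (simp add: v_def)
  qed
  have red': "(\<Sum>k<n. cnj (v k) * f k) = cnj a * f i + cnj b * f j" for f
  proof -
    have "(\<Sum>k<n. cnj (v k) * f k) = (\<Sum>k\<in>{i, j}. cnj (v k) * f k)"
      by (rule sum.mono_neutral_right) (use ij in \<open>auto simp: v_def\<close>)
    then show ?thesis using ij by (simp add: v_def)
  qed
  have "(\<Sum>k<n. \<Sum>l<n. cnj (v k) * A k l * v l) = (\<Sum>k<n. cnj (v k) * (A k i * a + A k j * b))"
    by (intro sum.cong refl) (subst red, simp add: algebra_simps)
  also have "\<dots> = cnj a * (A i i * a + A i j * b) + cnj b * (A j i * a + A j j * b)"
    by (rule red')
  finally show ?thesis using pos[of v] by (simp add: algebra_simps)
qed

lemma quad_form_diag: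
  fixes A :: "nat \<Rightarrow> nat \<Rightarrow> complex"
  assumes pos: "\<And>v. 0 \<le> (\<Sum>i<n. \<Sum>j<n. cnj (v i) * A i j * v j)" and i: "i < n"
  shows "0 \<le> A i i"
proof -
  have e: "(\<Sum>k<n. f k * (if k = i then 1 else 0)) = f i" for f :: "nat \<Rightarrow> complex"
    using i by (simp add: if_distrib[of "\<lambda>x. _ * x"] sum.delta cong: if_cong)
  have "(\<Sum>k<n. \<Sum>l<n. cnj (if k = i then 1 else 0) * A k l * (if l = i then 1 else 0)) = A i i"
    by (simp only: e) (simp add: e mult.commute[of _ "A _ _"] if_distrib[of cnj] cong: if_cong)
  then show ?thesis using pos[of "\<lambda>k. if k = i then 1 else 0"] by simp
qed

text \<open>Nonnegativity of a complex number includes realness. That the form is real at e_i + e_j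
  gives the imaginary part of the claim, that it is real at e_i + \<i> e_j the real part.\<close>

lemma quad_form_hermitian:
  fixes A :: "nat \<Rightarrow> nat \<Rightarrow> complex"
  assumes pos: "\<And>v. 0 \<le> (\<Sum>i<n. \<Sum>j<n. cnj (v i) * A i j * v j)"
    and ij: "i < n" "j < n"
  shows "A j i = cnj (A i j)"
proof (cases "i = j")
  case True
  then show ?thesis
    using quad_form_diag[where A = A, OF pos ij(1)] by (auto simp: less_eq_complex_def complex_eq_iff)
next
  case False
  have d: "Im (A i i) = 0" "Im (A j j) = 0"
    using quad_form_diag[where A = A, OF pos] ij by (auto simp: less_eq_complex_def)
  have "Im (A i j) + Im (A j i) = 0"
    using quad_form_two_points[where A = A, OF pos ij False, of 1 1] d
    by (simp add: less_eq_complex_def)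
  moreover have "Re (A i j) - Re (A j i) = 0"
    using quad_form_two_points[where A = A, OF pos ij False, of 1 \<i>] d
    by (simp add: less_eq_complex_def)
  ultimately show ?thesis by (simp add: complex_eq_iff)
qed

text \<open>Moving z far enough against b makes the value negative: the chosen t yields a real part
  of - Re q - 2. This is used for a zero pivot, which thereby forces the rest of its row to
  vanish.\<close>

lemma nonneg_affine_complex:
  fixes b q :: complex
  assumes "\<And>z. 0 \<le> q + (cnj z * b + z * cnj b)"
  shows "b = 0"
proof (rule ccontr)
  assume "b \<noteq> 0"
  define t where "t = (Re q + 1) / (cmod b)\<^sup>2"
  have "0 \<le> Re (q + (cnj (- of_real t * b) * b + (- of_real t * b) * cnj b))"
    using assms[of "- of_real t * b"] by (simp only: less_eq_complex_def) simp
  also have "\<dots> = Re q - 2 * t * (cmod b)\<^sup>2"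
    unfolding cmod_power2 by (simp add: power2_eq_square algebra_simps)
  also have "\<dots> = - Re q - 2" using \<open>b \<noteq> 0\<close> by (simp add: t_def)
  finally have "Re q \<le> - 2" by simp
  moreover have "0 \<le> Re q" using assms[of 0] by (simp add: less_eq_complex_def)
  ultimately show False by simp
qed

text \<open>A Cholesky decomposition: the last row and column are cleared by a Schur complement.\<close>

lemma gram_decomposition:
  fixes A :: "nat \<Rightarrow> nat \<Rightarrow> complex"
  assumes "\<And>v. 0 \<le> (\<Sum>i<n. \<Sum>j<n. cnj (v i) * A i j * v j)"
  shows "\<exists>\<eta>. \<forall>i<n. \<forall>j<n. A i j = (\<Sum>l<n. \<eta> l i * cnj (\<eta> l j))"
  using assms
proof (induction n arbitrary: A)
  case 0
  then show ?case by simp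
next
  case (Suc n)
  note herm = quad_form_hermitian[where A = A, OF Suc.prems]
  define a where "a = A n n"
  have a: "0 \<le> a" unfolding a_def using quad_form_diag[where A = A, OF Suc.prems] by blast
  define Q where "Q v = (\<Sum>i<n. \<Sum>j<n. cnj (v i) * A i j * v j)" for v
  define B where "B v = (\<Sum>j<n. A n j * v j)" for v
  have Bc: "(\<Sum>i<n. cnj (v i) * A i n) = cnj (B v)" for v
    unfolding B_def cnj_sum
  proof (intro sum.cong refl)
    fix i assume "i \<in> {..<n}"
    then have "A i n = cnj (A n i)" using herm[of n i] by simp
    then show "cnj (v i) * A i n = cnj (A n i * v i)" by simp
  qed
  have key: "0 \<le> Q v + (cnj z * B v + z * cnj (B v)) + cnj z * a * z" for v z
  proof -
    let ?v = "v(n := z)"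
    have "(\<Sum>i<Suc n. \<Sum>j<Suc n. cnj (?v i) * A i j * ?v j) =
        Q v + (\<Sum>i<n. cnj (v i) * A i n * z) + (\<Sum>j<n. cnj z * A n j * v j) + cnj z * a * z"
      by (simp add: Q_def a_def sum.distrib)
    also have "(\<Sum>i<n. cnj (v i) * A i n * z) = z * cnj (B v)"
      by (simp add: Bc[symmetric] sum_distrib_left mult.commute)
    also have "(\<Sum>j<n. cnj z * A n j * v j) = cnj z * B v"
      by (simp add: B_def sum_distrib_left mult.assoc)
    finally show ?thesis using Suc.prems[of ?v] by (simp add: algebra_simps)
  qed
  have zero: "A n j = 0" if "a = 0" "j < n" for j
  proof -
    have "B (\<lambda>k. if k = j then 1 else 0) = 0"
      using key[of "\<lambda>k. if k = j then 1 else 0"] that(1) by (intro nonneg_affine_complex) simp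
    then show ?thesis using that(2)
      by (simp add: B_def if_distrib[of "\<lambda>x. _ * x"] sum.delta cong: if_cong)
  qed
  \<comment> \<open>If a = 0, the quotient is 0 by convention and A' agrees with A. This is the
    right complement, as the last row then vanishes by \<open>zero\<close>.\<close>
  define A' where "A' i j = A i j - A i n * A n j / a" for i j
  have "0 \<le> (\<Sum>i<n. \<Sum>j<n. cnj (v i) * A' i j * v j)" for v
  proof -
    have "(\<Sum>i<n. \<Sum>j<n. cnj (v i) * A' i j * v j) =
        Q v - (\<Sum>i<n. \<Sum>j<n. (cnj (v i) * A i n) * (A n j * v j)) / a"
      by (simp add: A'_def Q_def sum_subtractf sum_divide_distrib algebra_simps)
    also have "(\<Sum>i<n. \<Sum>j<n. (cnj (v i) * A i n) * (A n j * v j)) = cnj (B v) * B v"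
      by (simp only: sum_product[symmetric] Bc) (simp add: B_def)
    finally have e: "(\<Sum>i<n. \<Sum>j<n. cnj (v i) * A' i j * v j) = Q v - cnj (B v) * B v / a" .
    show ?thesis
    proof (cases "a = 0")
      case True
      then show ?thesis using e key[of v 0] by simp
    next
      case False
      have ca: "cnj a = a" using a by (auto simp: less_eq_complex_def complex_eq_iff)
      \<comment> \<open>This z minimizes the form over the last coordinate; the minimum is the form
        of the Schur complement.\<close>
      show ?thesis using key[of v "- B v / a"] False
        by (subst e) (simp add: ca field_simps)
    qed
  qed
  then obtain \<eta> where \<eta>: "\<And>i j. i < n \<Longrightarrow> j < n \<Longrightarrow> A' i j = (\<Sum>l<n. \<eta> l i * cnj (\<eta> l j))"
    using Suc.IH[of A'] by blast
  define r where "r = complex_of_real (sqrt (Re a))"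
  have r: "r * r = a" "cnj r = r"
    using a by (auto simp: r_def less_eq_complex_def complex_eq_iff)
  \<comment> \<open>The last column divided by the root of the pivot is the new Gram vector, and the
    old ones are extended by 0. If a = 0, then r = 0 and the new vector is 0.\<close>
  define \<eta>' where "\<eta>' l i = (if l = n then A i n / r else if i = n then 0 else \<eta> l i)" for l i
  have last: "A i n / r * cnj (A j n / r) = A i n * A n j / a" if "j < Suc n" for i j
    using herm[of j n] that r by (simp add: field_simps)
  have "A i j = (\<Sum>l<Suc n. \<eta>' l i * cnj (\<eta>' l j))" if "i < Suc n" "j < Suc n" for i j
  proof -
    have s: "(\<Sum>l<n. \<eta>' l i * cnj (\<eta>' l j)) = (if i < n \<and> j < n then A' i j else 0)"
      using that by (auto simp: \<eta>'_def \<eta> less_Suc_eq)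
    have "(\<Sum>l<Suc n. \<eta>' l i * cnj (\<eta>' l j)) =
        (if i < n \<and> j < n then A' i j else 0) + A i n * A n j / a"
      using last[OF that(2), of i] by (simp add: s) (simp add: \<eta>'_def)
    also have "\<dots> = A i j"
    proof (cases "i < n \<and> j < n")
      case True
      then show ?thesis by (simp add: A'_def)
    next
      case False
      then have "i = n \<or> j = n" using that by auto
      then show ?thesis
      proof
        assume i: "i = n"
        show ?thesis
          using zero[of j] that i by (cases "a = 0"; cases "j = n") (auto simp: a_def)
      next
        assume j: "j = n"
        have "a = 0 \<Longrightarrow> i < n \<Longrightarrow> A i n = 0" using zero[of i] herm[of n i] by simp
        then show ?thesis
          using that j by (cases "a = 0"; cases "i = n") (auto simp: a_def)
      qed
    qed
    finally show ?thesis by simp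
  qed
  then show ?case by blast
qed

lemma psd_quad_form:
  assumes "psd n A"
  shows "0 \<le> (\<Sum>i<n. \<Sum>j<n. cnj (v i) * A $$ (i, j) * v j)"
proof -
  have A: "A \<in> carrier_mat n n" and "0 \<le> (A *\<^sub>v vec n v) \<bullet>c vec n v"
    using assms by (auto simp: psd_def)
  moreover have "(A *\<^sub>v vec n v) \<bullet>c vec n v = (\<Sum>i<n. \<Sum>j<n. cnj (v i) * A $$ (i, j) * v j)"
    using A by (auto simp: scalar_prod_def sum_distrib_left sum_distrib_right lessThan_atLeast0
        mult_ac intro!: sum.cong)
  ultimately show ?thesis by simp
qed

lemma psd_gram:
  assumes "psd n A"
  shows "\<exists>\<eta>. \<forall>i<n. \<forall>j<n. A $$ (i, j) = (\<Sum>l<n. \<eta> l i * cnj (\<eta> l j))"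
  by (rule gram_decomposition) (rule psd_quad_form[OF assms])

lemma psd_hermitian:
  assumes "psd n A" "i < n" "j < n"
  shows "A $$ (j, i) = cnj (A $$ (i, j))"
  by (rule quad_form_hermitian[where A = "\<lambda>i j. A $$ (i, j)", OF psd_quad_form[OF assms(1)] assms(2,3)])

lemma gram_psd:
  fixes L :: nat
  assumes A: "A \<in> carrier_mat n n"
    and g: "\<And>i j. i < n \<Longrightarrow> j < n \<Longrightarrow> A $$ (i, j) = (\<Sum>l<L. \<eta> l i * cnj (\<eta> l j))"
  shows "psd n A"
  unfolding psd_def
proof (intro conjI ballI A)
  fix v :: "complex vec" assume v: "v \<in> carrier_vec n"
  have "(A *\<^sub>v v) \<bullet>c v = (\<Sum>i<n. \<Sum>j<n. A $$ (i, j) * v $ j * cnj (v $ i))"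
    using A v by (auto simp: scalar_prod_def sum_distrib_right lessThan_atLeast0 intro!: sum.cong)
  also have "\<dots> = (\<Sum>i<n. \<Sum>j<n. \<Sum>l<L. (\<eta> l i * cnj (v $ i)) * (cnj (\<eta> l j) * v $ j))"
    by (intro sum.cong refl) (simp add: g sum_distrib_left sum_distrib_right mult_ac)
  also have "\<dots> = (\<Sum>l<L. (\<Sum>i<n. \<Sum>j<n. (\<eta> l i * cnj (v $ i)) * (cnj (\<eta> l j) * v $ j)))"
    by (subst sum.swap[of _ "{..<n}" "{..<L}"], subst sum.swap[of _ "{..<L}"]) (rule refl)
  also have "\<dots> = (\<Sum>l<L. (\<Sum>i<n. \<eta> l i * cnj (v $ i)) * cnj (\<Sum>i<n. \<eta> l i * cnj (v $ i)))"
    by (simp add: sum_product)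
  also have "0 \<le> \<dots>"
    by (intro sum_nonneg) (simp only: complex_norm_square[symmetric],
        simp add: less_eq_complex_def del: of_real_power)
  finally show "0 \<le> (A *\<^sub>v v) \<bullet>c v" .
qed

subsection \<open>Schmidt decompositions\<close>

text \<open>The matrix rank bound that stands in for the Schmidt rank, see
  \<open>schmidt_rank_le_iff\<close>. With free factors it passes through scaling and local
  operators at once, whereas these destroy the orthonormality of a Schmidt decomposition.\<close>

definition tensor_rank_le :: "nat \<Rightarrow> nat \<Rightarrow> nat \<Rightarrow> (nat \<Rightarrow> nat \<Rightarrow> complex) \<Rightarrow> bool" where
  "tensor_rank_le k m n \<psi> \<longleftrightarrow> (\<exists>x y. \<forall>a<m. \<forall>b<n. \<psi> a b = (\<Sum>i<k. x i a * y i b))"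

definition orthonormal_on :: "nat \<Rightarrow> nat \<Rightarrow> (nat \<Rightarrow> nat \<Rightarrow> complex) \<Rightarrow> bool" where
  "orthonormal_on n q u \<longleftrightarrow>
     (\<forall>i<q. \<forall>j<q. (\<Sum>a<n. u i a * cnj (u j a)) = (if i = j then 1 else 0))"

lemma tensor_rank_le_transpose:
  assumes "tensor_rank_le k m n \<psi>"
  shows "tensor_rank_le k n m (\<lambda>b a. \<psi> a b)"
proof -
  obtain x y where "\<And>a b. a < m \<Longrightarrow> b < n \<Longrightarrow> \<psi> a b = (\<Sum>i<k. x i a * y i b)"
    using assms unfolding tensor_rank_le_def by blast
  then show ?thesis unfolding tensor_rank_le_def
    by (intro exI[of _ y] exI[of _ x]) (simp add: mult.commute)
qed

lemma tensor_rank_le_scale: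
  assumes "tensor_rank_le k m n \<psi>"
  shows "tensor_rank_le k m n (\<lambda>a b. c * \<psi> a b)"
proof -
  obtain x y where "\<And>a b. a < m \<Longrightarrow> b < n \<Longrightarrow> \<psi> a b = (\<Sum>i<k. x i a * y i b)"
    using assms unfolding tensor_rank_le_def by blast
  then show ?thesis unfolding tensor_rank_le_def
    by (intro exI[of _ "\<lambda>i a. c * x i a"] exI[of _ y]) (simp add: sum_distrib_left mult.assoc)
qed

lemma tensor_rank_le_mono:
  assumes "tensor_rank_le q m n \<psi>" and "q \<le> k"
  shows "tensor_rank_le k m n \<psi>"
proof -
  obtain x y where xy: "\<And>a b. a < m \<Longrightarrow> b < n \<Longrightarrow> \<psi> a b = (\<Sum>i<q. x i a * y i b)"
    using assms(1) unfolding tensor_rank_le_def by blast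
  have "(\<Sum>i<k. (if i < q then x i a else 0) * y i b) = (\<Sum>i<q. x i a * y i b)" for a b
    using assms(2) by (intro sum.mono_neutral_cong_right) auto
  then show ?thesis unfolding tensor_rank_le_def
    by (intro exI[of _ "\<lambda>i a. if i < q then x i a else 0"] exI[of _ y]) (simp add: xy)
qed

lemma tensor_rank_le_dim: "tensor_rank_le n m n \<psi>"
  unfolding tensor_rank_le_def
  by (intro exI[of _ "\<lambda>i a. \<psi> a i"] exI[of _ "\<lambda>i b. if i = b then 1 else 0"])
    (simp add: if_distrib[of "\<lambda>x. _ * x"] sum.delta cong: if_cong)

text \<open>The vanishing combination of the x i, tensored with \<open>y i0 / c i0\<close>, is
  subtracted from \<psi>. This annihilates the second factor of term i0, and term r is moved into
  the gap.\<close>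

lemma tensor_rank_le_reduce:
  assumes \<psi>: "\<And>a b. a < m \<Longrightarrow> b < n \<Longrightarrow> \<psi> a b = (\<Sum>i<Suc r. x i a * y i b)"
    and c: "i0 < Suc r" "c i0 \<noteq> 0" "\<And>a. a < m \<Longrightarrow> (\<Sum>i<Suc r. c i * x i a) = 0"
  shows "tensor_rank_le r m n \<psi>"
proof -
  define \<pi> where "\<pi> l = (if l = i0 then r else l)" for l
  have re: "(\<Sum>l<r. g (\<pi> l)) = (\<Sum>l<Suc r. g l)" if "g i0 = 0" for g :: "nat \<Rightarrow> complex"
  proof -
    have "(\<Sum>l<Suc r. g l) = (\<Sum>l\<in>{..<Suc r} - {i0}. g l)"
      using c(1) that by (subst sum.remove[of _ i0]) auto
    also have "\<dots> = (\<Sum>l<r. g (\<pi> l))"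
      by (rule sum.reindex_bij_witness[of _ \<pi> "\<lambda>l. if l = r then i0 else l"])
        (use c(1) in \<open>auto simp: \<pi>_def split: if_splits\<close>)
    finally show ?thesis by simp
  qed
  define z where "z i b = y i b - c i / c i0 * y i0 b" for i b
  have "\<psi> a b = (\<Sum>l<r. x (\<pi> l) a * z (\<pi> l) b)" if "a < m" "b < n" for a b
  proof -
    have "(\<Sum>l<r. x (\<pi> l) a * z (\<pi> l) b) = (\<Sum>l<Suc r. x l a * z l b)"
      using re[of "\<lambda>l. x l a * z l b"] c by (simp add: z_def)
    also have "\<dots> = (\<Sum>l<Suc r. x l a * y l b) - (\<Sum>l<Suc r. (c l * x l a) * (y i0 b / c i0))"
      unfolding sum_subtractf[symmetric] z_def by (intro sum.cong refl) (simp add: algebra_simps)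
    also have "\<dots> = \<psi> a b"
      using \<psi>[OF that] c(3)[OF that(1)] by (simp only: sum_distrib_right[symmetric] mult_zero_left diff_zero)
    finally show ?thesis by simp
  qed
  then show ?thesis unfolding tensor_rank_le_def
    by (intro exI[of _ "\<lambda>l. x (\<pi> l)"] exI[of _ "\<lambda>l. z (\<pi> l)"]) simp
qed

section \<open>Singular value decomposition of a matrix of bounded rank\<close>

lemma ex_eigenvector:
  fixes C :: "nat \<Rightarrow> nat \<Rightarrow> complex"
  assumes "0 < n"
  shows "\<exists>c ev. (\<exists>i<n. c i \<noteq> 0) \<and> (\<forall>i<n. (\<Sum>j<n. C i j * c j) = ev * c i)"
proof -
  define A where "A = mat n n (\<lambda>(i, j). C i j)"
  have A: "A \<in> carrier_mat n n" by (simp add: A_def)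
  obtain ev v where v: "v \<in> carrier_vec n" "v \<noteq> 0\<^sub>v n" "A *\<^sub>v v = ev \<cdot>\<^sub>v v"
    using spectrum_non_empty[OF A assms] A
    unfolding spectrum_def eigenvalue_def eigenvector_def by auto
  have "(\<Sum>j<n. C i j * v $ j) = ev * v $ i" if "i < n" for i
  proof -
    have "(\<Sum>j<n. C i j * v $ j) = (A *\<^sub>v v) $ i"
      using that v(1) by (simp add: A_def scalar_prod_def lessThan_atLeast0)
    then show ?thesis using v that by simp
  qed
  moreover have "\<exists>i<n. v $ i \<noteq> 0"
    using v(1,2) by (metis carrier_vecD eq_vecI index_zero_vec)
  ultimately show ?thesis by (intro exI[of _ "\<lambda>i. v $ i"] exI[of _ ev]) blast
qed

lemma orthonormal_on_extend:
  assumes u: "orthonormal_on n q u" and w: "(\<Sum>a<n. w a * cnj (w a)) = 1"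
    and o: "\<And>i. i < q \<Longrightarrow> (\<Sum>a<n. u i a * cnj (w a)) = 0"
  shows "orthonormal_on n (Suc q) (u(q := w))"
  unfolding orthonormal_on_def
proof (intro allI impI)
  fix i j assume ij: "i < Suc q" "j < Suc q"
  have o': "(\<Sum>a<n. w a * cnj (u i a)) = 0" if "i < q" for i
  proof -
    have "(\<Sum>a<n. w a * cnj (u i a)) = cnj (\<Sum>a<n. u i a * cnj (w a))"
      by (simp add: mult.commute)
    then show ?thesis using o[OF that] by simp
  qed
  show "(\<Sum>a<n. (u(q := w)) i a * cnj ((u(q := w)) j a)) = (if i = j then 1 else 0)"
    using u w o o' ij by (auto simp: orthonormal_on_def less_Suc_eq)
qed

lemma orthonormal_on_coefficient:
  assumes v: "orthonormal_on n q v" and j: "j < q"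
    and e: "\<And>b. b < n \<Longrightarrow> (\<Sum>i<q. c i * v i b) = 0"
  shows "c j = 0"
proof -
  have "0 = (\<Sum>b<n. (\<Sum>i<q. c i * v i b) * cnj (v j b))" by (simp add: e)
  also have "\<dots> = (\<Sum>i<q. c i * (\<Sum>b<n. v i b * cnj (v j b)))"
    by (simp add: sum_distrib_left sum_distrib_right mult.assoc) (rule sum.swap)
  also have "\<dots> = (\<Sum>i<q. if i = j then c i else 0)"
    using v j by (intro sum.cong) (auto simp: orthonormal_on_def)
  also have "\<dots> = c j" using j by simp
  finally show ?thesis by simp
qed

lemma sum_cnj_mult_real:
  "(\<Sum>a\<in>A. f a * cnj (f a)) = complex_of_real (\<Sum>a\<in>A. (cmod (f a))\<^sup>2)"
  by (simp only: of_real_sum complex_norm_square)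

text \<open>One step of the singular value decomposition: if both families of factors are independent, an
  eigenvector of the Gram matrix product gives a singular triple with positive singular value, and
  deflating by it lowers the rank.\<close>

lemma singular_triple:
  assumes \<psi>: "\<And>a b. a < m \<Longrightarrow> b < n \<Longrightarrow> \<psi> a b = (\<Sum>i<Suc r. x i a * y i b)"
    and x: "\<And>c. (\<And>a. a < m \<Longrightarrow> (\<Sum>i<Suc r. c i * x i a) = 0) \<Longrightarrow> \<forall>i<Suc r. c i = 0"
    and y: "\<And>c. (\<And>b. b < n \<Longrightarrow> (\<Sum>i<Suc r. c i * y i b) = 0) \<Longrightarrow> \<forall>i<Suc r. c i = 0"
  shows "\<exists>s u v. 0 < s \<and> (\<Sum>a<m. u a * cnj (u a)) = 1 \<and> (\<Sum>b<n. v b * cnj (v b)) = 1 \<and>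
    (\<forall>b<n. (\<Sum>a<m. cnj (u a) * \<psi> a b) = complex_of_real s * v b) \<and>
    (\<forall>a<m. (\<Sum>b<n. \<psi> a b * cnj (v b)) = complex_of_real s * u a) \<and>
    tensor_rank_le r m n (\<lambda>a b. \<psi> a b - complex_of_real s * u a * v b)"
proof -
  define R where "R = Suc r"
  have R0: "0 < R" by (simp add: R_def)
  define X where "X l j = (\<Sum>a<m. cnj (x l a) * x j a)" for l j
  define Y where "Y i l = (\<Sum>b<n. y i b * cnj (y l b))" for i l
  \<comment> \<open>The composition of \<psi> after its adjoint maps the combination of the x i with
    coefficients c to the one with coefficients Y X c. So its eigenvectors in the span of the x i
    come from the small matrix Y X. This product need not be Hermitian; its eigenvector comes from
    the nonempty spectrum.\<close>
  obtain c ev where c: "\<exists>i<R. c i \<noteq> 0"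
    "\<And>i. i < R \<Longrightarrow> (\<Sum>j<R. (\<Sum>l<R. Y i l * X l j) * c j) = ev * c i"
    using ex_eigenvector[OF R0, of "\<lambda>i j. \<Sum>l<R. Y i l * X l j"] by blast
  define g where "g a = (\<Sum>i<R. c i * x i a)" for a
  define t where "t l = (\<Sum>a<m. cnj (x l a) * g a)" for l
  define h where "h b = (\<Sum>a<m. cnj (\<psi> a b) * g a)" for b
  have t: "t l = (\<Sum>j<R. X l j * c j)" for l
    unfolding t_def g_def X_def
    by (simp add: sum_distrib_left sum_distrib_right mult_ac) (rule sum.swap)
  have Yt: "(\<Sum>l<R. Y i l * t l) = ev * c i" if "i < R" for i
  proof -
    have "(\<Sum>j<R. (\<Sum>l<R. Y i l * X l j) * c j) = (\<Sum>l<R. Y i l * t l)"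
      unfolding t by (simp add: sum_distrib_left sum_distrib_right mult.assoc) (rule sum.swap)
    then show ?thesis using c(2)[OF that] by simp
  qed
  have h: "h b = (\<Sum>l<R. cnj (y l b) * t l)" if "b < n" for b
  proof -
    have "h b = (\<Sum>a<m. \<Sum>l<R. cnj (y l b) * (cnj (x l a) * g a))"
      unfolding h_def using that
      by (intro sum.cong refl) (simp add: \<psi> R_def sum_distrib_left sum_distrib_right mult_ac
          distrib_left distrib_right)
    then show ?thesis unfolding t_def by (subst (asm) sum.swap) (simp add: sum_distrib_left)
  qed
  have \<psi>h: "(\<Sum>b<n. \<psi> a b * h b) = ev * g a" if "a < m" for a
  proof -
    have "(\<Sum>b<n. \<psi> a b * h b) = (\<Sum>b<n. \<Sum>i<R. \<Sum>l<R. x i a * (y i b * cnj (y l b) * t l))"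
      using that by (intro sum.cong refl)
        (simp only: \<psi> R_def[symmetric] h lessThan_iff sum_product, simp add: mult_ac)
    also have "\<dots> = (\<Sum>i<R. x i a * (\<Sum>l<R. Y i l * t l))"
      unfolding Y_def sum_distrib_left sum_distrib_right
      by (subst sum.swap, rule sum.cong[OF refl], subst sum.swap, simp add: mult_ac)
    also have "\<dots> = ev * g a"
    proof -
      have "(\<Sum>i<R. x i a * (\<Sum>l<R. Y i l * t l)) = (\<Sum>i<R. x i a * (ev * c i))"
        by (intro sum.cong refl) (simp only: Yt lessThan_iff)
      then show ?thesis by (simp add: g_def sum_distrib_left mult_ac)
    qed
    finally show ?thesis .
  qed
  define G where "G = (\<Sum>a<m. (cmod (g a))\<^sup>2)"
  define H where "H = (\<Sum>b<n. (cmod (h b))\<^sup>2)"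
  have Gs: "(\<Sum>a<m. g a * cnj (g a)) = complex_of_real G" by (simp only: sum_cnj_mult_real G_def)
  have Hs: "(\<Sum>b<n. h b * cnj (h b)) = complex_of_real H" by (simp only: sum_cnj_mult_real H_def)
  have G0: "0 < G"
  proof -
    have "\<exists>a<m. g a \<noteq> 0"
    proof (rule ccontr)
      assume "\<not> ?thesis"
      then have "(\<Sum>i<Suc r. c i * x i a) = 0" if "a < m" for a
        using that unfolding g_def R_def by blast
      then have "\<forall>i<R. c i = 0" unfolding R_def by (rule x)
      then show False using c(1) by blast
    qed
    then obtain a where "a < m" "g a \<noteq> 0" by auto
    then show ?thesis unfolding G_def by (intro sum_pos2[of _ a]) auto
  qed
  \<comment> \<open>Comparing the squared norms shows ev = H / G, so ev is real and nonnegative; its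
    root will be the singular value.\<close>
  have HG: "complex_of_real H = ev * complex_of_real G"
  proof -
    have "complex_of_real H = (\<Sum>b<n. h b * (\<Sum>a<m. \<psi> a b * cnj (g a)))"
      unfolding Hs[symmetric] by (simp add: h_def)
    also have "\<dots> = (\<Sum>a<m. (\<Sum>b<n. \<psi> a b * h b) * cnj (g a))"
      by (simp add: sum_distrib_left sum_distrib_right mult_ac) (rule sum.swap)
    also have "\<dots> = (\<Sum>a<m. ev * (g a * cnj (g a)))"
      by (intro sum.cong refl) (simp add: \<psi>h)
    finally show ?thesis by (simp add: Gs flip: sum_distrib_left)
  qed
  \<comment> \<open>If h = 0, independence of the y l forces t = 0, and then G, which is the sum of
    all \<open>cnj (c i) * t i\<close>, vanishes as well.\<close>
  have H0: "0 < H"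
  proof (rule ccontr)
    assume "\<not> 0 < H"
    moreover have "0 \<le> H" by (auto simp: H_def intro: sum_nonneg)
    ultimately have "H = 0" by simp
    then have hz: "h b = 0" if "b < n" for b
      using that unfolding H_def by (subst (asm) sum_nonneg_eq_0_iff) auto
    have "(\<Sum>l<Suc r. cnj (t l) * y l b) = 0" if "b < n" for b
    proof -
      have "(\<Sum>l<Suc r. cnj (t l) * y l b) = cnj (h b)"
        using that by (simp only: h R_def cnj_sum) (simp add: mult.commute)
      then show ?thesis using hz[OF that] by simp
    qed
    then have tz: "\<forall>l<R. cnj (t l) = 0" using y[of "\<lambda>l. cnj (t l)"] unfolding R_def by blast
    have "complex_of_real G = (\<Sum>i<R. cnj (c i) * t i)"
      unfolding Gs[symmetric] t_def g_def[of a for a] cnj_sum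
      by (simp add: sum_distrib_left sum_distrib_right mult_ac) (rule sum.swap)
    also have "\<dots> = 0" using tz by simp
    finally show False using G0 by simp
  qed
  define s where "s = sqrt (H / G)"
  define p where "p = complex_of_real (sqrt G)"
  define q where "q = complex_of_real (sqrt H)"
  have s0: "0 < s" using G0 H0 by (simp add: s_def)
  have p: "p \<noteq> 0" "p * p = complex_of_real G" "cnj p = p"
    using G0 by (auto simp: p_def simp flip: of_real_mult)
  have q: "q \<noteq> 0" "q * q = complex_of_real H" "cnj q = q"
    using H0 by (auto simp: q_def simp flip: of_real_mult)
  have sqp: "complex_of_real s = q / p" by (simp add: s_def p_def q_def real_sqrt_divide)
  have lam: "ev * (p * p) = q * q" using HG p q by simp
  define u where "u a = g a / p" for a
  define v where "v b = cnj (h b) / q" for b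
  have uu: "(\<Sum>a<m. u a * cnj (u a)) = 1"
  proof -
    have "(\<Sum>a<m. u a * cnj (u a)) = (\<Sum>a<m. g a * cnj (g a)) / (p * p)"
      by (simp add: u_def p sum_divide_distrib)
    then show ?thesis using p G0 by (simp add: Gs)
  qed
  have vv: "(\<Sum>b<n. v b * cnj (v b)) = 1"
  proof -
    have "(\<Sum>b<n. v b * cnj (v b)) = (\<Sum>b<n. h b * cnj (h b)) / (q * q)"
      by (simp add: v_def q sum_divide_distrib mult.commute)
    then show ?thesis using q H0 by (simp add: Hs)
  qed
  have u\<psi>: "(\<Sum>a<m. cnj (u a) * \<psi> a b) = complex_of_real s * v b" for b
  proof -
    have "(\<Sum>a<m. cnj (u a) * \<psi> a b) = cnj (h b) / p"
      by (simp add: u_def h_def p sum_divide_distrib mult.commute)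
    then show ?thesis using p q by (simp add: sqp v_def)
  qed
  have \<psi>v: "(\<Sum>b<n. \<psi> a b * cnj (v b)) = complex_of_real s * u a" if "a < m" for a
  proof -
    have "(\<Sum>b<n. \<psi> a b * cnj (v b)) = ev * g a / q"
      by (simp add: v_def q \<psi>h[OF that, symmetric] sum_divide_distrib)
    also have "\<dots> = ev * (p * p) * g a / (q * p * p)" using p(1) by simp
    also have "\<dots> = complex_of_real s * u a" unfolding lam using p(1) q(1) by (simp add: sqp u_def)
    finally show ?thesis .
  qed
  \<comment> \<open>The x i are projected off u. Since u is proportional to g, the combination of
    the x i with coefficients c, the projected vectors satisfy the dependence c. So the deflated
    matrix, which is the projection of \<psi>, needs one term less.\<close>
  define x' where "x' i a = x i a - u a * (\<Sum>a'<m. cnj (u a') * x i a')" for i a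
  have "tensor_rank_le r m n (\<lambda>a b. \<psi> a b - complex_of_real s * u a * v b)"
  proof -
    obtain i0 where i0: "i0 < Suc r" "c i0 \<noteq> 0" using c(1) by (auto simp: R_def)
    show ?thesis
    proof (rule tensor_rank_le_reduce[of _ _ _ x' y r i0 c, OF _ i0])
      fix a b assume ab: "a < m" "b < n"
      have "(\<Sum>i<R. x' i a * y i b) =
          (\<Sum>i<R. x i a * y i b) - u a * (\<Sum>i<R. \<Sum>a'<m. cnj (u a') * (x i a' * y i b))"
        by (simp add: x'_def algebra_simps sum_subtractf sum_distrib_left sum_distrib_right)
      also have "(\<Sum>i<R. \<Sum>a'<m. cnj (u a') * (x i a' * y i b)) = (\<Sum>a'<m. cnj (u a') * \<psi> a' b)"
        using ab by (subst sum.swap) (simp only: sum_distrib_left[symmetric] R_def,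
            intro sum.cong refl, simp only: \<psi> lessThan_iff)
      finally show "\<psi> a b - complex_of_real s * u a * v b = (\<Sum>i<Suc r. x' i a * y i b)"
        using \<psi>[OF ab] by (simp only: u\<psi> R_def[symmetric]) (simp add: mult_ac)
    next
      fix a assume a: "a < m"
      have "(\<Sum>i<R. c i * x' i a) = g a - u a * (\<Sum>i<R. \<Sum>a'<m. cnj (u a') * (c i * x i a'))"
        by (simp add: x'_def g_def algebra_simps sum_subtractf sum_distrib_left sum_distrib_right)
      also have "(\<Sum>i<R. \<Sum>a'<m. cnj (u a') * (c i * x i a')) = (\<Sum>a'<m. cnj (u a') * g a')"
        by (subst sum.swap) (simp add: sum_distrib_left g_def)
      also have "\<dots> = p * (\<Sum>a'<m. u a' * cnj (u a'))"
        using p(1,3) by (simp add: u_def sum_distrib_left mult.commute)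
      finally show "(\<Sum>i<Suc r. c i * x' i a) = 0"
        using p(1) by (simp only: uu R_def[symmetric]) (simp add: u_def)
    qed
  qed
  then show ?thesis using s0 uu vv u\<psi> \<psi>v by blast
qed

text \<open>Induction on the bound. If no factorization of length r exists, both factor families of
  length r + 1 are independent, as a dependence would shorten the sum; hence a singular triple
  splits off.\<close>

lemma svd:
  assumes "tensor_rank_le r m n \<psi>"
  shows "\<exists>q\<le>r. \<exists>s u v. (\<forall>i<q. 0 < s i) \<and> orthonormal_on m q u \<and> orthonormal_on n q v \<and>
    (\<forall>a<m. \<forall>b<n. \<psi> a b = (\<Sum>i<q. complex_of_real (s i) * u i a * v i b))"
  using assms
proof (induction r arbitrary: \<psi>)
  case 0
  then show ?case by (auto simp: tensor_rank_le_def orthonormal_on_def)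
next
  case (Suc r)
  show ?case
  proof (cases "tensor_rank_le r m n \<psi>")
    case True
    from Suc.IH[OF this] show ?thesis using le_SucI by blast
  next
    case False
    obtain x y where \<psi>: "\<And>a b. a < m \<Longrightarrow> b < n \<Longrightarrow> \<psi> a b = (\<Sum>i<Suc r. x i a * y i b)"
      using Suc.prems unfolding tensor_rank_le_def by blast
    have "\<forall>i<Suc r. c i = 0" if "\<And>a. a < m \<Longrightarrow> (\<Sum>i<Suc r. c i * x i a) = 0" for c
      using tensor_rank_le_reduce[of m n \<psi> x y r _ c] \<psi> that False by blast
    moreover have "\<forall>i<Suc r. c i = 0" if "\<And>b. b < n \<Longrightarrow> (\<Sum>i<Suc r. c i * y i b) = 0" for c
    proof (rule ccontr)
      assume "\<not> ?thesis"
      then obtain i0 where "i0 < Suc r" "c i0 \<noteq> 0" by blast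
      moreover have "\<psi> a b = (\<Sum>i<Suc r. y i b * x i a)" if "b < n" "a < m" for a b
        using \<psi>[OF that(2,1)] by (simp add: mult.commute)
      ultimately have "tensor_rank_le r n m (\<lambda>b a. \<psi> a b)"
        using tensor_rank_le_reduce[of n m "\<lambda>b a. \<psi> a b" y x r i0 c] that by blast
      then show False using tensor_rank_le_transpose False by fastforce
    qed
    ultimately obtain s u v where s: "0 < s"
      and u: "(\<Sum>a<m. u a * cnj (u a)) = 1" and v: "(\<Sum>b<n. v b * cnj (v b)) = 1"
      and u\<psi>: "\<And>b. b < n \<Longrightarrow> (\<Sum>a<m. cnj (u a) * \<psi> a b) = complex_of_real s * v b"
      and \<psi>v: "\<And>a. a < m \<Longrightarrow> (\<Sum>b<n. \<psi> a b * cnj (v b)) = complex_of_real s * u a"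
      and rk: "tensor_rank_le r m n (\<lambda>a b. \<psi> a b - complex_of_real s * u a * v b)"
      using singular_triple[of m n \<psi> x y r] \<psi> by blast
    obtain q S U V where q: "q \<le> r" and S: "\<And>i. i < q \<Longrightarrow> 0 < S i"
      and U: "orthonormal_on m q U" and V: "orthonormal_on n q V"
      and dec: "\<And>a b. a < m \<Longrightarrow> b < n \<Longrightarrow>
        \<psi> a b - complex_of_real s * u a * v b = (\<Sum>i<q. complex_of_real (S i) * U i a * V i b)"
      using Suc.IH[OF rk] by blast
    \<comment> \<open>The singular equation makes u annihilate the deflated matrix. Expanded in the
      orthonormal V, this says that S j times the inner product of U j and u is 0 for each j, and S
      j > 0. The argument for v below is symmetric.\<close>
    have "(\<Sum>a<m. U j a * cnj (u a)) = 0" if j: "j < q" for j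
    proof -
      have "(\<Sum>i<q. complex_of_real (S i) * (\<Sum>a<m. U i a * cnj (u a)) * V i b) = 0"
        if b: "b < n" for b
      proof -
        have "(\<Sum>i<q. complex_of_real (S i) * (\<Sum>a<m. U i a * cnj (u a)) * V i b) =
            (\<Sum>a<m. cnj (u a) * (\<Sum>i<q. complex_of_real (S i) * U i a * V i b))"
          by (simp add: sum_distrib_left sum_distrib_right mult_ac) (rule sum.swap)
        also have "\<dots> = (\<Sum>a<m. cnj (u a) * (\<psi> a b - complex_of_real s * u a * v b))"
          by (intro sum.cong refl) (simp add: dec b)
        also have "\<dots> = (\<Sum>a<m. cnj (u a) * \<psi> a b) -
            (\<Sum>a<m. u a * cnj (u a)) * (complex_of_real s * v b)"
          by (simp add: right_diff_distrib sum_subtractf sum_distrib_left sum_distrib_right mult_ac)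
        finally show ?thesis by (simp add: u u\<psi>[OF b])
      qed
      from orthonormal_on_coefficient[OF V j this] show ?thesis using S[OF j] by simp
    qed
    from orthonormal_on_extend[OF U u this] have U': "orthonormal_on m (Suc q) (U(q := u))" .
    have "(\<Sum>b<n. V j b * cnj (v b)) = 0" if j: "j < q" for j
    proof -
      have "(\<Sum>i<q. complex_of_real (S i) * (\<Sum>b<n. V i b * cnj (v b)) * U i a) = 0"
        if a: "a < m" for a
      proof -
        have "(\<Sum>i<q. complex_of_real (S i) * (\<Sum>b<n. V i b * cnj (v b)) * U i a) =
            (\<Sum>b<n. cnj (v b) * (\<Sum>i<q. complex_of_real (S i) * U i a * V i b))"
          by (simp add: sum_distrib_left sum_distrib_right mult_ac) (rule sum.swap)
        also have "\<dots> = (\<Sum>b<n. cnj (v b) * (\<psi> a b - complex_of_real s * u a * v b))"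
          by (intro sum.cong refl) (simp add: dec a)
        also have "\<dots> = (\<Sum>b<n. \<psi> a b * cnj (v b)) -
            (\<Sum>b<n. v b * cnj (v b)) * (complex_of_real s * u a)"
          by (simp add: right_diff_distrib sum_subtractf sum_distrib_left sum_distrib_right mult_ac)
        finally show ?thesis by (simp add: v \<psi>v[OF a])
      qed
      from orthonormal_on_coefficient[OF U j this] show ?thesis using S[OF j] by simp
    qed
    from orthonormal_on_extend[OF V v this] have V': "orthonormal_on n (Suc q) (V(q := v))" .
    have "\<psi> a b = (\<Sum>i<Suc q. complex_of_real ((S(q := s)) i) * (U(q := u)) i a * (V(q := v)) i b)"
      if "a < m" "b < n" for a b
      using dec[OF that] by (simp add: algebra_simps)
    moreover have "0 < (S(q := s)) i" if "i < Suc q" for i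
      using that S s by (auto simp: less_Suc_eq)
    ultimately show ?thesis using U' V' q by (intro exI[of _ "Suc q"]) blast
  qed
qed

section \<open>Tensor indices, and Schmidt rank as tensor rank\<close>

lemma tensor_index_less: "a * n + b < m * n" if "a < m" "b < (n :: nat)"
proof -
  have "a * n + b < Suc a * n" using that by simp
  also have "\<dots> \<le> m * n" using that by (intro mult_le_mono1) simp
  finally show ?thesis .
qed

lemma tensor_index_div_mod:
  assumes "b < (n :: nat)"
  shows "(a * n + b) div n = a" "(a * n + b) mod n = b"
  using assms by auto

lemma tensor_index_cases:
  assumes "i < m * (n :: nat)"
  obtains a b where "i = a * n + b" "a < m" "b < n"
proof
  have "0 < n" using assms by (cases n) auto
  then show "i mod n < n" by simp
  show "i div n < m" using assms by (simp add: less_mult_imp_div_less)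
qed simp

lemma sum_tensor_index:
  fixes f :: "nat \<Rightarrow> 'a::comm_monoid_add"
  shows "(\<Sum>i<m * n. f i) = (\<Sum>a<m. \<Sum>b<n. f (a * n + b))"
proof -
  have "sum f {a * n..<a * n + n} = (\<Sum>b<n. f (a * n + b))" for a
    by (simp add: sum.atLeastLessThan_shift_0[of f "a * n"] lessThan_atLeast0)
  then show ?thesis by (simp add: sum.nat_group[symmetric])
qed

lemma cscalar_prod_sum:
  assumes "u \<in> carrier_vec n" "v \<in> carrier_vec n"
  shows "u \<bullet>c v = (\<Sum>a<n. u $ a * cnj (v $ a))"
  using assms by (auto simp: scalar_prod_def lessThan_atLeast0 intro!: sum.cong)

lemma orthonormal_family_iff:
  assumes "\<And>i. i < q \<Longrightarrow> u i \<in> carrier_vec n"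
  shows "orthonormal_family n q u \<longleftrightarrow> orthonormal_on n q (\<lambda>i a. u i $ a)"
  using assms by (auto simp: orthonormal_family_def orthonormal_on_def cscalar_prod_sum[where n = n])

lemma schmidt_decomposition_index:
  assumes "schmidt_decomposition m n \<psi> q s u v" and ab: "a < m" "b < n"
  shows "\<psi> $ (a * n + b) = (\<Sum>i<q. complex_of_real (s i) * u i $ a * v i $ b)"
proof -
  have uv: "u i \<in> carrier_vec m" "v i \<in> carrier_vec n" if "i < q" for i
    using assms that by (auto simp: schmidt_decomposition_def orthonormal_family_def)
  have "\<psi> $ (a * n + b) = (\<Sum>i<q. complex_of_real (s i) * (u i \<otimes>\<^sub>v v i) $ (a * n + b))"
    using assms tensor_index_less[OF ab] by (simp add: schmidt_decomposition_def)
  also have "\<dots> = (\<Sum>i<q. complex_of_real (s i) * u i $ a * v i $ b)"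
  proof (intro sum.cong refl)
    fix i assume "i \<in> {..<q}"
    then have "dim_vec (u i) = m" "dim_vec (v i) = n" using uv[of i] by auto
    then show "complex_of_real (s i) * (u i \<otimes>\<^sub>v v i) $ (a * n + b) =
        complex_of_real (s i) * u i $ a * v i $ b"
      using tensor_index_less[OF ab] ab by (simp add: vec_tensor_def tensor_index_div_mod)
  qed
  finally show ?thesis .
qed

text \<open>If more than k coefficients were nonzero, a nontrivial combination \<xi> of the
  conjugates of their u i would annihilate the k vectors x j, hence \<psi>. Contracting the Schmidt
  decomposition with \<xi> gives the sum of all \<open>s l * c l * v l\<close> instead, so c =
  0.\<close>

lemma schmidt_decomposition_card_le:
  assumes sd: "schmidt_decomposition m n \<psi> q s u v"
    and rk: "tensor_rank_le k m n (\<lambda>a b. \<psi> $ (a * n + b))"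
  shows "card {i. i < q \<and> s i \<noteq> 0} \<le> k"
proof (rule ccontr)
  define S where "S = {i. i < q \<and> s i \<noteq> 0}"
  assume "\<not> ?thesis"
  then have cS: "card {..<k} < card S" by (simp add: S_def)
  have fS: "finite S" by (simp add: S_def)
  have U: "orthonormal_on m q (\<lambda>i a. u i $ a)" and V: "orthonormal_on n q (\<lambda>i a. v i $ a)"
    using sd orthonormal_family_iff[of q u m] orthonormal_family_iff[of q v n]
    by (auto simp: schmidt_decomposition_def orthonormal_family_def)
  obtain x y where xy: "\<And>a b. a < m \<Longrightarrow> b < n \<Longrightarrow> \<psi> $ (a * n + b) = (\<Sum>j<k. x j a * y j b)"
    using rk unfolding tensor_rank_le_def by blast
  obtain c where c: "\<exists>i\<in>S. c i \<noteq> 0"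
    "\<And>j. j < k \<Longrightarrow> (\<Sum>i\<in>S. c i * (\<Sum>a<m. cnj (u i $ a) * x j a)) = 0"
    using linear_dependence[OF finite_lessThan fS cS, of "\<lambda>i j. \<Sum>a<m. cnj (u i $ a) * x j a"]
    by (auto simp: Ball_def)
  define \<xi> where "\<xi> a = (\<Sum>i\<in>S. c i * cnj (u i $ a))" for a
  have zero: "(\<Sum>l<q. (complex_of_real (s l) * (\<Sum>a<m. \<xi> a * u l $ a)) * v l $ b) = 0"
    if b: "b < n" for b
  proof -
    have "(\<Sum>l<q. (complex_of_real (s l) * (\<Sum>a<m. \<xi> a * u l $ a)) * v l $ b) =
        (\<Sum>a<m. \<xi> a * (\<Sum>l<q. complex_of_real (s l) * u l $ a * v l $ b))"
      by (simp add: sum_distrib_left sum_distrib_right mult_ac) (rule sum.swap)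
    also have "\<dots> = (\<Sum>a<m. \<xi> a * (\<Sum>j<k. x j a * y j b))"
    proof (intro sum.cong refl)
      fix a assume "a \<in> {..<m}"
      then show "\<xi> a * (\<Sum>l<q. complex_of_real (s l) * u l $ a * v l $ b) =
          \<xi> a * (\<Sum>j<k. x j a * y j b)"
        using schmidt_decomposition_index[OF sd _ b, of a] xy[OF _ b, of a] by simp
    qed
    also have "\<dots> = (\<Sum>j<k. (\<Sum>a<m. \<xi> a * x j a) * y j b)"
      by (simp add: sum_distrib_left sum_distrib_right mult_ac) (rule sum.swap)
    also have "\<dots> = (\<Sum>j<k. 0)"
    proof (intro sum.cong refl)
      fix j assume j: "j \<in> {..<k}"
      have "(\<Sum>a<m. \<xi> a * x j a) = (\<Sum>i\<in>S. c i * (\<Sum>a<m. cnj (u i $ a) * x j a))"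
        by (simp add: \<xi>_def sum_distrib_left sum_distrib_right mult_ac) (rule sum.swap)
      then show "(\<Sum>a<m. \<xi> a * x j a) * y j b = 0" using c(2)[of j] j by simp
    qed
    finally show ?thesis by simp
  qed
  have "c l = 0" if l: "l \<in> S" for l
  proof -
    have lq: "l < q" "s l \<noteq> 0" using l by (auto simp: S_def)
    have "(\<Sum>a<m. \<xi> a * u l $ a) = (\<Sum>i\<in>S. c i * (\<Sum>a<m. u l $ a * cnj (u i $ a)))"
      by (simp add: \<xi>_def sum_distrib_left sum_distrib_right mult_ac) (rule sum.swap)
    also have "\<dots> = (\<Sum>i\<in>S. if i = l then c i else 0)"
      using U lq by (intro sum.cong) (auto simp: orthonormal_on_def S_def)
    also have "\<dots> = c l" using l fS by simp
    finally have "(\<Sum>a<m. \<xi> a * u l $ a) = c l" .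
    moreover have "complex_of_real (s l) * (\<Sum>a<m. \<xi> a * u l $ a) = 0"
      by (rule orthonormal_on_coefficient[OF V lq(1) zero])
    ultimately show ?thesis using lq by simp
  qed
  then show False using c(1) by blast
qed

lemma tensor_rank_le_schmidt_card:
  assumes sd: "schmidt_decomposition m n \<psi> q s u v"
  shows "tensor_rank_le (card {i. i < q \<and> s i \<noteq> 0}) m n (\<lambda>a b. \<psi> $ (a * n + b))"
proof -
  define S where "S = {i. i < q \<and> s i \<noteq> 0}"
  obtain h where h: "bij_betw h {..<card S} S"
    using ex_bij_betw_nat_finite[of S] by (auto simp: S_def lessThan_atLeast0)
  have "\<psi> $ (a * n + b) = (\<Sum>j<card S. (complex_of_real (s (h j)) * u (h j) $ a) * v (h j) $ b)"
    if "a < m" "b < n" for a b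
  proof -
    have "\<psi> $ (a * n + b) = (\<Sum>i<q. complex_of_real (s i) * u i $ a * v i $ b)"
      by (rule schmidt_decomposition_index[OF sd that])
    also have "\<dots> = (\<Sum>i\<in>S. complex_of_real (s i) * u i $ a * v i $ b)"
      by (rule sum.mono_neutral_right) (auto simp: S_def)
    finally show ?thesis by (simp only: sum.reindex_bij_betw[OF h, symmetric])
  qed
  then show ?thesis unfolding tensor_rank_le_def S_def[symmetric]
    by (intro exI[of _ "\<lambda>j a. complex_of_real (s (h j)) * u (h j) $ a"] exI[of _ "\<lambda>j b. v (h j) $ b"])
      simp
qed

lemma ex_schmidt_decomposition:
  assumes \<psi>: "\<psi> \<in> carrier_vec (m * n)" and rk: "tensor_rank_le r m n (\<lambda>a b. \<psi> $ (a * n + b))"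
  shows "\<exists>q s u v. q \<le> r \<and> schmidt_decomposition m n \<psi> q s u v"
proof -
  obtain q s u v where q: "q \<le> r" "\<And>i. i < q \<Longrightarrow> 0 < s i"
    and U: "orthonormal_on m q u" and V: "orthonormal_on n q v"
    and dec: "\<And>a b. a < m \<Longrightarrow> b < n \<Longrightarrow>
      \<psi> $ (a * n + b) = (\<Sum>i<q. complex_of_real (s i) * u i a * v i b)"
    using svd[OF rk] by blast
  have "orthonormal_family m q (\<lambda>i. vec m (u i))" "orthonormal_family n q (\<lambda>i. vec n (v i))"
    using U V by (simp_all add: orthonormal_family_iff) (simp_all add: orthonormal_on_def)
  moreover have "\<psi> = vec (m * n) (\<lambda>a. \<Sum>i<q. complex_of_real (s i) * (vec m (u i) \<otimes>\<^sub>v vec n (v i)) $ a)"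
  proof (rule eq_vecI)
    fix i assume "i < dim_vec (vec (m * n)
      (\<lambda>a. \<Sum>i<q. complex_of_real (s i) * (vec m (u i) \<otimes>\<^sub>v vec n (v i)) $ a))"
    then have "i < m * n" by simp
    then obtain a b where i: "i = a * n + b" and ab: "a < m" "b < n" by (rule tensor_index_cases)
    show "\<psi> $ i = vec (m * n)
      (\<lambda>a. \<Sum>i<q. complex_of_real (s i) * (vec m (u i) \<otimes>\<^sub>v vec n (v i)) $ a) $ i"
      using tensor_index_less[OF ab] ab
      by (simp add: i dec vec_tensor_def tensor_index_div_mod mult.assoc)
  qed (use \<psi> in simp)
  ultimately have "schmidt_decomposition m n \<psi> q s (\<lambda>i. vec m (u i)) (\<lambda>i. vec n (v i))"
    using q by (auto simp: schmidt_decomposition_def intro: less_imp_le)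
  then show ?thesis using q(1) by blast
qed

text \<open>The definite description is legitimate: the nonzero terms of one Schmidt decomposition
  form a factorization, whose length bounds the number of nonzero terms of any other.\<close>

lemma schmidt_rank_le_iff:
  assumes \<psi>: "\<psi> \<in> carrier_vec (m * n)"
  shows "schmidt_rank m n \<psi> \<le> k \<longleftrightarrow> tensor_rank_le k m n (\<lambda>a b. \<psi> $ (a * n + b))"
proof -
  obtain q s u v where sd: "schmidt_decomposition m n \<psi> q s u v"
    using ex_schmidt_decomposition[OF \<psi> tensor_rank_le_dim] by blast
  have "schmidt_rank m n \<psi> = card {i. i < q \<and> s i \<noteq> 0}"
    unfolding schmidt_rank_def
  proof (rule the_equality)
    show "\<exists>q' s' u' v'. schmidt_decomposition m n \<psi> q' s' u' v' \<and>
        card {i. i < q \<and> s i \<noteq> 0} = card {i. i < q' \<and> s' i \<noteq> 0}"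
      using sd by blast
  next
    fix r assume "\<exists>q' s' u' v'. schmidt_decomposition m n \<psi> q' s' u' v' \<and>
        r = card {i. i < q' \<and> s' i \<noteq> 0}"
    then obtain q' s' u' v' where sd': "schmidt_decomposition m n \<psi> q' s' u' v'"
      and r: "r = card {i. i < q' \<and> s' i \<noteq> 0}" by blast
    show "r = card {i. i < q \<and> s i \<noteq> 0}"
      unfolding r by (intro antisym schmidt_decomposition_card_le[OF sd tensor_rank_le_schmidt_card[OF sd']]
          schmidt_decomposition_card_le[OF sd' tensor_rank_le_schmidt_card[OF sd]])
  qed
  then show ?thesis
    using schmidt_decomposition_card_le[OF sd] tensor_rank_le_mono[OF tensor_rank_le_schmidt_card[OF sd]]
    by auto
qed

subsection \<open>Schmidt numbers\<close>

lemma trace_gram: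
  assumes "\<And>i. i < dim_row \<sigma> \<Longrightarrow> \<sigma> $$ (i, i) = (\<Sum>l<L. \<eta> l i * cnj (\<eta> l i))"
  shows "mat_trace \<sigma> = complex_of_real (\<Sum>l<L. \<Sum>i<dim_row \<sigma>. (cmod (\<eta> l i))\<^sup>2)"
proof -
  have "mat_trace \<sigma> = (\<Sum>i<dim_row \<sigma>. \<Sum>l<L. \<eta> l i * cnj (\<eta> l i))"
    unfolding mat_trace_def using assms by simp
  also have "\<dots> = (\<Sum>l<L. \<Sum>i<dim_row \<sigma>. \<eta> l i * cnj (\<eta> l i))" by (rule sum.swap)
  finally show ?thesis by (simp only: sum_cnj_mult_real of_real_sum)
qed

lemma gram_pure_decomposition:
  assumes \<sigma>: "\<sigma> \<in> carrier_mat n n" and tr: "mat_trace \<sigma> = 1"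
    and g: "\<And>i j. i < n \<Longrightarrow> j < n \<Longrightarrow> \<sigma> $$ (i, j) = (\<Sum>l<L. \<eta> l i * cnj (\<eta> l j))"
  shows "\<exists>p \<psi>. pure_decomposition n \<sigma> L p \<psi> \<and>
    (\<forall>l<L. \<exists>c. \<exists>l'<L. \<psi> l = vec n (\<lambda>i. c * \<eta> l' i))"
proof -
  define p where "p l = (\<Sum>i<n. (cmod (\<eta> l i))\<^sup>2)" for l
  have p0: "0 \<le> p l" for l by (auto simp: p_def intro: sum_nonneg)
  have dim: "dim_row \<sigma> = n" using \<sigma> by simp
  have p1: "(\<Sum>l<L. p l) = 1"
  proof -
    have "mat_trace \<sigma> = complex_of_real (\<Sum>l<L. p l)"
      unfolding p_def dim[symmetric] by (rule trace_gram) (simp add: g dim)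
    then show ?thesis unfolding tr by (metis of_real_eq_1_iff)
  qed
  then obtain l0 where l0: "l0 < L" "p l0 \<noteq> 0" by (metis lessThan_iff sum.neutral zero_neq_one)
  \<comment> \<open>A zero Gram vector has weight 0 and cannot be normalized, so the vector at l0
    stands in for it. The substitute must be one of the given vectors, because the maximum in
    \<open>schmidt_number\<close> also counts terms of weight 0.\<close>
  define t where "t l = (if p l = 0 then l0 else l)" for l
  define \<psi> where "\<psi> l = vec n (\<lambda>i. complex_of_real (1 / sqrt (p (t l))) * \<eta> (t l) i)" for l
  have pt: "0 < p (t l)" for l using l0 p0[of "t l"] by (auto simp: t_def less_le)
  have unit: "\<psi> l \<in> unit_vectors n" for l
  proof -
    have "\<psi> l \<bullet>c \<psi> l = (\<Sum>i<n. complex_of_real (1 / p (t l)) * (\<eta> (t l) i * cnj (\<eta> (t l) i)))"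
      using pt[of l] by (subst cscalar_prod_sum[of _ n])
        (auto simp: \<psi>_def field_simps simp flip: of_real_mult intro!: sum.cong)
    also have "\<dots> = 1"
      using pt[of l] by (simp only: sum_distrib_left[symmetric] sum_cnj_mult_real p_def[symmetric])
        (simp flip: of_real_mult)
    finally show ?thesis by (simp add: unit_vectors_def \<psi>_def)
  qed
  have term_eq: "complex_of_real (p l) * (\<psi> l $ i * cnj (\<psi> l $ j)) = \<eta> l i * cnj (\<eta> l j)"
    if ij: "i < n" "j < n" for i j l
  proof (cases "p l = 0")
    case True
    then have "\<forall>i\<in>{..<n}. (cmod (\<eta> l i))\<^sup>2 = 0"
      unfolding p_def by (subst (asm) sum_nonneg_eq_0_iff) auto
    then show ?thesis using True ij by simp
  next
    case False
    then have "0 < p l" using p0[of l] by simp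
    then have "complex_of_real (sqrt (p l)) * complex_of_real (sqrt (p l)) = complex_of_real (p l)"
      by (simp flip: of_real_mult)
    then show ?thesis using ij False \<open>0 < p l\<close> by (simp add: \<psi>_def t_def field_simps)
  qed
  have "\<sigma> = mat_sum n (\<lambda>l. complex_of_real (p l) \<cdot>\<^sub>m ket_bra (\<psi> l)) {..<L}"
  proof (rule eq_matI)
    fix i j
    assume "i < dim_row (mat_sum n (\<lambda>l. complex_of_real (p l) \<cdot>\<^sub>m ket_bra (\<psi> l)) {..<L})"
      "j < dim_col (mat_sum n (\<lambda>l. complex_of_real (p l) \<cdot>\<^sub>m ket_bra (\<psi> l)) {..<L})"
    then have ij: "i < n" "j < n" by (auto simp: mat_sum_def)
    have "dim_vec (\<psi> l) = n" for l by (simp add: \<psi>_def)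
    then show "\<sigma> $$ (i, j) = mat_sum n (\<lambda>l. complex_of_real (p l) \<cdot>\<^sub>m ket_bra (\<psi> l)) {..<L} $$ (i, j)"
      using ij by (simp add: mat_sum_def ket_bra_def g term_eq)
  qed (use \<sigma> in \<open>auto simp: mat_sum_def\<close>)
  then have "pure_decomposition n \<sigma> L p \<psi>"
    using p0 p1 unit by (simp add: pure_decomposition_def prob_vector_def)
  moreover have "\<exists>c. \<exists>l'<L. \<psi> l = vec n (\<lambda>i. c * \<eta> l' i)" if "l < L" for l
    using that l0 unfolding \<psi>_def
    by (intro exI[of _ "complex_of_real (1 / sqrt (p (t l)))"] exI[of _ "t l"]) (simp add: t_def)
  ultimately show ?thesis by blast
qed

lemma pure_decomposition_gram:
  assumes pd: "pure_decomposition n \<sigma> L p \<psi>" and ij: "i < n" "j < n"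
  shows "\<sigma> $$ (i, j) = (\<Sum>l<L. complex_of_real (p l) * (\<psi> l $ i * cnj (\<psi> l $ j)))"
proof -
  have "dim_vec (\<psi> l) = n" if "l < L" for l
    using pd that by (auto simp: pure_decomposition_def unit_vectors_def)
  moreover have "\<sigma> = mat_sum n (\<lambda>j. complex_of_real (p j) \<cdot>\<^sub>m ket_bra (\<psi> j)) {..<L}"
    using pd by (simp add: pure_decomposition_def)
  ultimately show ?thesis using ij by (simp add: mat_sum_def ket_bra_def)
qed

lemma schmidt_number_leI:
  fixes \<eta> :: "nat \<Rightarrow> nat \<Rightarrow> complex"
  assumes \<sigma>: "\<sigma> \<in> carrier_mat (m * n) (m * n)" and tr: "mat_trace \<sigma> = 1"
    and g: "\<And>i j. i < m * n \<Longrightarrow> j < m * n \<Longrightarrow> \<sigma> $$ (i, j) = (\<Sum>l<L. \<eta> l i * cnj (\<eta> l j))"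
    and rk: "\<And>l. l < L \<Longrightarrow> tensor_rank_le k m n (\<lambda>a b. \<eta> l (a * n + b))"
  shows "schmidt_number m n \<sigma> \<le> k"
proof -
  obtain p \<psi> where pd: "pure_decomposition (m * n) \<sigma> L p \<psi>"
    and \<psi>: "\<And>l. l < L \<Longrightarrow> \<exists>c. \<exists>l'<L. \<psi> l = vec (m * n) (\<lambda>i. c * \<eta> l' i)"
    using gram_pure_decomposition[OF \<sigma> tr g] by blast
  have "schmidt_rank m n (\<psi> l) \<le> k" if l: "l < L" for l
  proof -
    obtain c l' where l': "l' < L" "\<psi> l = vec (m * n) (\<lambda>i. c * \<eta> l' i)" using \<psi>[OF l] by blast
    have "tensor_rank_le k m n (\<lambda>a b. c * \<eta> l' (a * n + b))"
      by (rule tensor_rank_le_scale[OF rk[OF l'(1)]])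
    then have "tensor_rank_le k m n (\<lambda>a b. \<psi> l $ (a * n + b))"
      unfolding tensor_rank_le_def by (simp add: l'(2) tensor_index_less)
    then show ?thesis by (subst schmidt_rank_le_iff) (simp_all add: l'(2))
  qed
  moreover have "0 < L" using pd by (cases L) (auto simp: pure_decomposition_def prob_vector_def)
  ultimately have "Max ((\<lambda>l. schmidt_rank m n (\<psi> l)) ` {..<L}) \<le> k" by (subst Max_le_iff) auto
  moreover have "schmidt_number m n \<sigma> \<le> Max ((\<lambda>l. schmidt_rank m n (\<psi> l)) ` {..<L})"
    unfolding schmidt_number_def using pd by (intro Least_le) blast
  ultimately show ?thesis by simp
qed

text \<open>The Gram decomposition of \<sigma> shows that the set in the definition is inhabited, so
  the minimum is attained by an actual decomposition.\<close>

lemma schmidt_number_leD: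
  assumes \<sigma>: "\<sigma> \<in> density_ops (m * n)" and le: "schmidt_number m n \<sigma> \<le> k"
  shows "\<exists>L p \<psi>. pure_decomposition (m * n) \<sigma> L p \<psi> \<and>
    (\<forall>l<L. tensor_rank_le k m n (\<lambda>a b. \<psi> l $ (a * n + b)))"
proof -
  have psd: "psd (m * n) \<sigma>" and tr: "mat_trace \<sigma> = 1" using \<sigma> by (auto simp: density_ops_def)
  obtain \<eta> where \<eta>: "\<And>i j. i < m * n \<Longrightarrow> j < m * n \<Longrightarrow>
      \<sigma> $$ (i, j) = (\<Sum>l<m * n. \<eta> l i * cnj (\<eta> l j))"
    using psd_gram[OF psd] by blast
  have "\<sigma> \<in> carrier_mat (m * n) (m * n)" using psd by (simp add: psd_def)
  from gram_pure_decomposition[OF this tr \<eta>]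
  have "\<exists>r L p \<psi>. pure_decomposition (m * n) \<sigma> L p \<psi> \<and>
      r = Max ((\<lambda>l. schmidt_rank m n (\<psi> l)) ` {..<L})" by blast
  from LeastI_ex[OF this] obtain L p \<psi> where pd: "pure_decomposition (m * n) \<sigma> L p \<psi>"
    and r: "schmidt_number m n \<sigma> = Max ((\<lambda>l. schmidt_rank m n (\<psi> l)) ` {..<L})"
    unfolding schmidt_number_def by blast
  have "tensor_rank_le k m n (\<lambda>a b. \<psi> l $ (a * n + b))" if l: "l < L" for l
  proof -
    have "schmidt_rank m n (\<psi> l) \<le> schmidt_number m n \<sigma>"
      unfolding r using l by (intro Max_ge) auto
    moreover have "\<psi> l \<in> carrier_vec (m * n)"
      using pd l by (auto simp: pure_decomposition_def unit_vectors_def)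
    ultimately show ?thesis using schmidt_rank_le_iff le by fastforce
  qed
  then show ?thesis using pd by blast
qed

subsection \<open>The Choi matrix and Schmidt-number-breaking channels\<close>

text \<open>The local operator F acts on the first factor of each product and leaves the number of
  products unchanged.\<close>

lemma tensor_rank_le_contract_left:
  assumes "tensor_rank_le k m n \<psi>"
  shows "tensor_rank_le k m' n (\<lambda>\<alpha> a. \<Sum>i<m. F \<alpha> i * \<psi> i a)"
proof -
  obtain x y where xy: "\<And>a b. a < m \<Longrightarrow> b < n \<Longrightarrow> \<psi> a b = (\<Sum>r<k. x r a * y r b)"
    using assms unfolding tensor_rank_le_def by blast
  have "(\<Sum>i<m. F \<alpha> i * \<psi> i b) = (\<Sum>r<k. (\<Sum>i<m. F \<alpha> i * x r i) * y r b)" if "b < n" for \<alpha> b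
  proof -
    have "(\<Sum>i<m. F \<alpha> i * \<psi> i b) = (\<Sum>i<m. \<Sum>r<k. F \<alpha> i * x r i * y r b)"
      using that by (intro sum.cong refl) (simp add: xy sum_distrib_left mult.assoc)
    also have "\<dots> = (\<Sum>r<k. \<Sum>i<m. F \<alpha> i * x r i * y r b)" by (rule sum.swap)
    finally show ?thesis by (simp add: sum_distrib_right)
  qed
  then show ?thesis unfolding tensor_rank_le_def
    by (intro exI[of _ "\<lambda>r \<alpha>. \<Sum>i<m. F \<alpha> i * x r i"] exI[of _ y]) simp
qed

lemma tensor_rank_le_contract_right:
  assumes "tensor_rank_le k m n \<psi>"
  shows "tensor_rank_le k m n' (\<lambda>i a. \<Sum>p<n. \<psi> i p * F p a)"
proof -
  have "tensor_rank_le k n' m (\<lambda>a i. \<Sum>p<n. F p a * \<psi> i p)"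
    by (rule tensor_rank_le_contract_left[OF tensor_rank_le_transpose[OF assms]])
  from tensor_rank_le_transpose[OF this] show ?thesis by (simp add: mult.commute)
qed

definition unit_mat :: "nat \<Rightarrow> nat \<Rightarrow> nat \<Rightarrow> complex mat" where
  "unit_mat d i j = mat d d (\<lambda>(a, b). if a = i \<and> b = j then 1 else 0)"

lemma linear_on_mats_sum:
  assumes E: "linear_on_mats d E" and S: "finite S" and F: "\<And>x. x \<in> S \<Longrightarrow> F x \<in> carrier_mat d d"
    and ab: "a < d" "b < d"
  shows "E (mat_sum d (\<lambda>x. c x \<cdot>\<^sub>m F x) S) $$ (a, b) = (\<Sum>x\<in>S. c x * E (F x) $$ (a, b))"
  using S F
proof (induction S rule: finite_induct)
  case empty
  have "mat_sum d (\<lambda>x. c x \<cdot>\<^sub>m F x) {} = 0 \<cdot>\<^sub>m 0\<^sub>m d d"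
    by (rule eq_matI) (auto simp: mat_sum_def)
  moreover have "E (0 \<cdot>\<^sub>m 0\<^sub>m d d) = 0 \<cdot>\<^sub>m E (0\<^sub>m d d)" "E (0\<^sub>m d d) \<in> carrier_mat d d"
    using E zero_carrier_mat unfolding linear_on_mats_def by blast+
  moreover have "(0 \<cdot>\<^sub>m M) $$ (a, b) = 0" if "M \<in> carrier_mat d d" for M :: "complex mat"
    using ab that by simp
  ultimately show ?case by (simp only: sum.empty)
next
  case (insert x S)
  let ?M = "mat_sum d (\<lambda>x. c x \<cdot>\<^sub>m F x) S"
  have M: "?M \<in> carrier_mat d d" by (simp add: mat_sum_def)
  have Fx: "F x \<in> carrier_mat d d" using insert by simp
  have "mat_sum d (\<lambda>x. c x \<cdot>\<^sub>m F x) (insert x S) = c x \<cdot>\<^sub>m F x + ?M"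
    using insert Fx by (intro eq_matI) (auto simp: mat_sum_def)
  moreover have "E (c x \<cdot>\<^sub>m F x + ?M) = c x \<cdot>\<^sub>m E (F x) + E ?M"
    using E Fx M by (simp add: linear_on_mats_def)
  moreover have "E (F x) \<in> carrier_mat d d" "E ?M \<in> carrier_mat d d"
    using E Fx M by (auto simp: linear_on_mats_def)
  ultimately show ?case using ab insert by auto
qed

lemma linear_on_mats_expand:
  assumes E: "linear_on_mats d E" and A: "A \<in> carrier_mat d d" and ab: "a < d" "b < d"
  shows "E A $$ (a, b) = (\<Sum>i<d. \<Sum>j<d. A $$ (i, j) * E (unit_mat d i j) $$ (a, b))"
proof -
  let ?S = "{..<d} \<times> {..<d}"
  have "A = mat_sum d (\<lambda>x. A $$ x \<cdot>\<^sub>m unit_mat d (fst x) (snd x)) ?S"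
  proof (rule eq_matI)
    fix i j
    assume "i < dim_row (mat_sum d (\<lambda>x. A $$ x \<cdot>\<^sub>m unit_mat d (fst x) (snd x)) ?S)"
      "j < dim_col (mat_sum d (\<lambda>x. A $$ x \<cdot>\<^sub>m unit_mat d (fst x) (snd x)) ?S)"
    then have ij: "i < d" "j < d" by (auto simp: mat_sum_def)
    have "(\<Sum>x\<in>?S. (A $$ x \<cdot>\<^sub>m unit_mat d (fst x) (snd x)) $$ (i, j)) =
        (\<Sum>x\<in>?S. if x = (i, j) then A $$ x else 0)"
      using ij by (intro sum.cong) (auto simp: unit_mat_def)
    also have "\<dots> = A $$ (i, j)" using ij by simp
    finally show "A $$ (i, j) = mat_sum d (\<lambda>x. A $$ x \<cdot>\<^sub>m unit_mat d (fst x) (snd x)) ?S $$ (i, j)"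
      using ij by (simp add: mat_sum_def)
  qed (use A in \<open>auto simp: mat_sum_def\<close>)
  then have "E A $$ (a, b) = E (mat_sum d (\<lambda>x. A $$ x \<cdot>\<^sub>m unit_mat d (fst x) (snd x)) ?S) $$ (a, b)"
    by simp
  also have "\<dots> = (\<Sum>x\<in>?S. A $$ x * E (unit_mat d (fst x) (snd x)) $$ (a, b))"
    by (rule linear_on_mats_sum[OF E _ _ ab]) (auto simp: unit_mat_def)
  finally show ?thesis by (simp add: sum.cartesian_product case_prod_unfold)
qed

lemma id_tensor_index:
  assumes "\<alpha> < m" "a < d" "\<beta> < m" "b < d"
  shows "id_tensor m d E X $$ (\<alpha> * d + a, \<beta> * d + b) = E (block d X \<alpha> \<beta>) $$ (a, b)"
  using assms by (simp add: id_tensor_def tensor_index_less)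

lemma id_tensor_density:
  assumes E: "quantum_channel d E" and m: "1 \<le> m" and \<rho>: "\<rho> \<in> density_ops (m * d)"
  shows "id_tensor m d E \<rho> \<in> density_ops (m * d)"
proof -
  have lin: "linear_on_mats d E" and tp: "\<And>A. A \<in> carrier_mat d d \<Longrightarrow> mat_trace (E A) = mat_trace A"
    and cp: "completely_positive d E"
    using E by (auto simp: quantum_channel_def)
  have \<rho>c: "\<rho> \<in> carrier_mat (m * d) (m * d)" using \<rho> by (auto simp: density_ops_def psd_def)
  have "mat_trace (id_tensor m d E \<rho>) = (\<Sum>\<alpha><m. \<Sum>a<d. E (block d \<rho> \<alpha> \<alpha>) $$ (a, a))"
    unfolding mat_trace_def by (simp add: id_tensor_def sum_tensor_index tensor_index_less)
  also have "\<dots> = (\<Sum>\<alpha><m. mat_trace (E (block d \<rho> \<alpha> \<alpha>)))"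
  proof (intro sum.cong refl)
    fix \<alpha>
    have "E (block d \<rho> \<alpha> \<alpha>) \<in> carrier_mat d d"
      using lin by (simp add: linear_on_mats_def block_def)
    then show "(\<Sum>a<d. E (block d \<rho> \<alpha> \<alpha>) $$ (a, a)) = mat_trace (E (block d \<rho> \<alpha> \<alpha>))"
      by (simp add: mat_trace_def)
  qed
  also have "\<dots> = (\<Sum>\<alpha><m. mat_trace (block d \<rho> \<alpha> \<alpha>))"
    by (simp add: tp block_def)
  also have "\<dots> = mat_trace \<rho>"
    using \<rho>c by (simp add: mat_trace_def block_def sum_tensor_index)
  finally have "mat_trace (id_tensor m d E \<rho>) = 1" using \<rho> by (simp add: density_ops_def)
  moreover have "psd (m * d) (id_tensor m d E \<rho>)"
    using cp m \<rho> by (simp add: completely_positive_def density_ops_def)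
  ultimately show ?thesis by (simp add: density_ops_def)
qed

text \<open>The \<chi> l are Choi vectors of N. A Gram vector of \<rho>, read as an m by d matrix,
  acts on their first factor as a local operator; the results are Gram vectors of the output
  state.\<close>

lemma SNBC_I:
  fixes \<chi> :: "nat \<Rightarrow> nat \<Rightarrow> complex"
  assumes N: "quantum_channel d N"
    and kraus: "\<And>i j a b. i < d \<Longrightarrow> j < d \<Longrightarrow> a < d \<Longrightarrow> b < d \<Longrightarrow>
      N (unit_mat d i j) $$ (a, b) = (\<Sum>l<L. \<chi> l (i * d + a) * cnj (\<chi> l (j * d + b)))"
    and rk: "\<And>l. l < L \<Longrightarrow> tensor_rank_le k d d (\<lambda>a b. \<chi> l (a * d + b))"
  shows "N \<in> SNBC k d"
  unfolding SNBC_def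
proof (intro CollectI conjI N allI impI ballI)
  fix m \<rho> assume m: "1 \<le> (m::nat)" and \<rho>: "\<rho> \<in> density_ops (m * d)"
  have lin: "linear_on_mats d N" using N by (auto simp: quantum_channel_def)
  have "psd (m * d) \<rho>" using \<rho> by (simp add: density_ops_def)
  then obtain \<phi> where \<phi>: "\<And>i j. i < m * d \<Longrightarrow> j < m * d \<Longrightarrow>
      \<rho> $$ (i, j) = (\<Sum>s<m * d. \<phi> s i * cnj (\<phi> s j))"
    using psd_gram by blast
  \<comment> \<open>The index p encodes a pair, with s = p div L choosing the Gram vector of \<rho>
    and l = p mod L the Choi vector.\<close>
  define \<eta> where "\<eta> p r = (\<Sum>i<d. \<phi> (p div L) ((r div d) * d + i) * \<chi> (p mod L) (i * d + r mod d))"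
    for p r
  have dens: "id_tensor m d N \<rho> \<in> density_ops (m * d)" by (rule id_tensor_density[OF N m \<rho>])
  show "schmidt_number m d (id_tensor m d N \<rho>) \<le> k"
  proof (rule schmidt_number_leI[where L = "m * d * L" and \<eta> = \<eta>])
    show "id_tensor m d N \<rho> \<in> carrier_mat (m * d) (m * d)" by (simp add: id_tensor_def)
    show "mat_trace (id_tensor m d N \<rho>) = 1" using dens by (simp add: density_ops_def)
  next
    fix u v assume "u < m * d" "v < m * d"
    then obtain \<alpha> a \<beta> b where u: "u = \<alpha> * d + a" "\<alpha> < m" "a < d"
      and v: "v = \<beta> * d + b" "\<beta> < m" "b < d"
      by (metis tensor_index_cases)
    have "id_tensor m d N \<rho> $$ (u, v) = N (block d \<rho> \<alpha> \<beta>) $$ (a, b)"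
      using u v by (simp add: id_tensor_index)
    also have "\<dots> = (\<Sum>i<d. \<Sum>j<d. block d \<rho> \<alpha> \<beta> $$ (i, j) * N (unit_mat d i j) $$ (a, b))"
      by (rule linear_on_mats_expand[OF lin _ u(3) v(3)]) (simp add: block_def)
    also have "\<dots> = (\<Sum>i<d. \<Sum>j<d. (\<Sum>s<m * d. \<phi> s (\<alpha> * d + i) * cnj (\<phi> s (\<beta> * d + j))) *
        (\<Sum>l<L. \<chi> l (i * d + a) * cnj (\<chi> l (j * d + b))))"
      using u v by (intro sum.cong refl) (simp add: block_def \<phi> kraus tensor_index_less)
    also have "\<dots> = (\<Sum>i<d. \<Sum>j<d. \<Sum>s<m * d. \<Sum>l<L.
        (\<phi> s (\<alpha> * d + i) * \<chi> l (i * d + a)) * cnj (\<phi> s (\<beta> * d + j) * \<chi> l (j * d + b)))"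
      by (simp only: sum_product) (simp add: mult_ac)
    also have "\<dots> = (\<Sum>s<m * d. \<Sum>l<L. \<Sum>i<d. \<Sum>j<d.
        (\<phi> s (\<alpha> * d + i) * \<chi> l (i * d + a)) * cnj (\<phi> s (\<beta> * d + j) * \<chi> l (j * d + b)))"
      by (simp only: sum.cartesian_product case_prod_unfold, rule sum.reindex_bij_witness[of _
        "\<lambda>(s, l, i, j). (i, j, s, l)" "\<lambda>(i, j, s, l). (s, l, i, j)"]) auto
    also have "\<dots> = (\<Sum>s<m * d. \<Sum>l<L. (\<Sum>i<d. \<phi> s (\<alpha> * d + i) * \<chi> l (i * d + a)) *
        cnj (\<Sum>j<d. \<phi> s (\<beta> * d + j) * \<chi> l (j * d + b)))"
      by (simp only: sum_product cnj_sum)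
    also have "\<dots> = (\<Sum>s<m * d. \<Sum>l<L. \<eta> (s * L + l) u * cnj (\<eta> (s * L + l) v))"
      using u v by (intro sum.cong refl) (simp add: \<eta>_def)
    finally show "id_tensor m d N \<rho> $$ (u, v) = (\<Sum>p<m * d * L. \<eta> p u * cnj (\<eta> p v))"
      by (simp only: sum_tensor_index[of _ "m * d" L])
  next
    fix p assume p: "p < m * d * L"
    then have "0 < L" by (cases L) auto
    then have "tensor_rank_le k d d (\<lambda>a b. \<chi> (p mod L) (a * d + b))" by (intro rk) simp
    from tensor_rank_le_contract_left[OF this, of m "\<lambda>\<alpha> i. \<phi> (p div L) (\<alpha> * d + i)"]
    show "tensor_rank_le k m d (\<lambda>a b. \<eta> p (a * d + b))"
      unfolding tensor_rank_le_def \<eta>_def by simp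
  qed
qed

section \<open>The maximally entangled state and Choi vectors\<close>

definition max_entangled :: "nat \<Rightarrow> complex mat" where
  "max_entangled d = mat (d * d) (d * d)
     (\<lambda>(r, s). if r div d = r mod d \<and> s div d = s mod d then 1 / of_nat d else 0)"

lemma max_entangled_index:
  assumes "i < d" "a < d" "j < d" "b < d"
  shows "max_entangled d $$ (i * d + a, j * d + b) = (if a = i \<and> b = j then 1 / of_nat d else 0)"
  using assms by (auto simp: max_entangled_def tensor_index_less)

lemma max_entangled_psd: "psd (d * d) (max_entangled d)"
proof (rule gram_psd[where L = 1])
  fix r s assume "r < d * d" "s < d * d"
  then show "max_entangled d $$ (r, s) =
      (\<Sum>l<1::nat. (if r div d = r mod d then 1 / complex_of_real (sqrt (real d)) else 0) *
        cnj (if s div d = s mod d then 1 / complex_of_real (sqrt (real d)) else 0))"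
    by (simp add: max_entangled_def flip: of_real_mult)
qed (simp add: max_entangled_def)

lemma max_entangled_density:
  assumes "1 \<le> d"
  shows "max_entangled d \<in> density_ops (d * d)"
proof -
  have "mat_trace (max_entangled d) = (\<Sum>i<d. \<Sum>a<d. if a = i then 1 / of_nat d else 0)"
  proof -
    have "dim_row (max_entangled d) = d * d" by (simp add: max_entangled_def)
    then show ?thesis
      by (simp add: mat_trace_def sum_tensor_index max_entangled_index)
  qed
  also have "\<dots> = 1" using assms by simp
  finally show ?thesis using max_entangled_psd by (simp add: density_ops_def)
qed

lemma choi_index:
  assumes E: "linear_on_mats d E" and "i < d" "a < d" "j < d" "b < d"
  shows "id_tensor d d E (max_entangled d) $$ (i * d + a, j * d + b) =
    E (unit_mat d i j) $$ (a, b) / of_nat d"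
proof -
  have "block d (max_entangled d) i j = (1 / of_nat d) \<cdot>\<^sub>m unit_mat d i j"
    by (rule eq_matI) (use assms in \<open>auto simp: block_def unit_mat_def max_entangled_index\<close>)
  moreover have "E ((1 / of_nat d) \<cdot>\<^sub>m unit_mat d i j) = (1 / of_nat d) \<cdot>\<^sub>m E (unit_mat d i j)"
    "E (unit_mat d i j) \<in> carrier_mat d d"
    using E by (auto simp: linear_on_mats_def unit_mat_def)
  ultimately show ?thesis using assms by (simp add: id_tensor_index)
qed

text \<open>Converse of \<open>SNBC_I\<close>: the definition is instantiated with m = d and the
  maximally entangled state, whose image has the entries of all \<open>E (unit_mat d i j)\<close>,
  divided by d.\<close>

lemma SNBC_D:
  assumes d: "1 \<le> d" and E: "E \<in> SNBC k d"
  shows "\<exists>(L::nat) \<chi>. (\<forall>l<L. tensor_rank_le k d d (\<lambda>a b. \<chi> l (a * d + b))) \<and>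
    (\<forall>i<d. \<forall>j<d. \<forall>a<d. \<forall>b<d. E (unit_mat d i j) $$ (a, b) =
      (\<Sum>l<L. \<chi> l (i * d + a) * cnj (\<chi> l (j * d + b))))"
proof -
  have ch: "quantum_channel d E" and lin: "linear_on_mats d E"
    and sn: "schmidt_number d d (id_tensor d d E (max_entangled d)) \<le> k"
    using E d max_entangled_density[OF d] by (auto simp: SNBC_def quantum_channel_def)
  obtain L p \<psi> where pd: "pure_decomposition (d * d) (id_tensor d d E (max_entangled d)) L p \<psi>"
    and rk: "\<And>l. l < L \<Longrightarrow> tensor_rank_le k d d (\<lambda>a b. \<psi> l $ (a * d + b))"
    using schmidt_number_leD[OF id_tensor_density[OF ch d max_entangled_density[OF d]] sn] by blast
  \<comment> \<open>The root absorbs the weight p l into the vector, and the factor d undoes the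
    normalization of \<open>max_entangled\<close>.\<close>
  define t where "t l = complex_of_real (sqrt (real d * p l))" for l
  define \<chi> where "\<chi> l r = t l * \<psi> l $ r" for l r
  have t: "t l * cnj (t l) = of_nat d * complex_of_real (p l)" if "l < L" for l
  proof -
    have "0 \<le> real d * p l" using pd that by (auto simp: pure_decomposition_def prob_vector_def)
    then have "sqrt (real d * p l) * sqrt (real d * p l) = real d * p l" by simp
    then have "complex_of_real (sqrt (real d * p l) * sqrt (real d * p l)) = of_nat d * complex_of_real (p l)"
      by (simp only: of_real_mult of_real_of_nat_eq)
    then show ?thesis by (simp only: t_def of_real_mult complex_cnj_complex_of_real)
  qed
  have "E (unit_mat d i j) $$ (a, b) = (\<Sum>l<L. \<chi> l (i * d + a) * cnj (\<chi> l (j * d + b)))"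
    if "i < d" "j < d" "a < d" "b < d" for i j a b
  proof -
    have "E (unit_mat d i j) $$ (a, b) =
        of_nat d * id_tensor d d E (max_entangled d) $$ (i * d + a, j * d + b)"
      using choi_index[OF lin that(1,3,2,4)] d by simp
    also have "\<dots> = (\<Sum>l<L. (of_nat d * complex_of_real (p l)) *
        (\<psi> l $ (i * d + a) * cnj (\<psi> l $ (j * d + b))))"
      unfolding pure_decomposition_gram[OF pd tensor_index_less[OF that(1,3)]
          tensor_index_less[OF that(2,4)]]
      by (simp add: sum_distrib_left mult.assoc)
    also have "\<dots> = (\<Sum>l<L. \<chi> l (i * d + a) * cnj (\<chi> l (j * d + b)))"
      by (intro sum.cong refl) (simp add: \<chi>_def mult_ac flip: t)
    finally show ?thesis .
  qed
  moreover have "tensor_rank_le k d d (\<lambda>a b. \<chi> l (a * d + b))" if "l < L" for l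
    unfolding \<chi>_def by (rule tensor_rank_le_scale[OF rk[OF that]])
  ultimately show ?thesis by blast
qed

text \<open>A game needs two different states, and dimension 1 has only one. This lemma rules that
  dimension out for a channel outside \<open>SNBC\<close>: there, every vector of the tensor product
  has rank at most 1.\<close>

lemma SNBC_1:
  assumes N: "quantum_channel 1 N" and k: "1 \<le> k"
  shows "N \<in> SNBC k 1"
proof -
  have "psd (1 * 1) (id_tensor 1 1 N (max_entangled 1))"
    using id_tensor_density[OF N order_refl max_entangled_density[OF order_refl]]
    by (simp add: density_ops_def)
  then obtain \<eta> :: "nat \<Rightarrow> nat \<Rightarrow> complex" where
    \<eta>: "\<forall>i<1 * 1. \<forall>j<1 * 1. id_tensor 1 1 N (max_entangled 1) $$ (i, j) =
      (\<Sum>l<1 * 1. \<eta> l i * cnj (\<eta> l j))"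
    using psd_gram by blast
  have lin: "linear_on_mats 1 N" using N by (simp add: quantum_channel_def)
  show ?thesis
  proof (rule SNBC_I[OF N, where L = 1 and \<chi> = \<eta>])
    fix i j a b :: nat assume "i < 1" "j < 1" "a < 1" "b < 1"
    then show "N (unit_mat 1 i j) $$ (a, b) = (\<Sum>l<1. \<eta> l (i * 1 + a) * cnj (\<eta> l (j * 1 + b)))"
      using choi_index[OF lin, of 0 0 0 0] \<eta> by simp
  next
    fix l :: nat
    show "tensor_rank_le k 1 1 (\<lambda>a b. \<eta> l (a * 1 + b))"
      by (rule tensor_rank_le_mono[OF tensor_rank_le_dim k])
  qed
qed

subsection \<open>A witness for channels that are not Schmidt-number-breaking\<close>

text \<open>Hermitian matrices are determined by the real array \<open>Re P + Im P\<close>, since \<open>Re P\<close> is symmetric and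
  \<open>Im P\<close> antisymmetric; this identifies them with a real coordinate space.\<close>

definition herm_coords :: "(nat \<Rightarrow> nat \<Rightarrow> complex) \<Rightarrow> nat \<times> nat \<Rightarrow> real" where
  "herm_coords P = (\<lambda>(r, s). Re (P r s) + Im (P r s))"

lemma herm_coords_inject:
  assumes "herm_coords P (r, s) = herm_coords Q (r, s)" "herm_coords P (s, r) = herm_coords Q (s, r)"
    and "P s r = cnj (P r s)" "Q s r = cnj (Q r s)"
  shows "P r s = Q r s"
  using assms by (auto simp: herm_coords_def complex_eq_iff)

definition tensor_sum :: "nat \<Rightarrow> nat \<Rightarrow> (nat \<Rightarrow> nat \<Rightarrow> complex) \<Rightarrow> (nat \<Rightarrow> nat \<Rightarrow> complex) \<Rightarrow> nat \<Rightarrow> complex" where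
  "tensor_sum k d x y r = (\<Sum>i<k. x i (r div d) * y i (r mod d))"

text \<open>The pure states of rank at most k in Hermitian coordinates. The bound confines the
  parameters x and y to a compact set. It loses no state, as the singular value decomposition
  provides factors of modulus at most d.\<close>

definition low_rank_states :: "nat \<Rightarrow> nat \<Rightarrow> (nat \<times> nat \<Rightarrow> real) set" where
  "low_rank_states k d = {herm_coords (\<lambda>r s. tensor_sum k d x y r * cnj (tensor_sum k d x y s)) | x y.
     (\<forall>i<k. \<forall>a<d. cmod (x i a) \<le> real (d * d) \<and> cmod (y i a) \<le> real (d * d)) \<and>
     (\<Sum>r<d * d. (cmod (tensor_sum k d x y r))\<^sup>2) = 1}"

text \<open>The factors lie in a bounded box and converge along a subsequence; the norm condition
  and the coordinates depend continuously on them.\<close>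

lemma low_rank_states_seq_compact:
  "coord_seq_compact ({..<d * d} \<times> {..<d * d}) (low_rank_states k d)"
  unfolding coord_seq_compact_def
proof (intro allI impI)
  fix f :: "nat \<Rightarrow> nat \<times> nat \<Rightarrow> real"
  assume "\<forall>n. f n \<in> low_rank_states k d"
  then have "\<forall>n. \<exists>x y. f n = herm_coords (\<lambda>r s. tensor_sum k d x y r * cnj (tensor_sum k d x y s)) \<and>
      (\<forall>i<k. \<forall>a<d. cmod (x i a) \<le> real (d * d) \<and> cmod (y i a) \<le> real (d * d)) \<and>
      (\<Sum>r<d * d. (cmod (tensor_sum k d x y r))\<^sup>2) = 1"
    by (simp add: low_rank_states_def)
  then obtain x y where
    f: "\<And>n. f n = herm_coords (\<lambda>r s. tensor_sum k d (x n) (y n) r * cnj (tensor_sum k d (x n) (y n) s))"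
    and x_le: "\<And>n i a. i < k \<Longrightarrow> a < d \<Longrightarrow> cmod (x n i a) \<le> real (d * d)"
    and y_le: "\<And>n i a. i < k \<Longrightarrow> a < d \<Longrightarrow> cmod (y n i a) \<le> real (d * d)"
    and nrm: "\<And>n. (\<Sum>r<d * d. (cmod (tensor_sum k d (x n) (y n) r))\<^sup>2) = 1"
    by metis
  have fin: "finite ({..<k} \<times> {..<d})" by simp
  obtain r1 g where r1: "strict_mono r1"
    and "\<forall>p\<in>{..<k} \<times> {..<d}. (\<lambda>n. x (r1 n) (fst p) (snd p)) \<longlonglongrightarrow> g p"
    using bounded_family_subseq[OF fin, of "\<lambda>n p. x n (fst p) (snd p)" "real (d * d)"] x_le by auto
  then have gx: "(\<lambda>n. x (r1 n) i a) \<longlonglongrightarrow> g (i, a)" if "i < k" "a < d" for i a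
    using that by auto
  obtain r2 h where r2: "strict_mono r2"
    and "\<forall>p\<in>{..<k} \<times> {..<d}. (\<lambda>n. y (r1 (r2 n)) (fst p) (snd p)) \<longlonglongrightarrow> h p"
    using bounded_family_subseq[OF fin, of "\<lambda>n p. y (r1 n) (fst p) (snd p)" "real (d * d)"] y_le by auto
  then have hy: "(\<lambda>n. y (r1 (r2 n)) i a) \<longlonglongrightarrow> h (i, a)" if "i < k" "a < d" for i a
    using that by auto
  have gx': "(\<lambda>n. x (r1 (r2 n)) i a) \<longlonglongrightarrow> g (i, a)" if "i < k" "a < d" for i a
    using LIMSEQ_subseq_LIMSEQ[OF gx[OF that] r2] by (simp add: o_def)
  define X where "X i a = g (i, a)" for i a
  define Y where "Y i a = h (i, a)" for i a
  have lim: "(\<lambda>n. tensor_sum k d (x (r1 (r2 n))) (y (r1 (r2 n))) r) \<longlonglongrightarrow> tensor_sum k d X Y r"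
    if "r < d * d" for r
  proof -
    have "0 < d" using that by (cases d) auto
    then have "r div d < d" "r mod d < d" using that by (simp_all add: less_mult_imp_div_less)
    then show ?thesis unfolding tensor_sum_def X_def Y_def
      by (intro tendsto_sum tendsto_mult gx' hy) auto
  qed
  have "(\<lambda>n. \<Sum>r<d * d. (cmod (tensor_sum k d (x (r1 (r2 n))) (y (r1 (r2 n))) r))\<^sup>2)
      \<longlonglongrightarrow> (\<Sum>r<d * d. (cmod (tensor_sum k d X Y r))\<^sup>2)"
    by (intro tendsto_sum tendsto_power tendsto_norm lim) simp
  then have "(\<Sum>r<d * d. (cmod (tensor_sum k d X Y r))\<^sup>2) = 1"
    by (simp add: nrm LIMSEQ_const_iff)
  moreover have "cmod (X i a) \<le> real (d * d)" "cmod (Y i a) \<le> real (d * d)" if "i < k" "a < d" for i a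
    unfolding X_def Y_def
    using LIMSEQ_le_const2[OF tendsto_norm[OF gx'[OF that]]]
      LIMSEQ_le_const2[OF tendsto_norm[OF hy[OF that]]] x_le[OF that] y_le[OF that]
    by blast+
  ultimately have "herm_coords (\<lambda>r s. tensor_sum k d X Y r * cnj (tensor_sum k d X Y s)) \<in> low_rank_states k d"
    unfolding low_rank_states_def by blast
  moreover have "(\<lambda>n. f ((r1 \<circ> r2) n) i) \<longlonglongrightarrow>
      herm_coords (\<lambda>r s. tensor_sum k d X Y r * cnj (tensor_sum k d X Y s)) i"
    if "i \<in> {..<d * d} \<times> {..<d * d}" for i
    using that unfolding f herm_coords_def o_def
    by (auto intro!: tendsto_intros lim)
  ultimately show "\<exists>(r :: nat \<Rightarrow> nat) g. strict_mono r \<and> g \<in> low_rank_states k d \<and>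
      (\<forall>i\<in>{..<d * d} \<times> {..<d * d}. (\<lambda>n. f (r n) i) \<longlonglongrightarrow> g i)"
    using strict_mono_o[OF r1 r2] by blast
qed

lemma low_rank_states_nonempty:
  assumes "1 \<le> d" "1 \<le> k"
  shows "low_rank_states k d \<noteq> {}"
proof -
  define x :: "nat \<Rightarrow> nat \<Rightarrow> complex" where "x i a = (if i = 0 \<and> a = 0 then 1 else 0)" for i a
  have ts: "tensor_sum k d x x r = (if r = 0 then 1 else 0)" if "r < d * d" for r
  proof -
    have "tensor_sum k d x x r = (\<Sum>i<k. if i = 0 then if r div d = 0 \<and> r mod d = 0 then 1 else 0 else 0)"
      unfolding tensor_sum_def by (intro sum.cong) (auto simp: x_def)
    also have "\<dots> = (if r div d = 0 \<and> r mod d = 0 then 1 else 0)" using assms by simp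
    also have "r div d = 0 \<and> r mod d = 0 \<longleftrightarrow> r = 0"
      by (metis add.right_neutral div_0 div_mult_mod_eq mod_0 mult_zero_left)
    finally show ?thesis .
  qed
  have "(\<Sum>r<d * d. (cmod (tensor_sum k d x x r))\<^sup>2) = (\<Sum>r<d * d. if r = 0 then 1 else 0)"
    by (intro sum.cong refl) (simp add: ts)
  also have "\<dots> = 1" using assms by simp
  finally have "(\<Sum>r<d * d. (cmod (tensor_sum k d x x r))\<^sup>2) = 1" .
  moreover have "cmod (x i a) \<le> real (d * d)" for i a
    using assms mult_le_mono[of 1 d 1 d] by (auto simp: x_def simp flip: of_nat_mult)
  ultimately show ?thesis unfolding low_rank_states_def by blast
qed

lemma orthonormal_on_le_1:
  assumes u: "orthonormal_on n q u" and "i < q" "a < n"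
  shows "cmod (u i a) \<le> 1"
proof -
  have "complex_of_real (\<Sum>a<n. (cmod (u i a))\<^sup>2) = 1"
    using assms by (simp only: sum_cnj_mult_real[symmetric]) (simp add: orthonormal_on_def)
  then have "(\<Sum>a<n. (cmod (u i a))\<^sup>2) = 1" by (metis of_real_eq_1_iff)
  moreover have "(cmod (u i a))\<^sup>2 \<le> (\<Sum>a<n. (cmod (u i a))\<^sup>2)"
    using assms by (intro member_le_sum) auto
  ultimately have "(cmod (u i a))\<^sup>2 \<le> 1\<^sup>2" by simp
  then show ?thesis by (rule power2_le_imp_le) simp
qed

text \<open>The factors of a unit vector of rank at most \<open>k\<close> can be bounded by means of its singular value
  decomposition.\<close>

lemma low_rank_state_mem:
  assumes rk: "tensor_rank_le k d d (\<lambda>a b. \<psi> (a * d + b))" and nrm: "(\<Sum>r<d * d. (cmod (\<psi> r))\<^sup>2) = 1"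
  shows "\<exists>\<kappa>\<in>low_rank_states k d. \<forall>r<d * d. \<forall>s<d * d. \<kappa> (r, s) = herm_coords (\<lambda>r s. \<psi> r * cnj (\<psi> s)) (r, s)"
proof -
  obtain q s u v where q: "q \<le> k" and s: "\<And>i. i < q \<Longrightarrow> 0 < s i"
    and U: "orthonormal_on d q u" and V: "orthonormal_on d q v"
    and dec: "\<And>a b. a < d \<Longrightarrow> b < d \<Longrightarrow> \<psi> (a * d + b) = (\<Sum>i<q. complex_of_real (s i) * u i a * v i b)"
    using svd[OF rk] by blast
  have \<psi>1: "cmod (\<psi> r) \<le> 1" if "r < d * d" for r
  proof -
    have "(cmod (\<psi> r))\<^sup>2 \<le> (\<Sum>r<d * d. (cmod (\<psi> r))\<^sup>2)" using that by (intro member_le_sum) auto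
    then have "(cmod (\<psi> r))\<^sup>2 \<le> 1\<^sup>2" using nrm by simp
    then show ?thesis by (rule power2_le_imp_le) simp
  qed
  \<comment> \<open>Pairing row a of \<psi> with v i recovers this factor as a sum of d terms of
    modulus at most 1.\<close>
  have su: "cmod (complex_of_real (s i) * u i a) \<le> real (d * d)" if i: "i < q" and a: "a < d" for i a
  proof -
    have "(\<Sum>b<d. \<psi> (a * d + b) * cnj (v i b)) =
        (\<Sum>b<d. (\<Sum>l<q. complex_of_real (s l) * u l a * v l b) * cnj (v i b))"
      by (intro sum.cong refl) (simp add: dec a)
    also have "\<dots> = (\<Sum>l<q. complex_of_real (s l) * u l a * (\<Sum>b<d. v l b * cnj (v i b)))"
      by (simp add: sum_distrib_left sum_distrib_right mult.assoc) (rule sum.swap)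
    also have "\<dots> = (\<Sum>l<q. if l = i then complex_of_real (s l) * u l a else 0)"
      using V i by (intro sum.cong) (auto simp: orthonormal_on_def)
    also have "\<dots> = complex_of_real (s i) * u i a" using i by simp
    finally have "cmod (complex_of_real (s i) * u i a) \<le> (\<Sum>b<d. cmod (\<psi> (a * d + b) * cnj (v i b)))"
      by (metis norm_sum)
    also have "\<dots> \<le> (\<Sum>b<d. 1)"
      using \<psi>1 orthonormal_on_le_1[OF V i] a
      by (intro sum_mono) (auto simp: norm_mult tensor_index_less intro!: mult_le_one)
    also have "\<dots> \<le> real (d * d)" using a by (simp flip: of_nat_mult)
    finally show ?thesis .
  qed
  define x where "x i a = (if i < q then complex_of_real (s i) * u i a else 0)" for i a
  define y where "y i a = (if i < q then v i a else 0)" for i a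
  have ts: "tensor_sum k d x y r = \<psi> r" if r: "r < d * d" for r
  proof -
    obtain a b where ab: "r = a * d + b" "a < d" "b < d" using tensor_index_cases[OF r] .
    have "tensor_sum k d x y r = (\<Sum>i<q. x i a * y i b)"
      unfolding tensor_sum_def ab(1) tensor_index_div_mod[OF ab(3)]
      using q by (intro sum.mono_neutral_right) (auto simp: x_def)
    also have "\<dots> = \<psi> r" using ab by (simp add: x_def y_def dec)
    finally show ?thesis .
  qed
  have "cmod (x i a) \<le> real (d * d) \<and> cmod (y i a) \<le> real (d * d)" if a: "a < d" for i a
  proof -
    have "1 \<le> d * d" using a mult_le_mono[of 1 d 1 d] by simp
    then have "1 \<le> real (d * d)" by (metis of_nat_1 of_nat_le_iff)
    moreover have "cmod (v i a) \<le> 1" if "i < q" by (rule orthonormal_on_le_1[OF V that a])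
    ultimately show ?thesis using su[OF _ a, of i] unfolding x_def y_def by fastforce
  qed
  moreover have "(\<Sum>r<d * d. (cmod (tensor_sum k d x y r))\<^sup>2) = 1" using nrm by (simp add: ts)
  ultimately have "herm_coords (\<lambda>r s. tensor_sum k d x y r * cnj (tensor_sum k d x y s)) \<in> low_rank_states k d"
    unfolding low_rank_states_def by blast
  then show ?thesis by (rule bexI[rotated]) (simp add: herm_coords_def ts)
qed

lemma tensor_sum_rank: "tensor_rank_le k d d (\<lambda>a b. tensor_sum k d x y (a * d + b))"
  unfolding tensor_rank_le_def tensor_sum_def
  by (intro exI[of _ x] exI[of _ y]) (simp add: tensor_index_div_mod)

lemma non_SNBC_witness:
  assumes d: "1 \<le> d" and k: "1 \<le> k" and N: "quantum_channel d N" "N \<notin> SNBC k d"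
  shows "\<exists>W. Re (\<Sum>r<d * d. \<Sum>s<d * d. W r s * id_tensor d d N (max_entangled d) $$ (r, s)) < 0 \<and>
    (\<forall>\<eta>. tensor_rank_le k d d (\<lambda>a b. \<eta> (a * d + b)) \<longrightarrow>
      0 \<le> Re (\<Sum>r<d * d. \<Sum>s<d * d. W r s * (\<eta> r * cnj (\<eta> s))))"
proof -
  let ?I = "{..<d * d} \<times> {..<d * d}"
  define J where "J r s = id_tensor d d N (max_entangled d) $$ (r, s)" for r s
  have lin: "linear_on_mats d N" using N by (simp add: quantum_channel_def)
  have dens: "id_tensor d d N (max_entangled d) \<in> density_ops (d * d)"
    by (rule id_tensor_density[OF N(1) d max_entangled_density[OF d]])
  then have Jh: "J s r = cnj (J r s)" if "r < d * d" "s < d * d" for r s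
    unfolding J_def using that by (intro psd_hermitian) (auto simp: density_ops_def)
  \<comment> \<open>Membership in the hull would determine the Hermitian matrix J itself and present
    it as a Gram sum of low-rank vectors. Rescaled, these are Choi vectors of N, which
    \<open>SNBC_I\<close> excludes.\<close>
  have "\<not> convex_comb L ?I (low_rank_states k d) (herm_coords J)" for L
  proof
    assume "convex_comb L ?I (low_rank_states k d) (herm_coords J)"
    then obtain c \<kappa> where c: "\<And>l. l < L \<Longrightarrow> 0 \<le> c l" and \<kappa>: "\<And>l. l < L \<Longrightarrow> \<kappa> l \<in> low_rank_states k d"
      and Jc: "\<And>p. p \<in> ?I \<Longrightarrow> herm_coords J p = (\<Sum>l<L. c l * \<kappa> l p)"
      unfolding convex_comb_def by blast
    from \<kappa> have "\<forall>l. \<exists>x y. l < L \<longrightarrow> \<kappa> l = herm_coords (\<lambda>r s. tensor_sum k d x y r * cnj (tensor_sum k d x y s))"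
      unfolding low_rank_states_def by blast
    from choice[OF this] obtain x where "\<forall>l. \<exists>y. l < L \<longrightarrow>
        \<kappa> l = herm_coords (\<lambda>r s. tensor_sum k d (x l) y r * cnj (tensor_sum k d (x l) y s))" ..
    from choice[OF this] obtain y where xy: "\<forall>l. l < L \<longrightarrow>
        \<kappa> l = herm_coords (\<lambda>r s. tensor_sum k d (x l) (y l) r * cnj (tensor_sum k d (x l) (y l) s))" ..
    define T where "T l = tensor_sum k d (x l) (y l)" for l
    define Q where "Q r s = (\<Sum>l<L. complex_of_real (c l) * (T l r * cnj (T l s)))" for r s
    have Qc: "herm_coords J p = herm_coords Q p" if "p \<in> ?I" for p
    proof -
      have "herm_coords J p = (\<Sum>l<L. c l * herm_coords (\<lambda>r s. T l r * cnj (T l s)) p)"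
        unfolding Jc[OF that] T_def by (intro sum.cong refl) (simp add: xy)
      also have "\<dots> = herm_coords Q p"
        by (cases p) (simp add: herm_coords_def Q_def sum.distrib distrib_left)
      finally show ?thesis .
    qed
    have JQ: "J r s = Q r s" if "r < d * d" "s < d * d" for r s
    proof (rule herm_coords_inject)
      show "herm_coords J (r, s) = herm_coords Q (r, s)" "herm_coords J (s, r) = herm_coords Q (s, r)"
        by (rule Qc; use that in simp)+
      show "J s r = cnj (J r s)" by (rule Jh[OF that])
      show "Q s r = cnj (Q r s)" by (simp add: Q_def mult_ac)
    qed
    define t where "t l = complex_of_real (sqrt (real d * c l))" for l
    have t: "t l * cnj (t l) = of_nat d * complex_of_real (c l)" if "l < L" for l
    proof -
      have "sqrt (real d * c l) * sqrt (real d * c l) = real d * c l" using c[OF that] by simp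
      then have "complex_of_real (sqrt (real d * c l) * sqrt (real d * c l)) =
          of_nat d * complex_of_real (c l)"
        by (simp only: of_real_mult of_real_of_nat_eq)
      then show ?thesis by (simp only: t_def of_real_mult complex_cnj_complex_of_real)
    qed
    have "N \<in> SNBC k d"
    proof (rule SNBC_I[OF N(1), where L = L and \<chi> = "\<lambda>l r. t l * T l r"])
      fix i j a b assume *: "i < d" "j < d" "a < d" "b < d"
      have "N (unit_mat d i j) $$ (a, b) = of_nat d * J (i * d + a) (j * d + b)"
        unfolding J_def choi_index[OF lin *(1,3,2,4)] using d by simp
      also have "\<dots> = of_nat d * Q (i * d + a) (j * d + b)"
        by (subst JQ) (simp_all add: tensor_index_less *)
      also have "\<dots> = (\<Sum>l<L. (t l * cnj (t l)) * (T l (i * d + a) * cnj (T l (j * d + b))))"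
        unfolding Q_def sum_distrib_left by (intro sum.cong refl) (simp add: t)
      finally show "N (unit_mat d i j) $$ (a, b) =
          (\<Sum>l<L. t l * T l (i * d + a) * cnj (t l * T l (j * d + b)))"
        by (simp add: mult_ac)
    next
      fix l show "tensor_rank_le k d d (\<lambda>a b. t l * T l (a * d + b))"
        unfolding T_def by (intro tensor_rank_le_scale tensor_sum_rank)
    qed
    then show False using N by simp
  qed
  from separate_from_convex_hull[OF _ low_rank_states_seq_compact low_rank_states_nonempty[OF d k] this]
  obtain w c where wJ: "(\<Sum>p\<in>?I. w p * herm_coords J p) < c"
    and wK: "\<And>\<kappa>. \<kappa> \<in> low_rank_states k d \<Longrightarrow> c \<le> (\<Sum>p\<in>?I. w p * \<kappa> p)"
    by auto
  \<comment> \<open>Since Re ((1 - \<i>) z) = Re z + Im z, the factor 1 - \<i> turns the real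
    functional w on Hermitian coordinates into the real part of a complex pairing. Subtracting c on
    the diagonal lowers the value at trace one by c, so the threshold becomes 0.\<close>
  define W where "W r s = complex_of_real (w (r, s) - (if r = s then c else 0)) * (1 - \<i>)" for r s
  have W: "Re (\<Sum>r<d * d. \<Sum>s<d * d. W r s * P r s) = (\<Sum>p\<in>?I. w p * herm_coords P p) - c * t"
    if P: "(\<Sum>r<d * d. P r r) = complex_of_real t" for P t
  proof -
    have "Re (\<Sum>r<d * d. \<Sum>s<d * d. W r s * P r s) =
        (\<Sum>r<d * d. \<Sum>s<d * d. (w (r, s) - (if r = s then c else 0)) * herm_coords P (r, s))"
      unfolding Re_sum by (intro sum.cong refl) (simp add: W_def herm_coords_def algebra_simps)
    also have "\<dots> = (\<Sum>r<d * d. \<Sum>s<d * d. w (r, s) * herm_coords P (r, s)) -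
        (\<Sum>r<d * d. \<Sum>s<d * d. if r = s then c * herm_coords P (r, s) else 0)"
      unfolding sum_subtractf[symmetric] by (intro sum.cong refl) (simp add: algebra_simps)
    also have "(\<Sum>r<d * d. \<Sum>s<d * d. if r = s then c * herm_coords P (r, s) else 0) =
        c * (Re (\<Sum>r<d * d. P r r) + Im (\<Sum>r<d * d. P r r))"
      by (simp add: herm_coords_def sum.distrib sum_distrib_left distrib_left)
    finally show ?thesis by (simp add: P sum.cartesian_product case_prod_unfold)
  qed
  have "(\<Sum>r<d * d. J r r) = complex_of_real 1"
    using dens by (simp add: density_ops_def mat_trace_def J_def id_tensor_def)
  from W[of J 1, OF this] wJ have "Re (\<Sum>r<d * d. \<Sum>s<d * d. W r s * J r s) < 0" by simp
  moreover have "0 \<le> Re (\<Sum>r<d * d. \<Sum>s<d * d. W r s * (\<eta> r * cnj (\<eta> s)))"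
    if rk: "tensor_rank_le k d d (\<lambda>a b. \<eta> (a * d + b))" for \<eta>
  proof -
    \<comment> \<open>Separation speaks of unit vectors; the inequality is homogeneous in \<eta> and
      extends by scaling.\<close>
    define n where "n = (\<Sum>r<d * d. (cmod (\<eta> r))\<^sup>2)"
    have n0: "0 \<le> n" by (auto simp: n_def intro: sum_nonneg)
    show ?thesis
    proof (cases "n = 0")
      case True
      then have "\<eta> r = 0" if "r < d * d" for r
        using that unfolding n_def by (subst (asm) sum_nonneg_eq_0_iff) auto
      then show ?thesis by simp
    next
      case False
      then have n: "0 < n" using n0 by simp
      define z where "z = complex_of_real (1 / sqrt n)"
      define \<psi> where "\<psi> r = z * \<eta> r" for r
      have zz: "z * cnj z = complex_of_real (1 / n)"
      proof -
        have "1 / sqrt n * (1 / sqrt n) = 1 / n" using n by simp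
        then show ?thesis unfolding z_def by (metis complex_cnj_complex_of_real of_real_mult)
      qed
      have "tensor_rank_le k d d (\<lambda>a b. \<psi> (a * d + b))"
        unfolding \<psi>_def by (rule tensor_rank_le_scale[OF rk])
      moreover have n\<psi>: "(\<Sum>r<d * d. (cmod (\<psi> r))\<^sup>2) = 1"
      proof -
        have "(\<Sum>r<d * d. (cmod (\<psi> r))\<^sup>2) = (\<Sum>r<d * d. (1 / n) * (cmod (\<eta> r))\<^sup>2)"
          using n by (intro sum.cong refl) (simp add: \<psi>_def z_def norm_mult norm_divide power_mult_distrib power_divide)
        also have "\<dots> = (1 / n) * n" by (simp only: sum_distrib_left[symmetric] n_def[symmetric])
        finally show ?thesis using n by simp
      qed
      ultimately obtain \<kappa> where \<kappa>: "\<kappa> \<in> low_rank_states k d"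
        "\<And>r s. r < d * d \<Longrightarrow> s < d * d \<Longrightarrow> \<kappa> (r, s) = herm_coords (\<lambda>r s. \<psi> r * cnj (\<psi> s)) (r, s)"
        using low_rank_state_mem by blast
      have tr: "(\<Sum>r<d * d. \<psi> r * cnj (\<psi> r)) = complex_of_real 1"
        by (simp only: sum_cnj_mult_real n\<psi>)
      have "(\<Sum>p\<in>?I. w p * \<kappa> p) = (\<Sum>p\<in>?I. w p * herm_coords (\<lambda>r s. \<psi> r * cnj (\<psi> s)) p)"
        by (intro sum.cong refl) (auto simp: \<kappa>(2))
      then have "0 \<le> Re (\<Sum>r<d * d. \<Sum>s<d * d. W r s * (\<psi> r * cnj (\<psi> s)))"
        using W[of "\<lambda>r s. \<psi> r * cnj (\<psi> s)" 1, OF tr] wK[OF \<kappa>(1)] by simp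
      also have "(\<Sum>r<d * d. \<Sum>s<d * d. W r s * (\<psi> r * cnj (\<psi> s))) =
          complex_of_real (1 / n) * (\<Sum>r<d * d. \<Sum>s<d * d. W r s * (\<eta> r * cnj (\<eta> s)))"
        unfolding sum_distrib_left zz[symmetric] by (intro sum.cong refl) (simp add: \<psi>_def mult_ac)
      finally have "0 \<le> (1 / n) * Re (\<Sum>r<d * d. \<Sum>s<d * d. W r s * (\<eta> r * cnj (\<eta> s)))"
        by (simp only: Re_complex_of_real times_complex.sel Im_complex_of_real mult_zero_left diff_zero)
      then show ?thesis using n by (simp add: zero_le_mult_iff zero_le_divide_iff)
    qed
  qed
  ultimately show ?thesis unfolding J_def by blast
qed

subsection \<open>The game\<close>

definition pol_vec :: "nat \<Rightarrow> nat \<Rightarrow> nat \<Rightarrow> nat \<Rightarrow> complex" where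
  "pol_vec i j t a = (if i = j then if a = i then 1 else 0
     else ((if a = i then 1 else 0) + \<i> ^ t * (if a = j then 1 else 0)) / complex_of_real (sqrt 2))"

definition pol_state :: "nat \<Rightarrow> nat \<Rightarrow> nat \<Rightarrow> nat \<Rightarrow> complex mat" where
  "pol_state d i j t = mat d d (\<lambda>(a, b). pol_vec i j t a * cnj (pol_vec i j t b))"

text \<open>For i \<noteq> j the sum over the fourth roots of unity cancels the diagonal terms and
  the (j, i) term of the projectors. The (j, i) conjugate partner, the (i, j) term, gets 1 / 2 from
  each of four normalized projectors, so the coefficients need modulus 1 / 2.\<close>

definition pol_coeff :: "nat \<Rightarrow> nat \<Rightarrow> nat \<Rightarrow> complex" where
  "pol_coeff i j t = (if i = j then if t = 0 then 1 else 0 else \<i> ^ t / 2)"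

lemma cnj_i_power: "\<i> ^ t * cnj (\<i> ^ t) = 1"
  by (simp flip: power_mult_distrib)

lemma polarization:
  "(\<Sum>t<4. pol_coeff i j t * (pol_vec i j t a * cnj (pol_vec i j t b))) = (if a = i \<and> b = j then 1 else 0)"
proof -
  have s2: "complex_of_real (sqrt 2) * complex_of_real (sqrt 2) = 2" by (simp flip: of_real_mult)
  have four: "{..<4} = {0, 1, 2, 3 :: nat}" by auto
  have i3: "\<i> ^ 3 = - \<i>" by (simp add: eval_nat_numeral)
  show ?thesis
    by (auto simp: four pol_coeff_def pol_vec_def i3 field_simps s2)
qed

lemma pol_state_density:
  assumes "i < d" "j < d"
  shows "pol_state d i j t \<in> density_ops d"
proof -
  have g: "pol_state d i j t $$ (a, b) = (\<Sum>l<(1::nat). pol_vec i j t a * cnj (pol_vec i j t b))"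
    if "a < d" "b < d" for a b using that by (simp add: pol_state_def)
  have "psd d (pol_state d i j t)"
    by (rule gram_psd[where L = 1, OF _ g]) (simp_all add: pol_state_def)
  moreover have "mat_trace (pol_state d i j t) = 1"
  proof (cases "i = j")
    case True
    then have "mat_trace (pol_state d i j t) = (\<Sum>a<d. if a = i then 1 else 0)"
      unfolding mat_trace_def by (intro sum.cong) (auto simp: pol_state_def pol_vec_def)
    then show ?thesis using assms by simp
  next
    case False
    have s2: "complex_of_real (sqrt 2) * complex_of_real (sqrt 2) = 2" by (simp flip: of_real_mult)
    have "mat_trace (pol_state d i j t) = (\<Sum>a<d. pol_vec i j t a * cnj (pol_vec i j t a))"
      unfolding mat_trace_def by (simp add: pol_state_def)
    also have "\<dots> = (\<Sum>a<d. (if a = i then 1 / 2 else 0) + (if a = j then 1 / 2 else 0))"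
      using False cnj_i_power[of t] by (intro sum.cong refl) (auto simp: pol_vec_def s2)
    also have "\<dots> = 1" using assms by (simp add: sum.distrib)
    finally show ?thesis .
  qed
  ultimately show ?thesis by (simp add: density_ops_def)
qed

lemma channel_polarization:
  assumes E: "linear_on_mats d E" and "i < d" "j < d" "a < d" "b < d"
  shows "(\<Sum>t<4. pol_coeff i j t * E (pol_state d i j t) $$ (a, b)) = E (unit_mat d i j) $$ (a, b)"
proof -
  have "unit_mat d i j = mat_sum d (\<lambda>t. pol_coeff i j t \<cdot>\<^sub>m pol_state d i j t) {..<4}"
    by (rule eq_matI) (auto simp: unit_mat_def mat_sum_def pol_state_def polarization)
  then show ?thesis
    using linear_on_mats_sum[OF E finite_lessThan, of 4 "pol_state d i j" a b "pol_coeff i j"] assms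
    by (simp add: pol_state_def)
qed

lemma state_polarization:
  assumes "i < d" "j < d" "a < d" "b < d"
  shows "(\<Sum>t<4. pol_coeff i j t * pol_state d i j t $$ (a, b)) = (if a = i \<and> b = j then 1 else 0)"
  using polarization[of i j a b] assms by (simp add: pol_state_def)

lemma channel_density:
  assumes E: "quantum_channel d E" and A: "A \<in> density_ops d"
  shows "E A \<in> density_ops d"
proof -
  have Ac: "A \<in> carrier_mat d d" using A by (simp add: density_ops_def psd_def)
  have EA: "E A \<in> carrier_mat d d" using E Ac by (simp add: quantum_channel_def linear_on_mats_def)
  have "block d A 0 0 = A" by (rule eq_matI) (use Ac in \<open>auto simp: block_def\<close>)
  then have "id_tensor 1 d E A = E A"
    by (intro eq_matI) (use EA in \<open>auto simp: id_tensor_def\<close>)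
  then show ?thesis using id_tensor_density[OF E order_refl, of A] A by simp
qed

section \<open>Traces against product states, and the average payoff\<close>

definition tensor_trace :: "nat \<Rightarrow> complex mat \<Rightarrow> complex mat \<Rightarrow> complex mat \<Rightarrow> complex" where
  "tensor_trace d A B M =
     (\<Sum>p<d. \<Sum>q<d. \<Sum>r<d. \<Sum>s<d. A $$ (p, q) * B $$ (r, s) * M $$ (q * d + s, p * d + r))"

lemma mat_trace_mult:
  assumes "A \<in> carrier_mat n n" "B \<in> carrier_mat n n"
  shows "mat_trace (A * B) = (\<Sum>a<n. \<Sum>b<n. A $$ (a, b) * B $$ (b, a))"
  using assms by (simp add: mat_trace_def scalar_prod_def lessThan_atLeast0)

lemma mat_trace_tensor_mult:
  assumes A: "A \<in> carrier_mat d d" and B: "B \<in> carrier_mat d d" and M: "M \<in> carrier_mat (d * d) (d * d)"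
  shows "mat_trace ((A \<otimes>\<^sub>m B) * M) = tensor_trace d A B M"
proof -
  have AB: "A \<otimes>\<^sub>m B \<in> carrier_mat (d * d) (d * d)" using A B by (simp add: mat_tensor_def)
  have ABi: "(A \<otimes>\<^sub>m B) $$ (p * d + r, q * d + s) = A $$ (p, q) * B $$ (r, s)"
    if "p < d" "q < d" "r < d" "s < d" for p q r s
    using that A B by (simp add: mat_tensor_def tensor_index_less)
  have "mat_trace ((A \<otimes>\<^sub>m B) * M) =
      (\<Sum>p<d. \<Sum>r<d. \<Sum>q<d. \<Sum>s<d. A $$ (p, q) * B $$ (r, s) * M $$ (q * d + s, p * d + r))"
    unfolding mat_trace_mult[OF AB M] sum_tensor_index by (intro sum.cong refl) (simp add: ABi)
  also have "\<dots> = tensor_trace d A B M"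
    unfolding tensor_trace_def by (rule sum.cong[OF refl], rule sum.swap)
  finally show ?thesis .
qed

text \<open>Conjugation exchanges row and column of the three Hermitian factors, which amounts to
  swapping (p, r) with (q, s) in the sum.\<close>

lemma tensor_trace_real:
  assumes A: "psd d A" and B: "psd d B" and M: "psd (d * d) M"
  shows "complex_of_real (Re (tensor_trace d A B M)) = tensor_trace d A B M"
proof -
  have "cnj (tensor_trace d A B M) =
      (\<Sum>p<d. \<Sum>q<d. \<Sum>r<d. \<Sum>s<d. A $$ (q, p) * B $$ (s, r) * M $$ (p * d + r, q * d + s))"
    unfolding tensor_trace_def cnj_sum
  proof (intro sum.cong refl)
    fix p q r s assume "p \<in> {..<d}" "q \<in> {..<d}" "r \<in> {..<d}" "s \<in> {..<d}"
    then show "cnj (A $$ (p, q) * B $$ (r, s) * M $$ (q * d + s, p * d + r)) =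
        A $$ (q, p) * B $$ (s, r) * M $$ (p * d + r, q * d + s)"
      using psd_hermitian[OF A, of p q] psd_hermitian[OF B, of r s]
        psd_hermitian[OF M, of "q * d + s" "p * d + r"]
      by (simp add: tensor_index_less)
  qed
  also have "\<dots> = (\<Sum>q<d. \<Sum>p<d. \<Sum>s<d. \<Sum>r<d. A $$ (q, p) * B $$ (s, r) * M $$ (p * d + r, q * d + s))"
    by (subst sum.swap, rule sum.cong[OF refl], rule sum.cong[OF refl], rule sum.swap)
  finally have "cnj (tensor_trace d A B M) = tensor_trace d A B M" by (simp only: tensor_trace_def)
  then show ?thesis by (simp add: complex_eq_iff)
qed

text \<open>This is \<open>Tr ((E E\<^sub>i\<^sub>j \<otimes> E\<^sub>a\<^sub>b) M)\<close> for the matrix units \<open>E\<^sub>i\<^sub>j\<close>.\<close>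

definition partial_pairing :: "nat \<Rightarrow> (complex mat \<Rightarrow> complex mat) \<Rightarrow> complex mat \<Rightarrow> nat \<Rightarrow> nat \<Rightarrow> nat \<Rightarrow> nat \<Rightarrow> complex" where
  "partial_pairing d E M i j a b =
     (\<Sum>p<d. \<Sum>q<d. E (unit_mat d i j) $$ (p, q) * M $$ (q * d + b, p * d + a))"

text \<open>By bilinearity, polarization in both slots replaces the states by matrix units; the unit
  in the second slot selects r = a and s = b.\<close>

lemma tensor_trace_polarization:
  assumes E: "linear_on_mats d E" and ij: "i < d" "j < d" "a < d" "b < d"
  shows "(\<Sum>t<4. \<Sum>u<4. pol_coeff i j t * pol_coeff a b u *
      tensor_trace d (E (pol_state d i j t)) (pol_state d a b u) M) = partial_pairing d E M i j a b"
proof -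
  have "(\<Sum>t<4. \<Sum>u<4. pol_coeff i j t * pol_coeff a b u *
        tensor_trace d (E (pol_state d i j t)) (pol_state d a b u) M) =
      (\<Sum>t<4. \<Sum>u<4. \<Sum>p<d. \<Sum>q<d. \<Sum>r<d. \<Sum>s<d.
        (pol_coeff i j t * E (pol_state d i j t) $$ (p, q)) *
        (pol_coeff a b u * pol_state d a b u $$ (r, s)) * M $$ (q * d + s, p * d + r))"
    unfolding tensor_trace_def sum_distrib_left by (intro sum.cong refl) (simp add: mult_ac)
  also have "\<dots> = (\<Sum>p<d. \<Sum>q<d. \<Sum>r<d. \<Sum>s<d. \<Sum>t<4. \<Sum>u<4.
        (pol_coeff i j t * E (pol_state d i j t) $$ (p, q)) *
        (pol_coeff a b u * pol_state d a b u $$ (r, s)) * M $$ (q * d + s, p * d + r))"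
    by (simp only: sum.cartesian_product case_prod_unfold, rule sum.reindex_bij_witness[of _
      "\<lambda>(p, q, r, s, t, u). (t, u, p, q, r, s)" "\<lambda>(t, u, p, q, r, s). (p, q, r, s, t, u)"]) auto
  also have "\<dots> = (\<Sum>p<d. \<Sum>q<d. \<Sum>r<d. \<Sum>s<d.
        (\<Sum>t<4. pol_coeff i j t * E (pol_state d i j t) $$ (p, q)) *
        (\<Sum>u<4. pol_coeff a b u * pol_state d a b u $$ (r, s)) * M $$ (q * d + s, p * d + r))"
    by (simp only: sum_product) (simp only: sum_distrib_right)
  also have "\<dots> = (\<Sum>p<d. \<Sum>q<d. \<Sum>r<d. \<Sum>s<d. if s = b then if r = a then
        E (unit_mat d i j) $$ (p, q) * M $$ (q * d + s, p * d + r) else 0 else 0)"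
    using ij by (intro sum.cong refl) (auto simp: channel_polarization[OF E] state_polarization)
  also have "\<dots> = partial_pairing d E M i j a b"
    unfolding partial_pairing_def using ij by (intro sum.cong refl) simp
  finally show ?thesis .
qed

text \<open>A label encodes a triple \<open>(i, j, t)\<close> as \<open>(i * d + j) * 4 + t\<close>; its state is the normalization of
  \<open>e\<^sub>i + \<i> ^ t e\<^sub>j\<close> if \<open>i \<noteq> j\<close>, and \<open>e\<^sub>i\<close> if \<open>i = j\<close>. By polarization these states span all matrices, and the payoffs are the
  coefficients of \<open>W\<close> with respect to them. Only real parts are needed, since the traces they multiply are
  real.\<close>

definition witness_game :: "nat \<Rightarrow> (nat \<Rightarrow> nat \<Rightarrow> complex) \<Rightarrow> sq_game" where
  "witness_game d W = (let
      I = (\<lambda>x. x div 4 div d); J = (\<lambda>x. x div 4 mod d); T = (\<lambda>x. x mod 4)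
    in \<lparr>dimB = d, nX = d * d * 4, nY = d * d * 4, nOut = 2,
      stA = (\<lambda>x. pol_state d (I x) (J x) (T x)), stB = (\<lambda>y. pol_state d (I y) (J y) (T y)),
      prA = (\<lambda>_. 1 / real (d * d * 4)), prB = (\<lambda>_. 1 / real (d * d * 4)),
      payoff = (\<lambda>b x y. if b = 0 then Re (W (I x * d + I y) (J x * d + J y) *
        pol_coeff (I x) (J x) (T x) * pol_coeff (I y) (J y) (T y)) else 0)\<rparr>)"

lemma witness_game_valid:
  assumes d: "2 \<le> d"
  shows "semiquantum_game d (witness_game d W)"
proof -
  have st: "pol_state d (x div 4 div d) (x div 4 mod d) (x mod 4) \<in> density_ops d"
    if "x < d * d * 4" for x
    using that d by (intro pol_state_density) (auto simp: less_mult_imp_div_less)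
  have pr: "prob_vector (d * d * 4) (\<lambda>_. 1 / real (d * d * 4))"
    using d by (simp add: prob_vector_def)
  have "not_all_orthogonal (d * d * 4)
      (\<lambda>x. pol_state d (x div 4 div d) (x div 4 mod d) (x mod 4))"
    unfolding not_all_orthogonal_def
  proof (intro exI conjI)
    have s2: "complex_of_real (sqrt 2) * complex_of_real (sqrt 2) = 2" by (simp flip: of_real_mult)
    have dd: "2 * 2 \<le> d * d" using d by (intro mult_le_mono)
    \<comment> \<open>The two labels are fixed here: 0 and 4 encode (0, 0, 0) and (0, 1, 0), that is
      e_0 and the normalization of e_0 + e_1, with overlap 1 / 2. The second one exists because d
      \<ge> 2.\<close>
    then show "0 < d * d * 4" "4 < d * d * 4" using d by auto
    have p00: "pol_state d 0 0 0 $$ (a, b) = (if b = 0 then if a = 0 then 1 else 0 else 0)"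
      if "a < d" "b < d" for a b using that by (simp add: pol_state_def pol_vec_def)
    have p01: "pol_state d 0 1 0 $$ (0, 0) = 1 / 2"
      using d by (simp add: pol_state_def pol_vec_def s2)
    have x: "(4::nat) div 4 div d = 0" "(4::nat) div 4 mod d = 1" using d by auto
    show "pol_state d (0 div 4 div d) (0 div 4 mod d) (0 mod 4) \<noteq>
        pol_state d (4 div 4 div d) (4 div 4 mod d) (4 mod 4)"
      unfolding x using p00[of 0 0] p01 d by auto
    have c: "pol_state d i j t \<in> carrier_mat d d" for i j t by (simp add: pol_state_def)
    have "mat_trace (pol_state d 0 0 0 * pol_state d 0 1 0) =
        (\<Sum>a<d. \<Sum>b<d. if b = 0 then if a = 0 then pol_state d 0 1 0 $$ (b, a) else 0 else 0)"
      unfolding mat_trace_mult[OF c c] by (intro sum.cong refl) (simp add: p00)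
    also have "\<dots> = 1 / 2" using d p01 by simp
    finally have e: "mat_trace (pol_state d 0 0 0 * pol_state d 0 1 0) = 1 / 2" .
    have "mat_trace (pol_state d 0 0 0 * pol_state d 0 1 0) \<noteq> 0" unfolding e by simp
    then show "mat_trace (pol_state d (0 div 4 div d) (0 div 4 mod d) (0 mod 4) *
        pol_state d (4 div 4 div d) (4 div 4 mod d) (4 mod 4)) \<noteq> 0"
      unfolding x by simp
  qed
  then show ?thesis using st pr by (simp add: semiquantum_game_def witness_game_def Let_def)
qed

text \<open>The labels of Alice's states run over the reference leg (i, j) of the Choi matrix, those
  of Bob's states over its output leg (a, b). Outcome 1 pays nothing, so only the effect M 0 occurs;
  the prefactor is the product of the two uniform probabilities.\<close>

lemma witness_game_payoff:
  assumes E: "quantum_channel d E" and M: "povm (d * d) 2 M"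
  shows "avg_payoff (witness_game d W) E M = (1 / real (d * d * 4))\<^sup>2 *
    Re (\<Sum>i<d. \<Sum>a<d. \<Sum>j<d. \<Sum>b<d. W (i * d + a) (j * d + b) * partial_pairing d E (M 0) i j a b)"
proof -
  let ?c = "1 / real (d * d * 4)"
  have lin: "linear_on_mats d E" using E by (simp add: quantum_channel_def)
  have M0: "psd (d * d) (M 0)" using M by (simp add: povm_def)
  have corr: "complex_of_real (Re (mat_trace ((E (pol_state d i j t) \<otimes>\<^sub>m pol_state d a b u) * M 0))) =
      tensor_trace d (E (pol_state d i j t)) (pol_state d a b u) (M 0)"
    if "i < d" "j < d" "a < d" "b < d" for i j t a b u
  proof -
    have "psd d (E (pol_state d i j t))" "psd d (pol_state d a b u)"
      using channel_density[OF E pol_state_density] pol_state_density that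
      by (auto simp: density_ops_def)
    then show ?thesis
      using M0 by (subst mat_trace_tensor_mult) (auto simp: tensor_trace_real psd_def)
  qed
  have "avg_payoff (witness_game d W) E M = (\<Sum>x<d * d * 4. \<Sum>y<d * d * 4.
      payoff (witness_game d W) 0 x y * correlation (witness_game d W) E M 0 x y * ?c * ?c)"
    by (simp add: avg_payoff_def numeral_2_eq_2 witness_game_def Let_def)
  also have "\<dots> = (\<Sum>i<d. \<Sum>j<d. \<Sum>t<4. \<Sum>a<d. \<Sum>b<d. \<Sum>u<4.
      Re (W (i * d + a) (j * d + b) * pol_coeff i j t * pol_coeff a b u) *
      Re (mat_trace ((E (pol_state d i j t) \<otimes>\<^sub>m pol_state d a b u) * M 0)) * ?c * ?c)"
    unfolding sum_tensor_index
    by (intro sum.cong refl) (simp add: witness_game_def Let_def correlation_def tensor_index_div_mod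
        del: times_complex.sel distrib_right_numeral)
  also have "\<dots> = (\<Sum>i<d. \<Sum>j<d. \<Sum>t<4. \<Sum>a<d. \<Sum>b<d. \<Sum>u<4. ?c\<^sup>2 *
      Re (W (i * d + a) (j * d + b) * pol_coeff i j t * pol_coeff a b u *
        tensor_trace d (E (pol_state d i j t)) (pol_state d a b u) (M 0)))"
  proof (intro sum.cong refl)
    fix i j t a b u :: nat
    assume "i \<in> {..<d}" "j \<in> {..<d}" "a \<in> {..<d}" "b \<in> {..<d}"
    then have "tensor_trace d (E (pol_state d i j t)) (pol_state d a b u) (M 0) =
        complex_of_real (Re (mat_trace ((E (pol_state d i j t) \<otimes>\<^sub>m pol_state d a b u) * M 0)))"
      using corr[of i j a b t u] by simp
    then show "Re (W (i * d + a) (j * d + b) * pol_coeff i j t * pol_coeff a b u) *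
        Re (mat_trace ((E (pol_state d i j t) \<otimes>\<^sub>m pol_state d a b u) * M 0)) * ?c * ?c =
      ?c\<^sup>2 * Re (W (i * d + a) (j * d + b) * pol_coeff i j t * pol_coeff a b u *
        tensor_trace d (E (pol_state d i j t)) (pol_state d a b u) (M 0))"
      by (simp only: times_complex.sel Re_complex_of_real Im_complex_of_real power2_eq_square) simp
  qed
  also have "\<dots> = ?c\<^sup>2 * Re (\<Sum>i<d. \<Sum>j<d. \<Sum>t<4. \<Sum>a<d. \<Sum>b<d. \<Sum>u<4.
      W (i * d + a) (j * d + b) * pol_coeff i j t * pol_coeff a b u *
        tensor_trace d (E (pol_state d i j t)) (pol_state d a b u) (M 0))"
    by (simp only: Re_sum sum_distrib_left)
  also have "(\<Sum>i<d. \<Sum>j<d. \<Sum>t<4. \<Sum>a<d. \<Sum>b<d. \<Sum>u<4.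
      W (i * d + a) (j * d + b) * pol_coeff i j t * pol_coeff a b u *
        tensor_trace d (E (pol_state d i j t)) (pol_state d a b u) (M 0)) =
      (\<Sum>i<d. \<Sum>a<d. \<Sum>j<d. \<Sum>b<d. \<Sum>t<4. \<Sum>u<4.
      W (i * d + a) (j * d + b) * pol_coeff i j t * pol_coeff a b u *
        tensor_trace d (E (pol_state d i j t)) (pol_state d a b u) (M 0))"
    by (simp only: sum.cartesian_product case_prod_unfold, rule sum.reindex_bij_witness[of _
      "\<lambda>(i, a, j, b, t, u). (i, j, t, a, b, u)" "\<lambda>(i, j, t, a, b, u). (i, a, j, b, t, u)"]) auto
  also have "\<dots> = (\<Sum>i<d. \<Sum>a<d. \<Sum>j<d. \<Sum>b<d.
      W (i * d + a) (j * d + b) * partial_pairing d E (M 0) i j a b)"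
  proof (intro sum.cong refl)
    fix i a j b assume "i \<in> {..<d}" "a \<in> {..<d}" "j \<in> {..<d}" "b \<in> {..<d}"
    then show "(\<Sum>t<4. \<Sum>u<4. W (i * d + a) (j * d + b) * pol_coeff i j t * pol_coeff a b u *
        tensor_trace d (E (pol_state d i j t)) (pol_state d a b u) (M 0)) =
      W (i * d + a) (j * d + b) * partial_pairing d E (M 0) i j a b"
      by (subst tensor_trace_polarization[OF lin, symmetric]) (simp_all add: sum_distrib_left mult.assoc)
  qed
  finally show ?thesis .
qed

text \<open>Pairing with the maximally entangled projector transposes the unit (a, b), so the trace
  reads off entry (a, b) of the output, divided by d. This is exactly an entry of the Choi matrix,
  without a partial transpose.\<close>

lemma partial_pairing_max_entangled:
  assumes E: "linear_on_mats d E" and "i < d" "j < d" "a < d" "b < d"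
  shows "partial_pairing d E (max_entangled d) i j a b =
    id_tensor d d E (max_entangled d) $$ (i * d + a, j * d + b)"
proof -
  have "partial_pairing d E (max_entangled d) i j a b =
      (\<Sum>p<d. \<Sum>q<d. if q = b then if p = a then E (unit_mat d i j) $$ (p, q) / of_nat d else 0 else 0)"
    unfolding partial_pairing_def using assms
    by (intro sum.cong refl) (auto simp: max_entangled_index)
  also have "\<dots> = E (unit_mat d i j) $$ (a, b) / of_nat d" using assms by simp
  finally show ?thesis using choi_index[OF E] assms by simp
qed

text \<open>The complement of the maximally entangled projector is a projector as well, so it is the Gram
  matrix of its own columns.\<close>

lemma max_entangled_complement_psd: "psd (d * d) (1\<^sub>m (d * d) - max_entangled d)"
proof (rule gram_psd[where L = "d * d"])
  define f where "f r = (if r div d = r mod d then 1 else 0 :: complex)" for r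
  define P where "P r s = (if r = s then 1 else 0) - f r * f s / of_nat d" for r s
  have cf: "cnj (f r) = f r" for r by (simp add: f_def)
  have ff: "(\<Sum>l<d * d. f l * f l) = of_nat d"
  proof -
    have "(\<Sum>l<d * d. f l * f l) = (\<Sum>a<d. \<Sum>b<d. if b = a then 1 else 0)"
      unfolding sum_tensor_index by (intro sum.cong refl) (auto simp: f_def tensor_index_div_mod)
    then show ?thesis by simp
  qed
  fix r s assume rs: "r < d * d" "s < d * d"
  then have "d \<noteq> 0" by (cases d) auto
  then have d: "of_nat d \<noteq> (0 :: complex)" by (simp only: of_nat_eq_0_iff not_False_eq_True)
  have "(\<Sum>l<d * d. P r l * cnj (P s l)) =
      (\<Sum>l<d * d. (if l = r then if r = s then 1 else 0 else 0) - (if l = r then f l * f s / of_nat d else 0) -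
        (if l = s then f r * f l / of_nat d else 0) + f r * f s / (of_nat d * of_nat d) * (f l * f l))"
    by (intro sum.cong refl) (auto simp: P_def cf algebra_simps)
  also have "\<dots> = P r s"
  proof -
    have "(\<Sum>l<d * d. f r * f s / (of_nat d * of_nat d) * (f l * f l)) =
        f r * f s / (of_nat d * of_nat d) * of_nat d"
      by (simp only: sum_distrib_left[symmetric] ff)
    then show ?thesis using rs d by (simp only: sum.distrib sum_subtractf) (simp add: P_def)
  qed
  finally show "(1\<^sub>m (d * d) - max_entangled d) $$ (r, s) = (\<Sum>l<d * d. P r l * cnj (P s l))"
    using rs by (simp add: P_def f_def max_entangled_def)
qed (simp add: max_entangled_def minus_carrier_mat)

lemma max_entangled_povm:
  "povm (d * d) 2 (\<lambda>b. if b = 0 then max_entangled d else 1\<^sub>m (d * d) - max_entangled d)"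
  unfolding povm_def
proof (intro conjI allI impI)
  show "mat_sum (d * d) (\<lambda>b :: nat. if b = 0 then max_entangled d else 1\<^sub>m (d * d) - max_entangled d) {..<2} =
      1\<^sub>m (d * d)"
    by (rule eq_matI) (auto simp: mat_sum_def numeral_2_eq_2 max_entangled_def)
qed (use max_entangled_psd max_entangled_complement_psd in auto)

lemma SNBC_payoff_nonneg:
  assumes d: "1 \<le> d" and E: "E \<in> SNBC k d" and M: "psd (d * d) M"
    and W: "\<And>\<eta>. tensor_rank_le k d d (\<lambda>a b. \<eta> (a * d + b)) \<Longrightarrow>
      0 \<le> Re (\<Sum>r<d * d. \<Sum>s<d * d. W r s * (\<eta> r * cnj (\<eta> s)))"
  shows "0 \<le> Re (\<Sum>i<d. \<Sum>a<d. \<Sum>j<d. \<Sum>b<d. W (i * d + a) (j * d + b) * partial_pairing d E M i j a b)"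
proof -
  obtain L :: nat and \<chi> where rk: "\<And>l. l < L \<Longrightarrow> tensor_rank_le k d d (\<lambda>a b. \<chi> l (a * d + b))"
    and kr: "\<And>i j a b. i < d \<Longrightarrow> j < d \<Longrightarrow> a < d \<Longrightarrow> b < d \<Longrightarrow>
      E (unit_mat d i j) $$ (a, b) = (\<Sum>l<L. \<chi> l (i * d + a) * cnj (\<chi> l (j * d + b)))"
    using SNBC_D[OF d E] by blast
  obtain \<mu> where \<mu>: "\<And>r s. r < d * d \<Longrightarrow> s < d * d \<Longrightarrow> M $$ (r, s) = (\<Sum>l<d * d. \<mu> l r * cnj (\<mu> l s))"
    using psd_gram[OF M] by blast
  \<comment> \<open>The Gram vector \<mu> n of the effect, conjugated and read as a d by d matrix,
    contracts the output leg p of the Choi vector and puts the leg of Bob's own state in its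
    place.\<close>
  define \<eta> where "\<eta> l n r = (\<Sum>p<d. \<chi> l ((r div d) * d + p) * cnj (\<mu> n (p * d + r mod d)))" for l n r
  have \<eta>rk: "tensor_rank_le k d d (\<lambda>a b. \<eta> l n (a * d + b))" if "l < L" for l n
    using tensor_rank_le_contract_right[OF rk[OF that], of d "\<lambda>p a. cnj (\<mu> n (p * d + a))"]
    unfolding tensor_rank_le_def \<eta>_def by simp
  have pp: "partial_pairing d E M i j a b =
      (\<Sum>l<L. \<Sum>n<d * d. \<eta> l n (i * d + a) * cnj (\<eta> l n (j * d + b)))"
    if "i < d" "j < d" "a < d" "b < d" for i j a b
  proof -
    have "partial_pairing d E M i j a b = (\<Sum>p<d. \<Sum>q<d.
        (\<Sum>l<L. \<chi> l (i * d + p) * cnj (\<chi> l (j * d + q))) * (\<Sum>n<d * d. \<mu> n (q * d + b) * cnj (\<mu> n (p * d + a))))"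
      unfolding partial_pairing_def using that
      by (intro sum.cong refl) (simp add: kr \<mu> tensor_index_less)
    also have "\<dots> = (\<Sum>p<d. \<Sum>q<d. \<Sum>l<L. \<Sum>n<d * d.
        (\<chi> l (i * d + p) * cnj (\<mu> n (p * d + a))) * cnj (\<chi> l (j * d + q) * cnj (\<mu> n (q * d + b))))"
      by (simp only: sum_product) (simp add: mult_ac)
    also have "\<dots> = (\<Sum>l<L. \<Sum>n<d * d. \<Sum>p<d. \<Sum>q<d.
        (\<chi> l (i * d + p) * cnj (\<mu> n (p * d + a))) * cnj (\<chi> l (j * d + q) * cnj (\<mu> n (q * d + b))))"
      by (simp only: sum.cartesian_product case_prod_unfold, rule sum.reindex_bij_witness[of _
        "\<lambda>(l, n, p, q). (p, q, l, n)" "\<lambda>(p, q, l, n). (l, n, p, q)"]) auto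
    also have "\<dots> = (\<Sum>l<L. \<Sum>n<d * d. (\<Sum>p<d. \<chi> l (i * d + p) * cnj (\<mu> n (p * d + a))) *
        cnj (\<Sum>q<d. \<chi> l (j * d + q) * cnj (\<mu> n (q * d + b))))"
      by (simp only: sum_product cnj_sum)
    finally show ?thesis using that by (simp add: \<eta>_def)
  qed
  have "(\<Sum>i<d. \<Sum>a<d. \<Sum>j<d. \<Sum>b<d. W (i * d + a) (j * d + b) * partial_pairing d E M i j a b) =
      (\<Sum>i<d. \<Sum>a<d. \<Sum>j<d. \<Sum>b<d. \<Sum>l<L. \<Sum>n<d * d.
        W (i * d + a) (j * d + b) * (\<eta> l n (i * d + a) * cnj (\<eta> l n (j * d + b))))"
    by (intro sum.cong refl) (simp add: pp sum_distrib_left)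
  also have "\<dots> = (\<Sum>l<L. \<Sum>n<d * d. \<Sum>i<d. \<Sum>a<d. \<Sum>j<d. \<Sum>b<d.
        W (i * d + a) (j * d + b) * (\<eta> l n (i * d + a) * cnj (\<eta> l n (j * d + b))))"
    by (simp only: sum.cartesian_product case_prod_unfold, rule sum.reindex_bij_witness[of _
      "\<lambda>(l, n, i, a, j, b). (i, a, j, b, l, n)" "\<lambda>(i, a, j, b, l, n). (l, n, i, a, j, b)"]) auto
  also have "\<dots> = (\<Sum>l<L. \<Sum>n<d * d. \<Sum>r<d * d. \<Sum>s<d * d. W r s * (\<eta> l n r * cnj (\<eta> l n s)))"
    by (rule sum.cong[OF refl], rule sum.cong[OF refl]) (simp only: sum_tensor_index[of _ d d])
  finally have e: "(\<Sum>i<d. \<Sum>a<d. \<Sum>j<d. \<Sum>b<d. W (i * d + a) (j * d + b) * partial_pairing d E M i j a b) =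
      (\<Sum>l<L. \<Sum>n<d * d. \<Sum>r<d * d. \<Sum>s<d * d. W r s * (\<eta> l n r * cnj (\<eta> l n s)))" .
  have "0 \<le> (\<Sum>l<L. \<Sum>n<d * d. Re (\<Sum>r<d * d. \<Sum>s<d * d. W r s * (\<eta> l n r * cnj (\<eta> l n s))))"
    by (intro sum_nonneg W \<eta>rk) simp
  then show ?thesis unfolding e by (simp only: Re_sum)
qed

theorem theorem1:
  fixes d k :: nat and N :: "complex mat \<Rightarrow> complex mat"
  assumes "d \<ge> 1" and "k \<ge> 1"
    and "quantum_channel d N" and "N \<notin> SNBC k d"
  shows "\<exists>G. semiquantum_game d G \<and>
    (\<exists>M. povm (d * dimB G) (nOut G) M \<and> avg_payoff G N M < 0) \<and>
    (\<forall>E \<in> SNBC k d. \<forall>M. povm (d * dimB G) (nOut G) M \<longrightarrow> avg_payoff G E M \<ge> 0)"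
proof -
  have "d \<noteq> 1" using SNBC_1 assms by blast
  then have d: "2 \<le> d" using assms(1) by simp
  have lin: "linear_on_mats d N" using assms(3) by (simp add: quantum_channel_def)
  obtain W where WN: "Re (\<Sum>r<d * d. \<Sum>s<d * d. W r s * id_tensor d d N (max_entangled d) $$ (r, s)) < 0"
    and WS: "\<And>\<eta>. tensor_rank_le k d d (\<lambda>a b. \<eta> (a * d + b)) \<Longrightarrow>
      0 \<le> Re (\<Sum>r<d * d. \<Sum>s<d * d. W r s * (\<eta> r * cnj (\<eta> s)))"
    using non_SNBC_witness[OF assms] by blast
  have G: "dimB (witness_game d W) = d" "nOut (witness_game d W) = 2"
    by (simp_all add: witness_game_def Let_def)
  have "avg_payoff (witness_game d W) N
      (\<lambda>b. if b = 0 then max_entangled d else 1\<^sub>m (d * d) - max_entangled d) < 0"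
  proof -
    have "(\<Sum>i<d. \<Sum>a<d. \<Sum>j<d. \<Sum>b<d.
        W (i * d + a) (j * d + b) * partial_pairing d N (max_entangled d) i j a b) =
      (\<Sum>r<d * d. \<Sum>s<d * d. W r s * id_tensor d d N (max_entangled d) $$ (r, s))"
      unfolding sum_tensor_index by (intro sum.cong refl) (simp add: partial_pairing_max_entangled[OF lin])
    moreover have "0 < (1 / real (d * d * 4))\<^sup>2" using d by simp
    ultimately show ?thesis
      using WN by (simp only: witness_game_payoff[OF assms(3) max_entangled_povm]
          simp_thms if_True mult_pos_neg)
  qed
  moreover have "0 \<le> avg_payoff (witness_game d W) E M" if "E \<in> SNBC k d" "povm (d * d) 2 M" for E M
  proof -
    have E: "quantum_channel d E" using that(1) by (simp add: SNBC_def)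
    have "psd (d * d) (M 0)" using that(2) by (simp add: povm_def)
    from SNBC_payoff_nonneg[OF assms(1) that(1) this WS] show ?thesis
      by (simp only: witness_game_payoff[OF E that(2)]) (intro mult_nonneg_nonneg, simp_all)
  qed
  ultimately show ?thesis
    using witness_game_valid[OF d, of W] max_entangled_povm[of d]
    by (intro exI[of _ "witness_game d W"]) (auto simp: G)
qed

end
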